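(* Let $\mathcal{F}$ be a family of languages, and let $\tau$ be one of the following six classes of combings: synchronous combings, boundedly asynchronous combings, asynchronous combings, synchronous bicombings, boundedly asynchronous bicombings, asynchronous bicombings. Let $G$ be a finitely generated group. (a) Let $N$ be a finite normal subgroup of $G$. If $G$ has an $\mathcal{F}$-combing of type $\tau$, then so does $G/N$. Conversely, if $\mathcal{F}$ is closed under concatenation with a finite set, and $G/N$ has an $\mathcal{F}$-combing of type $\tau$, then so does $G$. (b) Suppose that $\mathcal{F}$ is closed under concatenation with a finite set. If $G$ has an asynchronous (respectively boundedly asynchronous, respectively synchronous) $\mathcal{F}$-combing, then so does any group $J$ of which $G$ is a subgroup of finite index. (c) Suppose that $\mathcal{F}$ is closed under $\epsilon$-free GSM mappings and under limited deletion. If $G$ has an $\mathcal{F}$-combing $L$ of type $\tau$, then (i) $G$ has an $\mathcal{F}$-combing of type $\tau$ over any finite generating set of $G$; (ii) any subgroup $H$ of finite index in $G$ has an $\mathcal{F}$-combing of type $\tau$; if $L$ is bijective, then so is the combing for $H$.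
   Context: Generating sets are finite and inverse closed (they contain the inverse of each of their elements). A generating set is regarded as an alphabet of symbols mapping to group elements; distinct symbols may represent the same group element. For a group $G$ with identity $e$ and generating set $X$, $X^*$ is the set of all words over $X$; $w=_G v$ means that $w,v$ represent the same element of $G$; $l(w)$ is the length of $w$ as a string. $\Gamma_{G,X}$ is the Cayley graph (an edge labelled $x$ from $g$ to $gx$), and $d_{G,X}$ is the graph distance on vertices, extended to the path metric on the 1-skeleton. A word $w$ is identified with the path from $e$ labelled by $w$: for $0\le t<l(w)$, $w(t)$ is the point at distance $t$ along the path, and $w(t)=w(l(w))$ for $t\ge l(w)$. More generally a word such as $xv$ is treated as a path in the same way. Words $v,w$ synchronously $K$-fellow travel if $d_{G,X}(v(t),w(t))\le K$ for all $t$. They asynchronously $K$-fellow travel if there is a strictly increasing differentiable $h:\mathbf{R}\to\mathbf{R}$ mapping $[0,l(v)]$ onto $[0,l(w)]$ with $d_{G,X}(v(t),w(h(t)))\le K$ for all $t>0$; they do so with bound $M$ if moreover $1/M\le h'(t)\le M$ for all $t\le l(v)$. A language for $G$ over $X$ is a subset $L\subseteq X^*$ containing at least one representative of each element of $G$; it is bijective if it contains exactly one of each. $L$ is a synchronous (resp. asynchronous) combing if there is a constant $K$ such that all pairs $v,w\in L$ with $w=_G vx$ for some $x\in X\cup\{e\}$ synchronously (resp. asynchronously) $K$-fellow travel. It is a synchronous (resp. asynchronous) bicombing if moreover, for all $v,w\in L$ and $x\in X$ with $w=_G xv$, the words $xv$ and $w$ synchronously (resp. asynchronously) $K$-fellow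 travel. An asynchronous combing or bicombing is boundedly asynchronous if there is a constant $M$ such that all the relevant pairs asynchronously fellow travel with bound $M$. A combing is a language of any of these six types; a combing has type $\tau$ if it lies in class $\tau$. A group has a combing of a given kind if it has one over some finite generating set. A family of languages $\mathcal{F}$ is any non-empty set of languages over finite alphabets (languages differing only by a renaming of alphabet symbols are regarded as equivalent). An $\mathcal{F}$-combing is a combing which is a language in $\mathcal{F}$. Closed under concatenation with a finite set: if $L\in\mathcal{F}$ and $S$ is a finite set of words then $LS=\{uv: u\in L, v\in S\}\in\mathcal{F}$. A generalised sequential machine (GSM) is a possibly non-deterministic finite state automaton with an output string: each transition appends a (possibly trivial) word to the output string, and when an input word is accepted the current output string is output; the associated GSM mapping sends a language to the set of all outputs produced from accepted words of the language. It is $\epsilon$-free if the output on every transition is non-trivial. Closed under limited deletion: if $L\in\mathcal{F}$ and $h$ is a homomorphism of free monoids such that, for some constant $K$, $h$ maps at most $K$ consecutive symbols in any string of $L$ to the empty word $\epsilon$, then $h(L)\in\mathcal{F}$. *)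

theory Defs
  imports Complex_Main "HOL-Algebra.Coset" "HOL-Algebra.Generated_Groups"
begin

section \<open>Generating sets and words\<close>

text \<open>
  Symbols are natural numbers; since languages matter only up to renaming of symbols, this
  covers all finite alphabets. A generating set is an alphabet \<open>X\<close> together with a map \<open>\<phi>\<close>
  from symbols to group elements, not required to be injective.

  As usual for alphabets, \<open>X\<close> is non-empty. This only affects the trivial group over the empty
  alphabet, where \<open>{\<epsilon>}\<close> would be an asynchronous bicombing, although over a non-empty
  alphabet no asynchronous bicombing contains \<open>\<epsilon>\<close>.
\<close>

definition finitely_generated :: "('a, 'm) monoid_scheme \<Rightarrow> bool" where
  "finitely_generated G \<longleftrightarrow>
     (\<exists>S. finite S \<and> S \<subseteq> carrier G \<and> generate G S = carrier G)"

definition generating_set :: "('a, 'm) monoid_scheme \<Rightarrow> nat set \<Rightarrow> (nat \<Rightarrow> 'a) \<Rightarrow> bool" where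
  "generating_set G X \<phi> \<longleftrightarrow>
     finite X \<and> X \<noteq> {} \<and> \<phi> ` X \<subseteq> carrier G \<and>
     (\<forall>x\<in>X. \<exists>y\<in>X. \<phi> y = inv\<^bsub>G\<^esub> (\<phi> x)) \<and>
     generate G (\<phi> ` X) = carrier G"

definition word_val :: "('a, 'm) monoid_scheme \<Rightarrow> (nat \<Rightarrow> 'a) \<Rightarrow> nat list \<Rightarrow> 'a" where
  "word_val G \<phi> w = foldr (\<lambda>x g. \<phi> x \<otimes>\<^bsub>G\<^esub> g) w \<one>\<^bsub>G\<^esub>"

section \<open>The Cayley graph and its path metric\<close>

definition cayley_adj :: "('a, 'm) monoid_scheme \<Rightarrow> nat set \<Rightarrow> (nat \<Rightarrow> 'a) \<Rightarrow> ('a \<times> 'a) set" where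
  "cayley_adj G X \<phi> = {(g, g \<otimes>\<^bsub>G\<^esub> \<phi> x) | g x. g \<in> carrier G \<and> x \<in> X}"

definition cayley_dist ::
    "('a, 'm) monoid_scheme \<Rightarrow> nat set \<Rightarrow> (nat \<Rightarrow> 'a) \<Rightarrow> 'a \<Rightarrow> 'a \<Rightarrow> nat" where
  "cayley_dist G X \<phi> g h =
     (LEAST n. (g, h) \<in> (cayley_adj G X \<phi> \<union> (cayley_adj G X \<phi>)\<inverse>) ^^ n)"

text \<open>
  Points of the 1-skeleton: \<open>On_Edge g x s\<close> is the point at distance \<open>s \<in> [0, 1]\<close> from \<open>g\<close> along
  the edge labelled \<open>x\<close> from \<open>g\<close> to \<open>g x\<close>. For \<open>s = 0\<close> or \<open>s = 1\<close> it is an endpoint of that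
  edge, hence at distance 0 from the corresponding \<open>Vertex\<close>.
\<close>

datatype 'a skel_point = Vertex 'a | On_Edge 'a nat real

text \<open>The vertices through which a path can leave the edge containing a point, with their
  distances from the point along that edge.\<close>

fun exits :: "('a, 'm) monoid_scheme \<Rightarrow> (nat \<Rightarrow> 'a) \<Rightarrow> 'a skel_point \<Rightarrow> ('a \<times> real) set" where
  "exits G \<phi> (Vertex g) = {(g, 0)}"
| "exits G \<phi> (On_Edge g x s) = {(g, s), (g \<otimes>\<^bsub>G\<^esub> \<phi> x, 1 - s)}"

text \<open>The length of the path between two points that stays inside a single edge, if any.\<close>

fun within_edge :: "'a skel_point \<Rightarrow> 'a skel_point \<Rightarrow> real set" where
  "within_edge (On_Edge g x s) (On_Edge h y t) = (if g = h \<and> x = y then {\<bar>s - t\<bar>} else {})"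
| "within_edge _ _ = {}"

text \<open>
  A shortest path between two points either stays inside one edge or leaves the edge of the
  first point through an endpoint, follows a graph geodesic to an endpoint of the edge of the
  second point, and continues along that edge.
\<close>

definition skel_dist ::
    "('a, 'm) monoid_scheme \<Rightarrow> nat set \<Rightarrow> (nat \<Rightarrow> 'a) \<Rightarrow> 'a skel_point \<Rightarrow> 'a skel_point \<Rightarrow> real" where
  "skel_dist G X \<phi> p q =
     Min ((\<lambda>((g, s), (h, t)). s + real (cayley_dist G X \<phi> g h) + t) ` (exits G \<phi> p \<times> exits G \<phi> q)
          \<union> within_edge p q)"

text \<open>The point \<open>w(t)\<close> of the path from the identity labelled by \<open>w\<close>, for \<open>t \<ge> 0\<close>.\<close>

definition path_point ::
    "('a, 'm) monoid_scheme \<Rightarrow> (nat \<Rightarrow> 'a) \<Rightarrow> nat list \<Rightarrow> real \<Rightarrow> 'a skel_point" where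
  "path_point G \<phi> w t =
     (if t < real (length w)
      then On_Edge (word_val G \<phi> (take (nat \<lfloor>t\<rfloor>) w)) (w ! nat \<lfloor>t\<rfloor>) (frac t)
      else Vertex (word_val G \<phi> w))"

section \<open>Fellow travelling\<close>

definition sync_ft ::
    "('a, 'm) monoid_scheme \<Rightarrow> nat set \<Rightarrow> (nat \<Rightarrow> 'a) \<Rightarrow> real \<Rightarrow> nat list \<Rightarrow> nat list \<Rightarrow> bool" where
  "sync_ft G X \<phi> K v w \<longleftrightarrow>
     (\<forall>t\<ge>0. skel_dist G X \<phi> (path_point G \<phi> v t) (path_point G \<phi> w t) \<le> K)"

definition async_ft_by ::
    "('a, 'm) monoid_scheme \<Rightarrow> nat set \<Rightarrow> (nat \<Rightarrow> 'a) \<Rightarrow> real \<Rightarrow> nat list \<Rightarrow> nat list \<Rightarrow>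
     (real \<Rightarrow> real) \<Rightarrow> (real \<Rightarrow> real) \<Rightarrow> bool" where
  "async_ft_by G X \<phi> K v w h h' \<longleftrightarrow>
     strict_mono h \<and> (\<forall>t. (h has_real_derivative h' t) (at t)) \<and>
     h ` {0..real (length v)} = {0..real (length w)} \<and>
     (\<forall>t>0. skel_dist G X \<phi> (path_point G \<phi> v t) (path_point G \<phi> w (h t)) \<le> K)"

definition async_ft ::
    "('a, 'm) monoid_scheme \<Rightarrow> nat set \<Rightarrow> (nat \<Rightarrow> 'a) \<Rightarrow> real \<Rightarrow> nat list \<Rightarrow> nat list \<Rightarrow> bool" where
  "async_ft G X \<phi> K v w \<longleftrightarrow> (\<exists>h h'. async_ft_by G X \<phi> K v w h h')"

definition bd_async_ft ::
    "('a, 'm) monoid_scheme \<Rightarrow> nat set \<Rightarrow> (nat \<Rightarrow> 'a) \<Rightarrow> real \<Rightarrow> real \<Rightarrow> nat list \<Rightarrow> nat list \<Rightarrow> bool" where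
  "bd_async_ft G X \<phi> K M v w \<longleftrightarrow>
     (\<exists>h h'. async_ft_by G X \<phi> K v w h h' \<and>
             (\<forall>t\<le>real (length v). 1 / M \<le> h' t \<and> h' t \<le> M))"

section \<open>Combings\<close>

definition language_for ::
    "('a, 'm) monoid_scheme \<Rightarrow> nat set \<Rightarrow> (nat \<Rightarrow> 'a) \<Rightarrow> nat list set \<Rightarrow> bool" where
  "language_for G X \<phi> L \<longleftrightarrow>
     L \<subseteq> lists X \<and> (\<forall>g\<in>carrier G. \<exists>w\<in>L. word_val G \<phi> w = g)"

definition bijective_language ::
    "('a, 'm) monoid_scheme \<Rightarrow> nat set \<Rightarrow> (nat \<Rightarrow> 'a) \<Rightarrow> nat list set \<Rightarrow> bool" where
  "bijective_language G X \<phi> L \<longleftrightarrow>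
     L \<subseteq> lists X \<and> (\<forall>g\<in>carrier G. \<exists>!w. w \<in> L \<and> word_val G \<phi> w = g)"

text \<open>Here \<open>R\<close> is the fellow traveller relation demanded of the relevant pairs of words.\<close>

definition combing_wrt ::
    "('a, 'm) monoid_scheme \<Rightarrow> nat set \<Rightarrow> (nat \<Rightarrow> 'a) \<Rightarrow> nat list set \<Rightarrow>
     (nat list \<Rightarrow> nat list \<Rightarrow> bool) \<Rightarrow> bool" where
  "combing_wrt G X \<phi> L R \<longleftrightarrow>
     language_for G X \<phi> L \<and>
     (\<forall>v\<in>L. \<forall>w\<in>L. \<forall>g \<in> \<phi> ` X \<union> {\<one>\<^bsub>G\<^esub>}.
        word_val G \<phi> w = word_val G \<phi> v \<otimes>\<^bsub>G\<^esub> g \<longrightarrow> R v w)"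

definition bicombing_wrt ::
    "('a, 'm) monoid_scheme \<Rightarrow> nat set \<Rightarrow> (nat \<Rightarrow> 'a) \<Rightarrow> nat list set \<Rightarrow>
     (nat list \<Rightarrow> nat list \<Rightarrow> bool) \<Rightarrow> bool" where
  "bicombing_wrt G X \<phi> L R \<longleftrightarrow>
     combing_wrt G X \<phi> L R \<and>
     (\<forall>v\<in>L. \<forall>w\<in>L. \<forall>x\<in>X.
        word_val G \<phi> w = word_val G \<phi> (x # v) \<longrightarrow> R (x # v) w)"

datatype combing_type =
    Sync | Bd_Async | Async
  | Sync_Bi | Bd_Async_Bi | Async_Bi

fun combing ::
    "combing_type \<Rightarrow> ('a, 'm) monoid_scheme \<Rightarrow> nat set \<Rightarrow> (nat \<Rightarrow> 'a) \<Rightarrow> nat list set \<Rightarrow> bool" where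
  "combing Sync G X \<phi> L \<longleftrightarrow> (\<exists>K. combing_wrt G X \<phi> L (sync_ft G X \<phi> K))"
| "combing Bd_Async G X \<phi> L \<longleftrightarrow> (\<exists>K M. combing_wrt G X \<phi> L (bd_async_ft G X \<phi> K M))"
| "combing Async G X \<phi> L \<longleftrightarrow> (\<exists>K. combing_wrt G X \<phi> L (async_ft G X \<phi> K))"
| "combing Sync_Bi G X \<phi> L \<longleftrightarrow> (\<exists>K. bicombing_wrt G X \<phi> L (sync_ft G X \<phi> K))"
| "combing Bd_Async_Bi G X \<phi> L \<longleftrightarrow> (\<exists>K M. bicombing_wrt G X \<phi> L (bd_async_ft G X \<phi> K M))"
| "combing Async_Bi G X \<phi> L \<longleftrightarrow> (\<exists>K. bicombing_wrt G X \<phi> L (async_ft G X \<phi> K))"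

section \<open>Families of languages\<close>

text \<open>Identifying languages that differ by a renaming of symbols means that membership in a
  family is invariant under renamings.\<close>

definition language_family :: "nat list set set \<Rightarrow> bool" where
  "language_family F \<longleftrightarrow>
     F \<noteq> {} \<and>
     (\<forall>L\<in>F. finite (\<Union>(set ` L))) \<and>
     (\<forall>L\<in>F. \<forall>f. inj_on f (\<Union>(set ` L)) \<longrightarrow> map f ` L \<in> F)"

definition F_combing ::
    "nat list set set \<Rightarrow> combing_type \<Rightarrow>
     ('a, 'm) monoid_scheme \<Rightarrow> nat set \<Rightarrow> (nat \<Rightarrow> 'a) \<Rightarrow> nat list set \<Rightarrow> bool" where
  "F_combing F \<tau> G X \<phi> L \<longleftrightarrow> generating_set G X \<phi> \<and> combing \<tau> G X \<phi> L \<and> L \<in> F"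

definition has_F_combing ::
    "nat list set set \<Rightarrow> combing_type \<Rightarrow> ('a, 'm) monoid_scheme \<Rightarrow> bool" where
  "has_F_combing F \<tau> G \<longleftrightarrow> (\<exists>X \<phi> L. F_combing F \<tau> G X \<phi> L)"

definition closed_finite_concat :: "nat list set set \<Rightarrow> bool" where
  "closed_finite_concat F \<longleftrightarrow>
     (\<forall>L\<in>F. \<forall>S. finite S \<longrightarrow> {u @ v | u v. u \<in> L \<and> v \<in> S} \<in> F)"

text \<open>A transition \<open>(q, a, z, q')\<close> reads the symbol \<open>a\<close>, appends the word \<open>z\<close> to the output, and
  moves from state \<open>q\<close> to state \<open>q'\<close>.\<close>

record gsm =
  gsm_states :: "nat set"
  gsm_start :: nat
  gsm_accepting :: "nat set"
  gsm_trans :: "(nat \<times> nat \<times> nat list \<times> nat) set"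

definition is_gsm :: "gsm \<Rightarrow> bool" where
  "is_gsm T \<longleftrightarrow>
     finite (gsm_states T) \<and> gsm_start T \<in> gsm_states T \<and> gsm_accepting T \<subseteq> gsm_states T \<and> finite (gsm_trans T) \<and>
     (\<forall>(q, a, z, q') \<in> gsm_trans T. q \<in> gsm_states T \<and> q' \<in> gsm_states T)"

definition eps_free_gsm :: "gsm \<Rightarrow> bool" where
  "eps_free_gsm T \<longleftrightarrow> (\<forall>(q, a, z, q') \<in> gsm_trans T. z \<noteq> [])"

inductive gsm_run :: "gsm \<Rightarrow> nat \<Rightarrow> nat list \<Rightarrow> nat list \<Rightarrow> nat \<Rightarrow> bool" for T where
  gsm_run_Nil: "gsm_run T q [] [] q"
| gsm_run_Cons: "(q, a, z, q') \<in> gsm_trans T \<Longrightarrow> gsm_run T q' u v q'' \<Longrightarrow>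
     gsm_run T q (a # u) (z @ v) q''"

definition gsm_mapping :: "gsm \<Rightarrow> nat list set \<Rightarrow> nat list set" where
  "gsm_mapping T L = {v. \<exists>u\<in>L. \<exists>q\<in>gsm_accepting T. gsm_run T (gsm_start T) u v q}"

definition closed_eps_free_gsm :: "nat list set set \<Rightarrow> bool" where
  "closed_eps_free_gsm F \<longleftrightarrow>
     (\<forall>L\<in>F. \<forall>T. is_gsm T \<and> eps_free_gsm T \<longrightarrow> gsm_mapping T L \<in> F)"

text \<open>The homomorphism of free monoids determined by its values on symbols.\<close>

definition word_hom :: "(nat \<Rightarrow> nat list) \<Rightarrow> nat list \<Rightarrow> nat list" where
  "word_hom h w = concat (map h w)"

definition closed_limited_deletion :: "nat list set set \<Rightarrow> bool" where
  "closed_limited_deletion F \<longleftrightarrow>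
     (\<forall>L\<in>F. \<forall>h.
        (\<exists>K. \<forall>p u s. p @ u @ s \<in> L \<and> word_hom h u = [] \<longrightarrow> length u \<le> K)
        \<longrightarrow> word_hom h ` L \<in> F)"

end

theory Submission
  imports Defs "HOL-Library.Nat_Bijection"
begin

text \<open>
  The idea is to forget the Cayley graph. A word over any alphabet gives a trajectory, the sequence
  of group elements at its prefixes, and two points of trajectories are close if their difference
  \<open>p\<inverse> q\<close> lies in a fixed finite set. As balls in the word metric are finite, this gives the same
  notion of fellow travelling, up to constants (\<open>fellow_travelling_words\<close>). Chaining along words that
  spell a group element \<open>g\<close> then shows that a combing of any of the six types is the same as
  a set of trajectories in which all \<open>v\<close> and \<open>w\<close> with \<open>w = v g\<close>, and for bicombings also \<open>g v\<close> and
  \<open>w\<close> with \<open>w = g v\<close>, fellow travel uniformly for each fixed \<open>g\<close> (\<open>combing_iff_coarse\<close>). The latter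
  condition no longer mentions generators.

  Each part of the theorem is then a construction of words together with the remark that it
  changes the differences \<open>p\<inverse> q\<close> in a controlled way. For a finite normal subgroup, differences
  are mapped to the quotient, or pulled back from it along a map with finite fibres
  (\<open>combing_image\<close>, \<open>combing_lift\<close>). For an overgroup of finite index, elements are written as \<open>g t\<close>
  with \<open>t\<close> in a finite transversal (\<open>combing_finite_index_overgroup\<close>). For a subgroup of finite
  index, words are rewritten by the Schreier process, letter by letter
  (\<open>combing_finite_index_subgroup\<close>).

  Two of the constructions change the lengths of words. Appending a letter, or prefixing one, shifts
  time by one unit. In a change of generators each letter is replaced by a word, and the synchronous
  case requires that the new words be traversed at constant speed. Words representing the
  generators can be padded to a common length only up to parity; a machine with two states
  carries the surplus letter over to the next generator, so that after \<open>i\<close> letters the output has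
  length \<open>n i\<close> or \<open>n i + 1\<close> (\<open>combing_change_generators\<close>). In all cases the new trajectory is, within
  bounded distance, the old one slowed down by an integral factor, and a linear reparametrisation
  suffices (\<open>fellow_travelling_dilation\<close>).
\<close>

section \<open>Time changes\<close>

text \<open>A combing type is a timing together with the choice between combings and bicombings. All
  arguments below are uniform in the timing.\<close>
datatype timing = Synchronous | Bounded | Unbounded

text \<open>The admissible reparametrisations between a path of length \<open>m\<close> and one of length \<open>n\<close>.
  Synchronous travel involves no reparametrisation, and then the lengths need not be related.\<close>
definition time_change :: "timing \<Rightarrow> real \<Rightarrow> nat \<Rightarrow> nat \<Rightarrow> (real \<Rightarrow> real) \<Rightarrow> bool" where
  "time_change c M m n h \<longleftrightarrow>
     (if c = Synchronous then h = (\<lambda>t. t)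
      else strict_mono h \<and> h ` {0..real m} = {0..real n} \<and>
        (\<exists>h'. (\<forall>t. (h has_real_derivative h' t) (at t)) \<and>
              (c = Bounded \<longrightarrow> 1 \<le> M \<and> (\<forall>t\<le>real m. 1 / M \<le> h' t \<and> h' t \<le> M))))"

lemma time_change_ends:
  assumes "time_change c M m n h" "c \<noteq> Synchronous"
  shows "h 0 = 0" "h (real m) = real n"
proof -
  have mono: "strict_mono h" and im: "h ` {0..real m} = {0..real n}"
    using assms by (auto simp: time_change_def)
  have "0 \<in> {0..real m}" "real m \<in> {0..real m}" by simp_all
  then have a: "h 0 \<in> {0..real n}" "h (real m) \<in> {0..real n}"
    using im by (blast intro: imageI)+
  have "0 \<in> {0..real n}" "real n \<in> {0..real n}" by simp_all
  then obtain r s where r: "r \<in> {0..real m}" "h r = 0" and s: "s \<in> {0..real m}" "h s = real n"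
    unfolding im[symmetric] by (metis imageE)
  have "h 0 \<le> h r" "h s \<le> h (real m)"
    using r(1) s(1) strict_mono_less_eq[OF mono] by simp_all
  then show "h 0 = 0" "h (real m) = real n" using a r(2) s(2) by simp_all
qed

lemma time_change_pos:
  assumes "time_change c M m n h" "t > 0"
  shows "h t > 0"
proof (cases "c = Synchronous")
  case True
  then show ?thesis using assms by (simp add: time_change_def)
next
  case False
  then show ?thesis
    using time_change_ends(1)[OF assms(1) False] assms strict_monoD[of h 0 t]
    by (auto simp: time_change_def)
qed

text \<open>A strictly increasing \<open>h\<close> cannot carry a point onto a proper interval. Hence an
  asynchronous fellow traveller of the empty word is empty; this is the one degenerate case that
  has to be watched throughout.\<close>
lemma time_change_empty:
  assumes "time_change c M m n h" "c \<noteq> Synchronous"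
  shows "m = 0 \<longleftrightarrow> n = 0"
proof -
  have "strict_mono h" using assms by (simp add: time_change_def)
  from strict_mono_eq[OF this, of 0 "real m"] show ?thesis
    using time_change_ends[OF assms] by auto
qed

lemma time_change_mono:
  assumes "time_change c M m n h" "M \<le> M'"
  shows "time_change c M' m n h"
proof -
  have "1 / M' \<le> x \<and> x \<le> M'" if "1 \<le> M" "1 / M \<le> x" "x \<le> M" for x
  proof -
    have "1 / M' \<le> 1 / M" using that assms(2) by (intro divide_left_mono) auto
    then show ?thesis using that assms(2) by linarith
  qed
  note * = this
  show ?thesis
  proof (cases "c = Synchronous")
    case True
    then show ?thesis using assms by (simp add: time_change_def)
  next
    case False
    then obtain h' where "strict_mono h" "h ` {0..real m} = {0..real n}"
        "\<forall>t. (h has_real_derivative h' t) (at t)"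
        "c = Bounded \<longrightarrow> 1 \<le> M \<and> (\<forall>t\<le>real m. 1 / M \<le> h' t \<and> h' t \<le> M)"
      using assms(1) unfolding time_change_def by auto
    moreover from this(4) have
        "c = Bounded \<longrightarrow> 1 \<le> M' \<and> (\<forall>t\<le>real m. 1 / M' \<le> h' t \<and> h' t \<le> M')"
      using * assms(2) by fastforce
    ultimately show ?thesis using False unfolding time_change_def by auto
  qed
qed

lemma time_change_compose:
  assumes h: "time_change c M l m h" and k: "time_change c M' m n k"
  shows "time_change c (M * M') l n (\<lambda>t. k (h t))"
proof (cases "c = Synchronous")
  case True
  then show ?thesis using assms by (simp add: time_change_def)
next
  case False
  obtain h' where h': "strict_mono h" "h ` {0..real l} = {0..real m}"
      "\<And>t. (h has_real_derivative h' t) (at t)"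
      "c = Bounded \<Longrightarrow> 1 \<le> M \<and> (\<forall>t\<le>real l. 1 / M \<le> h' t \<and> h' t \<le> M)"
    using h False by (auto simp: time_change_def)
  obtain k' where k': "strict_mono k" "k ` {0..real m} = {0..real n}"
      "\<And>t. (k has_real_derivative k' t) (at t)"
      "c = Bounded \<Longrightarrow> 1 \<le> M' \<and> (\<forall>t\<le>real m. 1 / M' \<le> k' t \<and> k' t \<le> M')"
    using k False by (auto simp: time_change_def)
  have der: "((\<lambda>t. k (h t)) has_real_derivative k' (h t) * h' t) (at t)" for t
    using DERIV_chain2[OF k'(3) h'(3)] .
  have "1 / (M * M') \<le> k' (h t) * h' t \<and> k' (h t) * h' t \<le> M * M'"
    if c: "c = Bounded" and t: "t \<le> real l" for t
  proof -
    have "h t \<le> real m"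
      using strict_mono_less_eq[OF h'(1)] t time_change_ends(2)[OF h False] by metis
    then have k'b: "1 / M' \<le> k' (h t)" "k' (h t) \<le> M'" and M': "1 \<le> M'" using k'(4)[OF c] by auto
    have h'b: "1 / M \<le> h' t" "h' t \<le> M" and M: "1 \<le> M" using h'(4)[OF c] t by auto
    have "0 \<le> 1 / M" "0 \<le> 1 / M'" using M M' by auto
    then have "1 / M' * (1 / M) \<le> k' (h t) * h' t" "k' (h t) * h' t \<le> M' * M"
      using k'b h'b M M' by (intro mult_mono; linarith)+
    then show ?thesis by (simp add: mult.commute)
  qed
  moreover have "c = Bounded \<Longrightarrow> 1 \<le> M * M'"
    using h'(4) k'(4) mult_mono[of 1 M 1 M'] by auto
  moreover have "(\<lambda>t. k (h t)) ` {0..real l} = {0..real n}"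
    using h'(2) k'(2) by (metis image_image)
  moreover have "strict_mono (\<lambda>t. k (h t))"
    using h'(1) k'(1) by (simp add: strict_mono_def)
  ultimately show ?thesis using False der unfolding time_change_def
    by (simp del: image_image) (intro exI[of _ "\<lambda>t. k' (h t) * h' t"], simp)
qed

text \<open>Every reparametrisation constructed here is linear. The lengths in question only ever differ
  by a bounded amount, up to a fixed integral factor, so a linear map stays within bounded distance
  of the intended correspondence and no smoothing of piecewise linear maps is needed.\<close>
lemma time_change_linear:
  assumes "0 < m" "0 < n" "real n \<le> C * real m" "real m \<le> C * real n" "1 \<le> C"
    and "c \<noteq> Synchronous"
  shows "time_change c C m n (\<lambda>t. t * (real n / real m))"
proof -
  have r: "real n / real m > 0" using assms by simp
  have "(\<lambda>t. t * (real n / real m)) ` {0..real m} = {0..real n}" (is "?h ` _ = _")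
  proof (intro equalityI subsetI)
    fix s assume "s \<in> {0..real n}"
    then have "s = ?h (s * (real m / real n))" "s * (real m / real n) \<in> {0..real m}"
      using assms(1,2) by (simp_all add: field_simps)
    then show "s \<in> ?h ` {0..real m}" by blast
  next
    fix s assume "s \<in> ?h ` {0..real m}"
    then obtain t where t: "0 \<le> t" "t \<le> real m" "s = ?h t" by auto
    have "?h t \<le> real m * (real n / real m)" using t(1,2) r by (intro mult_right_mono) auto
    then show "s \<in> {0..real n}" using t assms(1) by simp
  qed
  moreover have "strict_mono ?h"
    using r by (intro strict_monoI mult_strict_right_mono)
  moreover have "(?h has_real_derivative real n / real m) (at t)" for t
    using assms(1) by (auto intro!: derivative_eq_intros)
  moreover have "1 / C \<le> real n / real m" "real n / real m \<le> C"
    using assms(1-5) by (simp_all add: divide_simps mult.commute)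
  ultimately show ?thesis using assms(5,6) unfolding time_change_def
    by (simp del: times_divide_eq_right) (intro exI[of _ "\<lambda>_. real n / real m"], simp)
qed

section \<open>Families of fellow travelling trajectories\<close>

text \<open>A trajectory is a length together with the group elements at the integer times. The later
  values count as well: a path rests at its end point.\<close>
type_synonym 'a trajectory = "nat \<times> (nat \<Rightarrow> 'a)"

text \<open>Closeness of two moving points is measured by membership of \<open>p\<inverse> q\<close> in a finite set rather than
  by a distance. This does not mention generators, so it can be compared between different
  generating sets and between a group, its subgroups and its quotients.\<close>
definition tracks ::
    "('a, 'm) monoid_scheme \<Rightarrow> 'a set \<Rightarrow> (real \<Rightarrow> real) \<Rightarrow> (nat \<Rightarrow> 'a) \<Rightarrow> (nat \<Rightarrow> 'a) \<Rightarrow> bool" where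
  "tracks G B h p q \<longleftrightarrow> range p \<subseteq> carrier G \<and> range q \<subseteq> carrier G \<and>
     (\<forall>t>0. inv\<^bsub>G\<^esub> (p (nat \<lfloor>t\<rfloor>)) \<otimes>\<^bsub>G\<^esub> q (nat \<lfloor>h t\<rfloor>) \<in> B)"

text \<open>One finite set and one derivative bound serve all pairs of the relation \<open>R\<close>. Treating a whole
  family of pairs as a relation hides the constants: chaining fellow travellers becomes relational
  composition.\<close>
definition fellow_travelling ::
    "timing \<Rightarrow> ('a, 'm) monoid_scheme \<Rightarrow> ('a trajectory \<times> 'a trajectory) set \<Rightarrow> bool" where
  "fellow_travelling c G R \<longleftrightarrow>
     (\<exists>B M. finite B \<and> (\<forall>m p n q. ((m, p), (n, q)) \<in> R \<longrightarrow>
        (\<exists>h. time_change c M m n h \<and> tracks G B h p q)))"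

lemma (in group) inv_mult_cancel:
  assumes "x \<in> carrier G" "y \<in> carrier G"
  shows "x \<otimes> (inv x \<otimes> y) = y" "inv x \<otimes> (x \<otimes> y) = y"
  using assms by (simp_all add: m_assoc[symmetric])

lemma fellow_travelling_subset:
  "fellow_travelling c G R \<Longrightarrow> R' \<subseteq> R \<Longrightarrow> fellow_travelling c G R'"
  unfolding fellow_travelling_def by (meson subsetD)

lemma fellow_travelling_empty: "fellow_travelling c G {}"
  unfolding fellow_travelling_def by auto

lemma fellow_travelling_Un:
  assumes "fellow_travelling c G R" "fellow_travelling c G R'"
  shows "fellow_travelling c G (R \<union> R')"
proof -
  obtain B M where BM: "finite B" "\<And>m p n q. ((m, p), (n, q)) \<in> R \<Longrightarrow>
      \<exists>h. time_change c M m n h \<and> tracks G B h p q"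
    using assms(1) unfolding fellow_travelling_def by blast
  obtain B' M' where BM': "finite B'" "\<And>m p n q. ((m, p), (n, q)) \<in> R' \<Longrightarrow>
      \<exists>h. time_change c M' m n h \<and> tracks G B' h p q"
    using assms(2) unfolding fellow_travelling_def by blast
  have "\<exists>h. time_change c (max M M') m n h \<and> tracks G (B \<union> B') h p q"
    if R: "((m, p), (n, q)) \<in> R \<union> R'" for m p n q
  proof -
    obtain h where "time_change c M m n h \<or> time_change c M' m n h"
        "tracks G B h p q \<or> tracks G B' h p q"
      using BM(2)[of m p n q] BM'(2)[of m p n q] R by blast
    moreover from this(1) have "time_change c (max M M') m n h"
      using time_change_mono max.cobounded1 max.cobounded2 by metis
    ultimately show ?thesis unfolding tracks_def by blast
  qed
  moreover have "finite (B \<union> B')" using BM(1) BM'(1) by simp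
  ultimately show ?thesis unfolding fellow_travelling_def by blast
qed

lemma fellow_travelling_UN:
  assumes "finite I" "\<And>i. i \<in> I \<Longrightarrow> fellow_travelling c G (R i)"
  shows "fellow_travelling c G (\<Union>i\<in>I. R i)"
  using assms
  by (induction I rule: finite_induct) (auto intro: fellow_travelling_empty fellow_travelling_Un)

lemma (in group) fellow_travelling_relcomp:
  assumes "fellow_travelling c G R" "fellow_travelling c G R'"
  shows "fellow_travelling c G (R O R')"
proof -
  obtain B M where BM: "finite B" "\<And>m p n q. ((m, p), (n, q)) \<in> R \<Longrightarrow>
      \<exists>h. time_change c M m n h \<and> tracks G B h p q"
    using assms(1) unfolding fellow_travelling_def by blast
  obtain B' M' where BM': "finite B'" "\<And>m p n q. ((m, p), (n, q)) \<in> R' \<Longrightarrow>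
      \<exists>h. time_change c M' m n h \<and> tracks G B' h p q"
    using assms(2) unfolding fellow_travelling_def by blast
  let ?B = "(\<lambda>(b, b'). b \<otimes> b') ` (B \<times> B')"
  have "\<exists>h. time_change c (M * M') m n h \<and> tracks G ?B h p q"
    if RR: "((m, p), (n, q)) \<in> R O R'" for m p n q
  proof -
    obtain U where "((m, p), U) \<in> R" "(U, (n, q)) \<in> R'"
      using RR by blast
    then obtain l r where lr: "((m, p), (l, r)) \<in> R" "((l, r), (n, q)) \<in> R'"
      by (cases U) blast
    obtain h where h: "time_change c M m l h" "tracks G B h p r" using BM(2)[OF lr(1)] by blast
    obtain k where k: "time_change c M' l n k" "tracks G B' k r q" using BM'(2)[OF lr(2)] by blast
    have car: "p i \<in> carrier G" "r i \<in> carrier G" "q i \<in> carrier G" for i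
      using h(2) k(2) unfolding tracks_def by auto
    have "inv (p (nat \<lfloor>t\<rfloor>)) \<otimes> q (nat \<lfloor>k (h t)\<rfloor>) \<in> ?B" if "t > 0" for t
    proof -
      have "inv (p (nat \<lfloor>t\<rfloor>)) \<otimes> r (nat \<lfloor>h t\<rfloor>) \<in> B" using h(2) that unfolding tracks_def by blast
      moreover have "inv (r (nat \<lfloor>h t\<rfloor>)) \<otimes> q (nat \<lfloor>k (h t)\<rfloor>) \<in> B'"
        using k(2) time_change_pos[OF h(1) that] unfolding tracks_def by blast
      moreover have "inv (p (nat \<lfloor>t\<rfloor>)) \<otimes> q (nat \<lfloor>k (h t)\<rfloor>) =
          (inv (p (nat \<lfloor>t\<rfloor>)) \<otimes> r (nat \<lfloor>h t\<rfloor>)) \<otimes> (inv (r (nat \<lfloor>h t\<rfloor>)) \<otimes> q (nat \<lfloor>k (h t)\<rfloor>))"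
        using car by (simp add: m_assoc inv_mult_cancel)
      ultimately show ?thesis by (intro image_eqI[OF _ SigmaI]) auto
    qed
    then have "tracks G ?B (\<lambda>t. k (h t)) p q" using car unfolding tracks_def by auto
    then show ?thesis using time_change_compose[OF h(1) k(1)] by blast
  qed
  moreover have "finite ?B" using BM(1) BM'(1) by simp
  ultimately show ?thesis unfolding fellow_travelling_def by blast
qed

text \<open>Replacing trajectories by others of the same lengths, possibly in another group, preserves
  fellow travelling under the same time changes as soon as differences in \<open>B\<close> go to differences
  in a finite set \<open>\<Phi> B\<close>.\<close>
lemma fellow_travelling_transfer:
  assumes "fellow_travelling c G R"
    and "\<And>B. finite B \<Longrightarrow> finite (\<Phi> B)"
    and "\<And>m p' n q'. ((m, p'), (n, q')) \<in> R' \<Longrightarrow> \<exists>p q. ((m, p), (n, q)) \<in> R \<and>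
       range p' \<subseteq> carrier G' \<and> range q' \<subseteq> carrier G' \<and>
       (\<forall>B i j. inv\<^bsub>G\<^esub> (p i) \<otimes>\<^bsub>G\<^esub> q j \<in> B \<longrightarrow> inv\<^bsub>G'\<^esub> (p' i) \<otimes>\<^bsub>G'\<^esub> q' j \<in> \<Phi> B)"
  shows "fellow_travelling c G' R'"
proof -
  obtain B M where BM: "finite B" "\<And>m p n q. ((m, p), (n, q)) \<in> R \<Longrightarrow>
      \<exists>h. time_change c M m n h \<and> tracks G B h p q"
    using assms(1) unfolding fellow_travelling_def by blast
  have "\<exists>h. time_change c M m n h \<and> tracks G' (\<Phi> B) h p' q'"
    if R': "((m, p'), (n, q')) \<in> R'" for m p' n q'
  proof -
    obtain p q where pq: "((m, p), (n, q)) \<in> R" "range p' \<subseteq> carrier G'" "range q' \<subseteq> carrier G'"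
       "\<And>B i j. inv\<^bsub>G\<^esub> (p i) \<otimes>\<^bsub>G\<^esub> q j \<in> B \<Longrightarrow> inv\<^bsub>G'\<^esub> (p' i) \<otimes>\<^bsub>G'\<^esub> q' j \<in> \<Phi> B"
      using assms(3)[OF R'] by meson
    obtain h where "time_change c M m n h" and h: "tracks G B h p q" using BM(2)[OF pq(1)] by blast
    moreover have "inv\<^bsub>G'\<^esub> (p' (nat \<lfloor>t\<rfloor>)) \<otimes>\<^bsub>G'\<^esub> q' (nat \<lfloor>h t\<rfloor>) \<in> \<Phi> B" if "t > 0" for t
      using h that pq(4) unfolding tracks_def by simp
    then have "tracks G' (\<Phi> B) h p' q'" using pq(2,3) unfolding tracks_def by simp
    ultimately show ?thesis by blast
  qed
  then show ?thesis using assms(2)[OF BM(1)] unfolding fellow_travelling_def by blast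
qed

lemma fellow_travelling_empty_iff:
  assumes "fellow_travelling c G R" "(P, Q) \<in> R" "c \<noteq> Synchronous"
  shows "fst P = 0 \<longleftrightarrow> fst Q = 0"
proof -
  obtain m p n q where "P = (m, p)" "Q = (n, q)" by (cases P; cases Q) blast
  then show ?thesis
    using assms time_change_empty[OF _ assms(3)] unfolding fellow_travelling_def by fastforce
qed

section \<open>Slowing trajectories down\<close>

text \<open>The trajectory \<open>P'\<close> runs through the same places as \<open>P\<close>, but \<open>k\<close> times more slowly: index
  \<open>i\<close> of \<open>P\<close> corresponds to index \<open>k * i\<close> of \<open>P'\<close>. The window \<open>k + 2\<close> is what rounding real times
  to integers costs. For \<open>k = 1\<close> this compares a word with the word obtained by adding a letter
  at either end.\<close>
definition dilation ::
    "timing \<Rightarrow> ('a, 'm) monoid_scheme \<Rightarrow> nat \<Rightarrow> 'a set \<Rightarrow> 'a trajectory \<Rightarrow> 'a trajectory \<Rightarrow> bool" where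
  "dilation c G k E = (\<lambda>(m, p) (m', p').
     range p \<subseteq> carrier G \<and> range p' \<subseteq> carrier G \<and>
     (c = Synchronous \<or> (m = 0 \<longleftrightarrow> m' = 0) \<and> \<bar>int m' - int (k * m)\<bar> \<le> 1) \<and>
     (\<forall>i j. \<bar>int j - int (k * i)\<bar> \<le> int k + 2 \<or> m \<le> i \<and> m' \<le> j \<longrightarrow>
        inv\<^bsub>G\<^esub> (p i) \<otimes>\<^bsub>G\<^esub> p' j \<in> E))"

lemma dilationD:
  assumes "dilation c G k E (m, p) (m', p')"
  shows "p i \<in> carrier G" "p' i \<in> carrier G"
    and "c \<noteq> Synchronous \<Longrightarrow> (m = 0 \<longleftrightarrow> m' = 0) \<and> \<bar>int m' - int (k * m)\<bar> \<le> 1"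
    and "\<bar>int j - int (k * i)\<bar> \<le> int k + 2 \<or> m \<le> i \<and> m' \<le> j \<Longrightarrow>
        inv\<^bsub>G\<^esub> (p i) \<otimes>\<^bsub>G\<^esub> p' j \<in> E"
proof -
  note d = assms[unfolded dilation_def prod.case]
  show "p i \<in> carrier G" "p' i \<in> carrier G"
    using d[THEN conjunct1] d[THEN conjunct2, THEN conjunct1] by (simp_all add: range_subsetD)
  show "c \<noteq> Synchronous \<Longrightarrow> (m = 0 \<longleftrightarrow> m' = 0) \<and> \<bar>int m' - int (k * m)\<bar> \<le> 1"
    using d[THEN conjunct2, THEN conjunct2, THEN conjunct1] by (elim disjE) simp_all
  show "\<bar>int j - int (k * i)\<bar> \<le> int k + 2 \<or> m \<le> i \<and> m' \<le> j \<Longrightarrow>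
      inv\<^bsub>G\<^esub> (p i) \<otimes>\<^bsub>G\<^esub> p' j \<in> E"
    by (rule d[THEN conjunct2, THEN conjunct2, THEN conjunct2, rule_format])
qed

lemma floor_dilation:
  fixes x y :: real
  assumes "0 \<le> x" "0 \<le> y" "\<bar>y - real k * x\<bar> \<le> 1"
  shows "\<bar>int (nat \<lfloor>y\<rfloor>) - int (k * nat \<lfloor>x\<rfloor>)\<bar> \<le> int k + 2"
proof -
  define a where "a = \<lfloor>y\<rfloor>"
  define b where "b = \<lfloor>x\<rfloor>"
  have a: "real_of_int a \<le> y" "y < real_of_int a + 1" unfolding a_def by linarith+
  have "real_of_int b \<le> x" "x \<le> real_of_int b + 1" unfolding b_def by linarith+
  then have "real k * real_of_int b \<le> real k * x" "real k * x \<le> real k * (real_of_int b + 1)"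
    by (intro mult_left_mono; simp)+
  then have "\<bar>real_of_int a - real k * real_of_int b\<bar> \<le> real k + 2"
    using a assms(3) by (simp add: distrib_left)
  then have "real_of_int \<bar>a - int k * b\<bar> \<le> real_of_int (int k + 2)" by simp
  then have "\<bar>a - int k * b\<bar> \<le> int k + 2" unfolding of_int_le_iff .
  moreover have "int (nat \<lfloor>y\<rfloor>) = a" "int (nat \<lfloor>x\<rfloor>) = b"
    using assms(1,2) unfolding a_def b_def by auto
  ultimately show ?thesis by simp
qed

lemma dilation_ratio:
  assumes "(m = 0 \<longleftrightarrow> m' = 0) \<and> \<bar>int m' - int (k * m)\<bar> \<le> 1" "1 \<le> k"
  shows "real m' \<le> (real k + 1) * real m" "real m \<le> (real k + 1) * real m'"
proof -
  have "int m' \<le> int k * int m + int m"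
    using assms(1) by (cases "m = 0") auto
  also have "\<dots> = int ((k + 1) * m)" by (simp add: algebra_simps)
  finally have "m' \<le> (k + 1) * m" by linarith
  then have "real m' \<le> real ((k + 1) * m)" by (simp only: of_nat_le_iff)
  then show "real m' \<le> (real k + 1) * real m" by (simp only: of_nat_mult of_nat_add of_nat_1)
  have "m \<le> k * m" "m' \<le> k * m'" using assms(2) by (cases k; simp)+
  then have "m \<le> k * m' + m'"
    using assms(1) by (cases "m = 0") linarith+
  then have "m \<le> (k + 1) * m'" by simp
  then have "real m \<le> real ((k + 1) * m')" by (simp only: of_nat_le_iff)
  then show "real m \<le> (real k + 1) * real m'" by (simp only: of_nat_mult of_nat_add of_nat_1)
qed

lemma dilation_linear:
  assumes d: "dilation c G k E (m, p) (m', p')" and "c \<noteq> Synchronous" "0 < m" "0 < s"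
  shows "inv\<^bsub>G\<^esub> (p (nat \<lfloor>s\<rfloor>)) \<otimes>\<^bsub>G\<^esub> p' (nat \<lfloor>s * (real m' / real m)\<rfloor>) \<in> E"
proof (cases "s \<le> real m")
  case True
  have "\<bar>int m' - int (k * m)\<bar> \<le> 1" using dilationD(3)[OF d assms(2)] by blast
  then have "real_of_int \<bar>int m' - int (k * m)\<bar> \<le> 1" by linarith
  then have "\<bar>real m' - real k * real m\<bar> \<le> 1" by simp
  then have "s / real m * \<bar>real m' - real k * real m\<bar> \<le> 1 * 1"
    using True assms(3,4) by (intro mult_mono) auto
  moreover have "s * (real m' / real m) - real k * s = s / real m * (real m' - real k * real m)"
    using assms(3) by (simp add: field_simps)
  ultimately have "\<bar>s * (real m' / real m) - real k * s\<bar> \<le> 1"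
    using assms(3,4) by (simp add: abs_mult)
  from floor_dilation[OF _ _ this] show ?thesis
    using assms(4) by (intro dilationD(4)[OF d] disjI1) simp
next
  case False
  then have "real m * (real m' / real m) \<le> s * (real m' / real m)"
    by (intro mult_right_mono) auto
  then have "real m' \<le> s * (real m' / real m)" using assms(3) by simp
  then have "m \<le> nat \<lfloor>s\<rfloor>" "m' \<le> nat \<lfloor>s * (real m' / real m)\<rfloor>"
    using False by linarith+
  then show ?thesis by (intro dilationD(4)[OF d] disjI2 conjI)
qed

text \<open>If \<open>P'\<close> and \<open>Q'\<close> are slowed down by the same factor, then synchronous fellow travelling
  survives because both are read off at time \<open>t / k\<close>; in the asynchronous cases the time change
  is conjugated by the linear maps between the lengths.\<close>
lemma (in group) fellow_travelling_dilation:
  assumes "fellow_travelling c G R" "1 \<le> k" "finite E"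
    and R': "\<And>P' Q'. (P', Q') \<in> R' \<Longrightarrow>
       \<exists>P Q. (P, Q) \<in> R \<and> dilation c G k E P P' \<and> dilation c G k E Q Q'"
  shows "fellow_travelling c G R'"
proof -
  obtain B M where BM: "finite B" "\<And>m p n q. ((m, p), (n, q)) \<in> R \<Longrightarrow>
      \<exists>h. time_change c M m n h \<and> tracks G B h p q"
    using assms(1) unfolding fellow_travelling_def by blast
  let ?B = "(\<lambda>(x, b, y). inv x \<otimes> b \<otimes> y) ` (E \<times> B \<times> E)"
  let ?C = "real k + 1"
  have "\<exists>h. time_change c (max M (?C * M * ?C)) m' n' h \<and> tracks G ?B h p' q'"
    if pq': "((m', p'), (n', q')) \<in> R'" for m' p' n' q'
  proof -
    obtain m p n q where pq: "((m, p), (n, q)) \<in> R" and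
      dp: "dilation c G k E (m, p) (m', p')" and dq: "dilation c G k E (n, q) (n', q')"
      using R'[OF pq'] by (metis surj_pair)
    have car: "p i \<in> carrier G" "p' i \<in> carrier G" "q i \<in> carrier G" "q' i \<in> carrier G" for i
      using dilationD(1,2)[OF dp] dilationD(1,2)[OF dq] by blast+
    obtain h where h: "time_change c M m n h" "tracks G B h p q" using BM(2)[OF pq] by blast
    have B: "inv (p' j) \<otimes> q' j' \<in> ?B"
      if "inv (p i) \<otimes> p' j \<in> E" "inv (p i) \<otimes> q i' \<in> B" "inv (q i') \<otimes> q' j' \<in> E" for i i' j j'
    proof -
      have "inv (p' j) \<otimes> q' j' = inv (inv (p i) \<otimes> p' j) \<otimes> (inv (p i) \<otimes> q i') \<otimes> (inv (q i') \<otimes> q' j')"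
        using car by (simp add: m_assoc inv_mult_group inv_mult_cancel)
      then show ?thesis using that
        by (intro image_eqI[where x = "(inv (p i) \<otimes> p' j, inv (p i) \<otimes> q i', inv (q i') \<otimes> q' j')"]) auto
    qed
    have t: "inv (p (nat \<lfloor>t\<rfloor>)) \<otimes> q (nat \<lfloor>h t\<rfloor>) \<in> B" if "t > 0" for t
      using h(2) that unfolding tracks_def by blast
    consider "c = Synchronous" | "c \<noteq> Synchronous" "m = 0" | "c \<noteq> Synchronous" "m > 0" by blast
    then show ?thesis
    proof cases
      case 1
      have "inv (p' (nat \<lfloor>t\<rfloor>)) \<otimes> q' (nat \<lfloor>t\<rfloor>) \<in> ?B" if "t > 0" for t :: real
      proof (rule B)
        have "\<bar>t - real k * (t / real k)\<bar> \<le> 1" using assms(2) by simp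
        from floor_dilation[OF _ _ this]
        have *: "\<bar>int (nat \<lfloor>t\<rfloor>) - int (k * nat \<lfloor>t / real k\<rfloor>)\<bar> \<le> int k + 2" using that by simp
        then show "inv (p (nat \<lfloor>t / real k\<rfloor>)) \<otimes> p' (nat \<lfloor>t\<rfloor>) \<in> E"
          "inv (q (nat \<lfloor>t / real k\<rfloor>)) \<otimes> q' (nat \<lfloor>t\<rfloor>) \<in> E"
          using dilationD(4)[OF dp] dilationD(4)[OF dq] by blast+
        show "inv (p (nat \<lfloor>t / real k\<rfloor>)) \<otimes> q (nat \<lfloor>t / real k\<rfloor>) \<in> B"
          using t[of "t / real k"] h(1) 1 that assms(2) by (simp add: time_change_def)
      qed
      then show ?thesis using 1 car unfolding time_change_def tracks_def by auto
    next
      case 2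
      then have "n = 0" using time_change_empty h(1) by blast
      then have 0: "m' = 0" "n' = 0" using dilationD(3)[OF dp 2(1)] dilationD(3)[OF dq 2(1)] 2(2) by auto
      have "inv (p' (nat \<lfloor>t\<rfloor>)) \<otimes> q' (nat \<lfloor>h t\<rfloor>) \<in> ?B" if "t > 0" for t
        by (rule B[OF _ t[OF that]]) (use 0 \<open>m = 0\<close> \<open>n = 0\<close> dilationD(4)[OF dp] dilationD(4)[OF dq] in simp_all)
      then have "tracks G ?B h p' q'" using car unfolding tracks_def by auto
      then show ?thesis
        using time_change_mono[OF h(1), of "max M (?C * M * ?C)"] 0 \<open>m = 0\<close> \<open>n = 0\<close> by auto
    next
      case 3
      have "n > 0" using time_change_empty[OF h(1)] 3 by auto
      have sp: "(m = 0 \<longleftrightarrow> m' = 0) \<and> \<bar>int m' - int (k * m)\<bar> \<le> 1"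
        and sq: "(n = 0 \<longleftrightarrow> n' = 0) \<and> \<bar>int n' - int (k * n)\<bar> \<le> 1"
        using dilationD(3)[OF dp 3(1)] dilationD(3)[OF dq 3(1)] by blast+
      have pos: "m' > 0" "n' > 0" using sp sq 3 \<open>n > 0\<close> by auto
      define f where "f = (\<lambda>t. t * (real m / real m'))"
      define g where "g = (\<lambda>t. t * (real n' / real n))"
      have f: "time_change c ?C m' m f" unfolding f_def
        by (rule time_change_linear) (use dilation_ratio[OF sp assms(2)] pos 3 in auto)
      have g: "time_change c ?C n n' g" unfolding g_def
        by (rule time_change_linear) (use dilation_ratio[OF sq assms(2)] pos \<open>n > 0\<close> 3 in auto)
      have "inv (p' (nat \<lfloor>t\<rfloor>)) \<otimes> q' (nat \<lfloor>g (h (f t))\<rfloor>) \<in> ?B" if "t > 0" for t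
      proof (rule B)
        have ft: "f t > 0" using time_change_pos[OF f that] .
        show "inv (p (nat \<lfloor>f t\<rfloor>)) \<otimes> q (nat \<lfloor>h (f t)\<rfloor>) \<in> B" using t[OF ft] .
        have "f t * (real m' / real m) = t" using pos 3 by (simp add: f_def)
        then show "inv (p (nat \<lfloor>f t\<rfloor>)) \<otimes> p' (nat \<lfloor>t\<rfloor>) \<in> E"
          using dilation_linear[OF dp 3 ft] by simp
        show "inv (q (nat \<lfloor>h (f t)\<rfloor>)) \<otimes> q' (nat \<lfloor>g (h (f t))\<rfloor>) \<in> E"
          using dilation_linear[OF dq 3(1) \<open>n > 0\<close> time_change_pos[OF h(1) ft]] by (simp add: g_def)
      qed
      then have "tracks G ?B (\<lambda>t. g (h (f t))) p' q'" using car unfolding tracks_def by auto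
      moreover have "time_change c (?C * M * ?C) m' n' (\<lambda>t. g (h (f t)))"
        using time_change_compose[OF time_change_compose[OF f h(1)] g] .
      then have "time_change c (max M (?C * M * ?C)) m' n' (\<lambda>t. g (h (f t)))"
        by (rule time_change_mono) simp
      ultimately show ?thesis by blast
    qed
  qed
  moreover have "finite ?B" using BM(1) assms(3) by simp
  ultimately show ?thesis unfolding fellow_travelling_def by blast
qed

section \<open>Words and the path metric\<close>

lemma word_val_Nil [simp]: "word_val G \<phi> [] = \<one>\<^bsub>G\<^esub>"
  and word_val_Cons [simp]: "word_val G \<phi> (x # w) = \<phi> x \<otimes>\<^bsub>G\<^esub> word_val G \<phi> w"
  by (simp_all add: word_val_def)

definition word_ball :: "('a, 'm) monoid_scheme \<Rightarrow> nat set \<Rightarrow> (nat \<Rightarrow> 'a) \<Rightarrow> nat \<Rightarrow> 'a set" where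
  "word_ball G X \<phi> k = word_val G \<phi> ` {w \<in> lists X. length w \<le> k}"

definition trajectory :: "('a, 'm) monoid_scheme \<Rightarrow> (nat \<Rightarrow> 'a) \<Rightarrow> nat list \<Rightarrow> 'a trajectory" where
  "trajectory G \<phi> w = (length w, \<lambda>i. word_val G \<phi> (take i w))"

definition translate :: "('a, 'm) monoid_scheme \<Rightarrow> 'a \<Rightarrow> 'a trajectory \<Rightarrow> 'a trajectory" where
  "translate G g = (\<lambda>(m, p). (m, \<lambda>i. g \<otimes>\<^bsub>G\<^esub> p i))"

lemma (in group) word_val_closed:
  "\<phi> ` X \<subseteq> carrier G \<Longrightarrow> w \<in> lists X \<Longrightarrow> word_val G \<phi> w \<in> carrier G"
  by (induction w) auto

lemma (in group) word_val_append:
  "\<phi> ` X \<subseteq> carrier G \<Longrightarrow> u \<in> lists X \<Longrightarrow> v \<in> lists X \<Longrightarrow>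
    word_val G \<phi> (u @ v) = word_val G \<phi> u \<otimes> word_val G \<phi> v"
proof (induction u)
  case (Cons a u)
  then have "\<phi> a \<in> carrier G" "word_val G \<phi> u \<in> carrier G" "word_val G \<phi> v \<in> carrier G"
    using word_val_closed by auto
  then show ?case using Cons by (simp add: m_assoc)
qed (simp add: word_val_closed)

locale marked_group = group G for G (structure) +
  fixes X :: "nat set" and \<phi> :: "nat \<Rightarrow> 'a"
  assumes marking: "generating_set G X \<phi>"
begin

abbreviation "val \<equiv> word_val G \<phi>"
abbreviation "ball \<equiv> word_ball G X \<phi>"

lemma finite_X: "finite X" and X_nonempty: "X \<noteq> {}" and img_X: "\<phi> ` X \<subseteq> carrier G"
  and inverse_symbol: "x \<in> X \<Longrightarrow> \<exists>y\<in>X. \<phi> y = inv (\<phi> x)"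
  and generate_X: "generate G (\<phi> ` X) = carrier G"
  using marking unfolding generating_set_def by blast+

lemma phi_closed [simp]: "x \<in> X \<Longrightarrow> \<phi> x \<in> carrier G"
  using img_X by blast

lemma val_closed [simp]: "w \<in> lists X \<Longrightarrow> val w \<in> carrier G"
  using word_val_closed[OF img_X] .

lemma val_append: "u \<in> lists X \<Longrightarrow> v \<in> lists X \<Longrightarrow> val (u @ v) = val u \<otimes> val v"
  using word_val_append[OF img_X] .

lemma take_lists: "w \<in> lists X \<Longrightarrow> take i w \<in> lists X"
  by (meson in_lists_conv_set in_set_takeD)

lemma drop_lists: "w \<in> lists X \<Longrightarrow> drop i w \<in> lists X"
  by (meson in_lists_conv_set in_set_dropD)

lemma finite_ball: "finite (ball k)"
  unfolding word_ball_def using finite_lists_length_le[OF finite_X, of k]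
  by (intro finite_imageI) (simp add: lists_eq_set)

lemma ball_mono: "k \<le> l \<Longrightarrow> a \<in> ball k \<Longrightarrow> a \<in> ball l"
  unfolding word_ball_def by auto

lemma one_in_ball: "\<one> \<in> ball k"
  unfolding word_ball_def by (rule image_eqI[of _ _ "[]"]) auto

lemma symbol_in_ball: "x \<in> X \<Longrightarrow> \<phi> x \<in> ball 1"
  unfolding word_ball_def by (rule image_eqI[of _ _ "[x]"]) auto

lemma ball_mult: "a \<in> ball k \<Longrightarrow> b \<in> ball l \<Longrightarrow> a \<otimes> b \<in> ball (k + l)"
  unfolding word_ball_def
proof (elim imageE)
  fix u v assume "a = val u" "u \<in> {w \<in> lists X. length w \<le> k}" "b = val v" "v \<in> {w \<in> lists X. length w \<le> l}"
  then show "a \<otimes> b \<in> val ` {w \<in> lists X. length w \<le> k + l}"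
    by (intro image_eqI[of _ _ "u @ v"]) (auto simp: val_append)
qed

lemma inverse_word:
  "w \<in> lists X \<Longrightarrow> \<exists>w'\<in>lists X. length w' = length w \<and> val w' = inv (val w)"
proof (induction w)
  case (Cons x w)
  then have xw: "x \<in> X" "w \<in> lists X" by simp_all
  obtain w' where w': "w' \<in> lists X" "length w' = length w" "val w' = inv (val w)"
    using Cons.IH[OF xw(2)] by metis
  obtain y where y: "y \<in> X" "\<phi> y = inv (\<phi> x)"
    using inverse_symbol[OF xw(1)] by metis
  have "val (w' @ [y]) = val w' \<otimes> \<phi> y" using w'(1) y(1) by (simp add: val_append)
  also have "\<dots> = inv (val (x # w))"
    unfolding w'(3) y(2) word_val_Cons using xw by (simp add: inv_mult_group)
  finally show ?case using w'(1,2) y(1) by (intro bexI[of _ "w' @ [y]"]) simp_all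
qed (intro bexI[of _ "[]"]; simp)

lemma ball_inv: "a \<in> ball k \<Longrightarrow> inv a \<in> ball k"
  unfolding word_ball_def
proof (elim imageE)
  fix w assume w: "a = val w" "w \<in> {w \<in> lists X. length w \<le> k}"
  then obtain w' where "w' \<in> lists X" "length w' = length w" "val w' = inv (val w)"
    using inverse_word by blast
  then show "inv a \<in> val ` {w \<in> lists X. length w \<le> k}"
    using w by (intro image_eqI[of _ _ w']) auto
qed

lemma word_exists: "g \<in> carrier G \<Longrightarrow> \<exists>w\<in>lists X. val w = g"
  unfolding generate_X[symmetric]
proof (induction g rule: generate.induct)
  case one
  then show ?case by (intro bexI[of _ "[]"]) auto
next
  case (incl h)
  then obtain x where "x \<in> X" "h = \<phi> x" by blast
  then show ?case by (intro bexI[of _ "[x]"]) auto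
next
  case (inv h)
  then obtain x where "x \<in> X" "h = \<phi> x" by blast
  moreover then obtain y where "y \<in> X" "\<phi> y = inv h" using inverse_symbol by blast
  ultimately show ?case by (intro bexI[of _ "[y]"]) auto
next
  case (eng h1 h2)
  then obtain u v where "u \<in> lists X" "v \<in> lists X" "val u = h1" "val v = h2" by blast
  then show ?case by (intro bexI[of _ "u @ v"]) (simp_all add: val_append)
qed

lemma segment_in_ball_le:
  assumes "w \<in> lists X" "i \<le> j" "j \<le> i + k"
  shows "inv (val (take i w)) \<otimes> val (take j w) \<in> ball k"
proof -
  have "take j w = take i w @ take (j - i) (drop i w)"
    using assms(2) by (metis take_add le_add_diff_inverse)
  then have "val (take j w) = val (take i w) \<otimes> val (take (j - i) (drop i w))"
    using assms(1) by (metis val_append take_lists drop_lists)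
  then have "inv (val (take i w)) \<otimes> val (take j w) = val (take (j - i) (drop i w))"
    using assms(1) by (simp add: inv_mult_cancel take_lists drop_lists)
  moreover have "take (j - i) (drop i w) \<in> lists X" using assms(1) by (simp add: take_lists drop_lists)
  ultimately show ?thesis using assms(2,3) unfolding word_ball_def by auto
qed

lemma segment_in_ball:
  assumes "w \<in> lists X" "\<bar>int j - int i\<bar> \<le> int k"
  shows "inv (val (take i w)) \<otimes> val (take j w) \<in> ball k"
proof (cases "i \<le> j")
  case True
  then show ?thesis using assms by (intro segment_in_ball_le) auto
next
  case False
  then have "inv (val (take j w)) \<otimes> val (take i w) \<in> ball k"
    using assms by (intro segment_in_ball_le) auto
  from ball_inv[OF this] show ?thesis
    using assms(1) by (simp add: inv_mult_group take_lists)
qed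

text \<open>Since the alphabet is inverse closed, reversing an edge of the Cayley graph gives an edge.\<close>
lemma cayley_adj_sym:
  "(g, h) \<in> cayley_adj G X \<phi> \<union> (cayley_adj G X \<phi>)\<inverse> \<longleftrightarrow>
     g \<in> carrier G \<and> (\<exists>x\<in>X. h = g \<otimes> \<phi> x)"
proof -
  have "\<exists>y\<in>X. h = (h \<otimes> \<phi> x) \<otimes> \<phi> y" if x: "h \<in> carrier G" "x \<in> X" for x
  proof -
    obtain y where "y \<in> X" "\<phi> y = inv (\<phi> x)" using inverse_symbol[OF x(2)] by blast
    then show ?thesis using x by (intro bexI[of _ y]) (simp_all add: m_assoc)
  qed
  then show ?thesis unfolding cayley_adj_def by auto
qed

lemma cayley_path:
  "g \<in> carrier G \<Longrightarrow> (g, h) \<in> (cayley_adj G X \<phi> \<union> (cayley_adj G X \<phi>)\<inverse>) ^^ n \<longleftrightarrow>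
     (\<exists>w\<in>lists X. length w = n \<and> h = g \<otimes> val w)"
proof (induction n arbitrary: g)
  case 0
  then show ?case by auto
next
  case (Suc n)
  let ?R = "cayley_adj G X \<phi> \<union> (cayley_adj G X \<phi>)\<inverse>"
  have "(g, h) \<in> ?R ^^ Suc n \<longleftrightarrow> (\<exists>k. (g, k) \<in> ?R \<and> (k, h) \<in> ?R ^^ n)"
    by (metis relpow_Suc_D2 relpow_Suc_I2)
  also have "\<dots> \<longleftrightarrow> (\<exists>x\<in>X. (g \<otimes> \<phi> x, h) \<in> ?R ^^ n)"
    using Suc.prems unfolding cayley_adj_sym by blast
  also have "\<dots> \<longleftrightarrow> (\<exists>x\<in>X. \<exists>w\<in>lists X. length w = n \<and> h = (g \<otimes> \<phi> x) \<otimes> val w)"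
    using Suc by (metis m_closed phi_closed)
  also have "\<dots> \<longleftrightarrow> (\<exists>x\<in>X. \<exists>w\<in>lists X. length w = n \<and> h = g \<otimes> val (x # w))"
    using Suc.prems by (metis m_assoc phi_closed val_closed word_val_Cons)
  also have "\<dots> \<longleftrightarrow> (\<exists>w\<in>lists X. length w = Suc n \<and> h = g \<otimes> val w)"
  proof
    assume "\<exists>w\<in>lists X. length w = Suc n \<and> h = g \<otimes> val w"
    then obtain w where w: "w \<in> lists X" "length w = Suc n" "h = g \<otimes> val w" by (elim bexE conjE)
    then obtain x u where "w = x # u" by (cases w) simp_all
    then show "\<exists>x\<in>X. \<exists>w\<in>lists X. length w = n \<and> h = g \<otimes> val (x # w)"
      using w by (intro bexI[of _ x] bexI[of _ u]) simp_all
  qed (metis Cons_in_lists_iff length_Cons)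
  finally show ?case .
qed

lemma dist_in_ball:
  assumes "g \<in> carrier G" "h \<in> carrier G"
  shows "inv g \<otimes> h \<in> ball (cayley_dist G X \<phi> g h)"
proof -
  let ?R = "cayley_adj G X \<phi> \<union> (cayley_adj G X \<phi>)\<inverse>"
  obtain w where "w \<in> lists X" "val w = inv g \<otimes> h"
    using word_exists[of "inv g \<otimes> h"] assms by auto
  then have "(g, h) \<in> ?R ^^ length w"
    using assms unfolding cayley_path[OF assms(1)] by (intro bexI[of _ w]) (auto simp: inv_mult_cancel)
  then have "(g, h) \<in> ?R ^^ cayley_dist G X \<phi> g h"
    unfolding cayley_dist_def by (rule LeastI)
  then obtain u where "u \<in> lists X" "length u = cayley_dist G X \<phi> g h" "h = g \<otimes> val u"
    unfolding cayley_path[OF assms(1)] by blast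
  then show ?thesis using assms(1) unfolding word_ball_def
    by (intro image_eqI[of _ _ u]) (auto simp: inv_mult_cancel)
qed

lemma dist_le:
  assumes "g \<in> carrier G" "h \<in> carrier G" "inv g \<otimes> h \<in> ball k"
  shows "cayley_dist G X \<phi> g h \<le> k"
proof -
  let ?R = "cayley_adj G X \<phi> \<union> (cayley_adj G X \<phi>)\<inverse>"
  obtain w where w: "w \<in> lists X" "val w = inv g \<otimes> h" "length w \<le> k"
    using assms(3) unfolding word_ball_def by (elim imageE CollectE) metis
  then have "(g, h) \<in> ?R ^^ length w"
    using assms unfolding cayley_path[OF assms(1)] by (intro bexI[of _ w]) (auto simp: inv_mult_cancel)
  then have "cayley_dist G X \<phi> g h \<le> length w"
    unfolding cayley_dist_def by (rule Least_le)
  then show ?thesis using w(3) by simp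
qed

text \<open>A point of a path lies on the edge that starts at the last vertex passed, at integer time
  \<open>\<lfloor>t\<rfloor>\<close>. Replacing the point by that vertex changes distances by a bounded amount, which is all
  that matters; \<open>skel_dist_ge\<close> and \<open>skel_dist_le\<close> make this precise.\<close>
lemma path_point_exits:
  assumes "w \<in> lists X" "0 \<le> t"
  defines "b \<equiv> val (take (nat \<lfloor>t\<rfloor>) w)"
  shows "\<exists>s. (b, s) \<in> exits G \<phi> (path_point G \<phi> w t) \<and> s \<le> 1"
    and "(g, s) \<in> exits G \<phi> (path_point G \<phi> w t) \<Longrightarrow> g \<in> carrier G \<and> 0 \<le> s \<and> inv b \<otimes> g \<in> ball 1"
proof -
  have b: "b \<in> carrier G" using assms(1) by (simp add: b_def take_lists)
  have vertex: "path_point G \<phi> w t = Vertex b" if "\<not> t < real (length w)"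
  proof -
    have "length w \<le> nat \<lfloor>t\<rfloor>" using that by linarith
    then show ?thesis using that by (simp add: path_point_def b_def)
  qed
  have edge: "path_point G \<phi> w t = On_Edge b (w ! nat \<lfloor>t\<rfloor>) (frac t)" "w ! nat \<lfloor>t\<rfloor> \<in> X"
    if "t < real (length w)"
  proof -
    show "path_point G \<phi> w t = On_Edge b (w ! nat \<lfloor>t\<rfloor>) (frac t)"
      using that by (simp add: path_point_def b_def)
    have "nat \<lfloor>t\<rfloor> < length w" using that assms(2) by linarith
    then show "w ! nat \<lfloor>t\<rfloor> \<in> X" using assms(1) by auto
  qed
  have fr: "frac t \<le> 1" "0 \<le> frac t" using frac_lt_1[of t] by auto
  show "\<exists>s. (b, s) \<in> exits G \<phi> (path_point G \<phi> w t) \<and> s \<le> 1"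
    by (cases "t < real (length w)") (use vertex edge fr in \<open>auto intro: exI[of _ "frac t"]\<close>)
  show "(g, s) \<in> exits G \<phi> (path_point G \<phi> w t) \<Longrightarrow> g \<in> carrier G \<and> 0 \<le> s \<and> inv b \<otimes> g \<in> ball 1"
    by (cases "t < real (length w)")
       (use vertex edge fr b one_in_ball symbol_in_ball in \<open>auto simp: inv_mult_cancel\<close>)
qed

lemma within_edge_same_vertex:
  assumes "d \<in> within_edge (path_point G \<phi> v t) (path_point G \<phi> w s)"
  shows "val (take (nat \<lfloor>t\<rfloor>) v) = val (take (nat \<lfloor>s\<rfloor>) w)"
  using assms by (auto simp: path_point_def split: if_splits)

lemma finite_exits: "finite (exits G \<phi> p)" "finite (within_edge p q)"
  by (cases p; simp) (cases p; cases q; simp)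

text \<open>The minimum defining the distance is attained either by a path through two exits, each within
  one edge of the vertices at integer times, or inside a single edge, whose initial vertex is then
  common to both points.\<close>
lemma skel_dist_ge:
  assumes "v \<in> lists X" "w \<in> lists X" "0 \<le> t" "0 \<le> s"
    and "skel_dist G X \<phi> (path_point G \<phi> v t) (path_point G \<phi> w s) \<le> K"
  shows "inv (val (take (nat \<lfloor>t\<rfloor>) v)) \<otimes> val (take (nat \<lfloor>s\<rfloor>) w) \<in> ball (nat \<lfloor>K\<rfloor> + 2)"
proof -
  let ?p = "path_point G \<phi> v t" and ?q = "path_point G \<phi> w s"
  define a where "a = val (take (nat \<lfloor>t\<rfloor>) v)"
  define b where "b = val (take (nat \<lfloor>s\<rfloor>) w)"
  have car: "a \<in> carrier G" "b \<in> carrier G" using assms by (simp_all add: a_def b_def take_lists)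
  let ?S = "(\<lambda>((g, s), (h, t)). s + real (cayley_dist G X \<phi> g h) + t) ` (exits G \<phi> ?p \<times> exits G \<phi> ?q)
          \<union> within_edge ?p ?q"
  have "finite ?S" using finite_exits by simp
  moreover have "?S \<noteq> {}"
    using path_point_exits(1)[OF assms(1,3)] path_point_exits(1)[OF assms(2,4)] by blast
  ultimately have "skel_dist G X \<phi> ?p ?q \<in> ?S" unfolding skel_dist_def by (rule Min_in)
  then consider (graph) g x h y where "(g, x) \<in> exits G \<phi> ?p" "(h, y) \<in> exits G \<phi> ?q"
      "skel_dist G X \<phi> ?p ?q = x + real (cayley_dist G X \<phi> g h) + y"
    | (edge) "skel_dist G X \<phi> ?p ?q \<in> within_edge ?p ?q"
    by auto
  then have "inv a \<otimes> b \<in> ball (nat \<lfloor>K\<rfloor> + 2)"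
  proof cases
    case graph
    have g: "g \<in> carrier G" "0 \<le> x" "inv a \<otimes> g \<in> ball 1"
      using path_point_exits(2)[OF assms(1,3) graph(1)] by (simp_all add: a_def)
    have h: "h \<in> carrier G" "0 \<le> y" "inv b \<otimes> h \<in> ball 1"
      using path_point_exits(2)[OF assms(2,4) graph(2)] by (simp_all add: b_def)
    have "real (cayley_dist G X \<phi> g h) \<le> K" using graph(3) g(2) h(2) assms(5) by linarith
    then have "cayley_dist G X \<phi> g h \<le> nat \<lfloor>K\<rfloor>" by linarith
    then have "inv g \<otimes> h \<in> ball (nat \<lfloor>K\<rfloor>)" using dist_in_ball[OF g(1) h(1)] ball_mono by blast
    then have "inv a \<otimes> g \<otimes> (inv g \<otimes> h) \<otimes> inv (inv b \<otimes> h) \<in> ball (1 + nat \<lfloor>K\<rfloor> + 1)"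
      using g(3) ball_inv[OF h(3)] by (intro ball_mult)
    moreover have "inv a \<otimes> g \<otimes> (inv g \<otimes> h) \<otimes> inv (inv b \<otimes> h) = inv a \<otimes> b"
      using car g(1) h(1) by (simp add: m_assoc inv_mult_group inv_mult_cancel)
    moreover have "1 + nat \<lfloor>K\<rfloor> + 1 = nat \<lfloor>K\<rfloor> + 2" by simp
    ultimately show ?thesis by metis
  next
    case edge
    then have "a = b" using within_edge_same_vertex by (simp add: a_def b_def)
    then show ?thesis using car one_in_ball by simp
  qed
  then show ?thesis by (simp add: a_def b_def)
qed

lemma skel_dist_le:
  assumes "v \<in> lists X" "w \<in> lists X" "0 \<le> t" "0 \<le> s"
    and "inv (val (take (nat \<lfloor>t\<rfloor>) v)) \<otimes> val (take (nat \<lfloor>s\<rfloor>) w) \<in> ball k"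
  shows "skel_dist G X \<phi> (path_point G \<phi> v t) (path_point G \<phi> w s) \<le> real k + 2"
proof -
  let ?p = "path_point G \<phi> v t" and ?q = "path_point G \<phi> w s"
  define a where "a = val (take (nat \<lfloor>t\<rfloor>) v)"
  define b where "b = val (take (nat \<lfloor>s\<rfloor>) w)"
  have car: "a \<in> carrier G" "b \<in> carrier G" using assms by (simp_all add: a_def b_def take_lists)
  obtain x y where x: "(a, x) \<in> exits G \<phi> ?p" "x \<le> 1" and y: "(b, y) \<in> exits G \<phi> ?q" "y \<le> 1"
    using path_point_exits(1)[OF assms(1,3)] path_point_exits(1)[OF assms(2,4)]
    by (auto simp: a_def b_def)
  let ?S = "(\<lambda>((g, s), (h, t)). s + real (cayley_dist G X \<phi> g h) + t) ` (exits G \<phi> ?p \<times> exits G \<phi> ?q)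
          \<union> within_edge ?p ?q"
  have "finite ?S" using finite_exits by simp
  moreover have "x + real (cayley_dist G X \<phi> a b) + y \<in> ?S"
    by (rule UnI1, rule image_eqI[of _ _ "((a, x), (b, y))"]) (use x y in auto)
  ultimately have "skel_dist G X \<phi> ?p ?q \<le> x + real (cayley_dist G X \<phi> a b) + y"
    unfolding skel_dist_def by (rule Min_le)
  moreover have "cayley_dist G X \<phi> a b \<le> k"
    using dist_le car assms(5) by (simp add: a_def b_def)
  ultimately show ?thesis using x(2) y(2) by linarith
qed

end

section \<open>Combings as coarse conditions\<close>

lemma fellow_travelling_range:
  assumes "fellow_travelling c G R" "((m, p), (n, q)) \<in> R"
  shows "p i \<in> carrier G" "q i \<in> carrier G"
  using assms unfolding fellow_travelling_def tracks_def by blast+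

lemma fst_trajectory [simp]: "fst (trajectory G \<phi> w) = length w"
  by (simp add: trajectory_def)

lemma fst_translate [simp]: "fst (translate G g P) = fst P"
  by (simp add: translate_def case_prod_beta)

lemma (in group) inv_mult_translate:
  "g \<in> carrier G \<Longrightarrow> a \<in> carrier G \<Longrightarrow> b \<in> carrier G \<Longrightarrow>
     inv (g \<otimes> a) \<otimes> (g \<otimes> b) = inv a \<otimes> b"
  by (simp add: inv_mult_group m_assoc inv_mult_cancel)

lemma (in group) fellow_travelling_translate:
  assumes "fellow_travelling c G R" "g \<in> carrier G"
  shows "fellow_travelling c G (map_prod (translate G g) (translate G g) ` R)"
proof (rule fellow_travelling_transfer[OF assms(1), where \<Phi> = "\<lambda>B. B"])
  fix m p' n q'
  assume "((m, p'), n, q') \<in> map_prod (translate G g) (translate G g) ` R"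
  then obtain P Q where PQ: "(P, Q) \<in> R" "translate G g P = (m, p')" "translate G g Q = (n, q')"
    by auto
  obtain p q where "P = (m, p)" "Q = (n, q)" "p' = (\<lambda>i. g \<otimes> p i)" "q' = (\<lambda>i. g \<otimes> q i)"
    using PQ(2,3) by (cases P; cases Q) (auto simp: translate_def)
  note pq = this
  have R: "((m, p), (n, q)) \<in> R" using PQ(1) pq by simp
  note car = fellow_travelling_range[OF assms(1) R]
  show "\<exists>p q. ((m, p), n, q) \<in> R \<and> range p' \<subseteq> carrier G \<and> range q' \<subseteq> carrier G \<and>
      (\<forall>B i j. inv p i \<otimes> q j \<in> B \<longrightarrow> inv p' i \<otimes> q' j \<in> B)"
    using R car assms(2) by (intro exI[of _ p] exI[of _ q]) (auto simp: pq inv_mult_translate)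
qed auto

definition word_ft ::
    "timing \<Rightarrow> ('a, 'm) monoid_scheme \<Rightarrow> nat set \<Rightarrow> (nat \<Rightarrow> 'a) \<Rightarrow> real \<Rightarrow> real \<Rightarrow>
      nat list \<Rightarrow> nat list \<Rightarrow> bool" where
  "word_ft c G X \<phi> K M v w =
     (case c of Synchronous \<Rightarrow> sync_ft G X \<phi> K v w
      | Bounded \<Rightarrow> bd_async_ft G X \<phi> K M v w
      | Unbounded \<Rightarrow> async_ft G X \<phi> K v w)"

fun timing_of :: "combing_type \<Rightarrow> timing" where
  "timing_of Sync = Synchronous" | "timing_of Sync_Bi = Synchronous"
| "timing_of Bd_Async = Bounded" | "timing_of Bd_Async_Bi = Bounded"
| "timing_of Async = Unbounded" | "timing_of Async_Bi = Unbounded"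

definition two_sided :: "combing_type \<Rightarrow> bool" where
  "two_sided \<tau> \<longleftrightarrow> \<tau> \<in> {Sync_Bi, Bd_Async_Bi, Async_Bi}"

definition right_pairs ::
    "('a, 'm) monoid_scheme \<Rightarrow> (nat \<Rightarrow> 'a) \<Rightarrow> nat list set \<Rightarrow> 'a \<Rightarrow> ('a trajectory \<times> 'a trajectory) set" where
  "right_pairs G \<phi> L g = {(trajectory G \<phi> v, trajectory G \<phi> w) | v w.
     v \<in> L \<and> w \<in> L \<and> word_val G \<phi> w = word_val G \<phi> v \<otimes>\<^bsub>G\<^esub> g}"

definition left_pairs ::
    "('a, 'm) monoid_scheme \<Rightarrow> (nat \<Rightarrow> 'a) \<Rightarrow> nat list set \<Rightarrow> 'a \<Rightarrow> ('a trajectory \<times> 'a trajectory) set" where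
  "left_pairs G \<phi> L g = {(translate G g (trajectory G \<phi> v), trajectory G \<phi> w) | v w.
     v \<in> L \<and> w \<in> L \<and> word_val G \<phi> w = g \<otimes>\<^bsub>G\<^esub> word_val G \<phi> v}"

text \<open>The translation of the combing conditions into a form that does not depend on the alphabet: the
  pairs to be compared are those whose values differ by any fixed group element, on the right or
  on the left, instead of by a generator. The empty word has to be excluded from asynchronous
  bicombings: if \<open>v\<close> is empty, then the path labelled \<open>x v\<close> has length one, while \<open>v\<close> translated by
  \<open>x\<close> has length zero.\<close>
definition coarse_combing ::
    "combing_type \<Rightarrow> ('a, 'm) monoid_scheme \<Rightarrow> (nat \<Rightarrow> 'a) \<Rightarrow> nat list set \<Rightarrow> bool" where
  "coarse_combing \<tau> G \<phi> L \<longleftrightarrow>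
     (\<forall>g\<in>carrier G. \<exists>w\<in>L. word_val G \<phi> w = g) \<and>
     (\<forall>g\<in>carrier G. fellow_travelling (timing_of \<tau>) G (right_pairs G \<phi> L g)) \<and>
     (two_sided \<tau> \<longrightarrow>
        (\<forall>g\<in>carrier G. fellow_travelling (timing_of \<tau>) G (left_pairs G \<phi> L g)) \<and>
        (timing_of \<tau> \<noteq> Synchronous \<longrightarrow> [] \<notin> L))"

context marked_group
begin

lemma prefix_closed [simp]:
  "w \<in> lists X \<Longrightarrow> val (take i w) \<in> carrier G"
  "\<forall>x\<in>set w. x \<in> X \<Longrightarrow> val (take i w) \<in> carrier G"
  by (auto intro!: val_closed take_lists)

abbreviation "traj \<equiv> trajectory G \<phi>"

lemma finite_in_ball:
  assumes "finite B" "B \<subseteq> carrier G"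
  shows "\<exists>k. B \<subseteq> ball k"
  using assms
proof (induction B rule: finite_induct)
  case (insert b B)
  then obtain k where k: "B \<subseteq> ball k" by auto
  obtain w where w: "w \<in> lists X" "val w = b" using word_exists[of b] insert.prems by auto
  then have "b \<in> ball (length w)" unfolding word_ball_def by (intro image_eqI[of _ _ w]) auto
  then have "insert b B \<subseteq> ball (length w + k)"
    using k ball_mono[of k "length w + k"] ball_mono[of "length w" "length w + k"] by auto
  then show ?case by blast
qed auto

lemma async_ft_by_tracks:
  assumes "v \<in> lists X" "w \<in> lists X" "async_ft_by G X \<phi> K v w h h'"
  shows "time_change Unbounded 1 (length v) (length w) h"
    and "tracks G (ball (nat \<lfloor>K\<rfloor> + 2)) h (snd (traj v)) (snd (traj w))"
proof -
  show tc: "time_change Unbounded 1 (length v) (length w) h"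
    using assms(3) unfolding async_ft_by_def time_change_def by auto
  have "inv (val (take (nat \<lfloor>t\<rfloor>) v)) \<otimes> val (take (nat \<lfloor>h t\<rfloor>) w) \<in> ball (nat \<lfloor>K\<rfloor> + 2)"
    if "t > 0" for t
    using assms that time_change_pos[OF tc that]
    by (intro skel_dist_ge) (auto simp: async_ft_by_def)
  then show "tracks G (ball (nat \<lfloor>K\<rfloor> + 2)) h (snd (traj v)) (snd (traj w))"
    using assms(1,2) unfolding tracks_def trajectory_def by (auto simp: take_lists)
qed

text \<open>For \<open>M \<le> 0\<close> the bounds on the derivative would force it to be non-positive to the left of \<open>0\<close>,
  contradicting monotonicity. So \<open>M\<close> is positive, and can be enlarged to be at least \<open>1\<close>.\<close>
lemma bounded_time_change:
  assumes "async_ft_by G X \<phi> K v w h h'"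
    and b: "\<forall>t\<le>real (length v). 1 / M \<le> h' t \<and> h' t \<le> M"
  shows "time_change Bounded (max 1 M) (length v) (length w) h"
proof -
  have mono: "strict_mono h" and der: "\<And>t. (h has_real_derivative h' t) (at t)"
    using assms(1) by (auto simp: async_ft_by_def)
  obtain z where z: "-1 < z" "z < 0" "h 0 - h (-1) = (0 - (-1)) * h' z"
    using MVT2[of "-1" 0 h h'] der by auto
  have "h (-1) < h 0" using strict_monoD[OF mono] by simp
  then have "0 < h' z" using z(3) by simp
  also have "h' z \<le> M" using b z(2) by (meson less_eq_real_def of_nat_0_le_iff order_trans)
  finally have M: "0 < M" .
  have "1 / max 1 M \<le> 1 / M" using M by (intro divide_left_mono) auto
  then have "\<forall>t\<le>real (length v). 1 / max 1 M \<le> h' t \<and> h' t \<le> max 1 M"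
    using b by (meson order_trans max.cobounded2)
  then show ?thesis using assms(1) unfolding async_ft_by_def time_change_def by auto
qed

lemma tracks_async_ft_by:
  assumes "v \<in> lists X" "w \<in> lists X" "strict_mono h" "\<forall>t. (h has_real_derivative h' t) (at t)"
    "h ` {0..real (length v)} = {0..real (length w)}"
    and B: "B \<inter> carrier G \<subseteq> ball k" "tracks G B h (snd (traj v)) (snd (traj w))"
    and pos: "\<And>t. 0 < t \<Longrightarrow> 0 < h t"
  shows "async_ft_by G X \<phi> (real k + 2) v w h h'"
proof -
  have "skel_dist G X \<phi> (path_point G \<phi> v t) (path_point G \<phi> w (h t)) \<le> real k + 2"
    if "t > 0" for t
  proof (rule skel_dist_le)
    have "inv (val (take (nat \<lfloor>t\<rfloor>) v)) \<otimes> val (take (nat \<lfloor>h t\<rfloor>) w) \<in> B \<inter> carrier G"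
      using B(2) that assms(1,2) unfolding tracks_def trajectory_def by (simp add: take_lists)
    then show "inv (val (take (nat \<lfloor>t\<rfloor>) v)) \<otimes> val (take (nat \<lfloor>h t\<rfloor>) w) \<in> ball k" using B(1) by blast
  qed (use assms(1,2) that pos[OF that] in auto)
  then show ?thesis using assms(3-5) unfolding async_ft_by_def by blast
qed

text \<open>Balls in the word metric are finite, and every finite set of group elements lies in a ball.
  Hence a uniform distance bound is the same as a uniform finite set of differences.\<close>
lemma fellow_travelling_words:
  assumes W: "W \<subseteq> lists X \<times> lists X"
  shows "(\<exists>K M. \<forall>(v, w)\<in>W. word_ft c G X \<phi> K M v w) \<longleftrightarrow>
     fellow_travelling c G (map_prod traj traj ` W)"
proof
  assume "\<exists>K M. \<forall>(v, w)\<in>W. word_ft c G X \<phi> K M v w"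
  then obtain K M where KM: "\<And>v w. (v, w) \<in> W \<Longrightarrow> word_ft c G X \<phi> K M v w" by blast
  let ?B = "ball (nat \<lfloor>K\<rfloor> + 2)"
  have "\<exists>h. time_change c (max 1 M) m n h \<and> tracks G ?B h p q"
    if pq: "((m, p), (n, q)) \<in> map_prod traj traj ` W" for m p n q
  proof -
    obtain v w where vw: "(v, w) \<in> W" "traj v = (m, p)" "traj w = (n, q)" using pq by auto
    have lists: "v \<in> lists X" "w \<in> lists X" using vw(1) W by auto
    have mn: "m = length v" "n = length w" "p = snd (traj v)" "q = snd (traj w)"
      using vw(2,3) by (metis fst_conv fst_trajectory snd_conv)+
    show ?thesis
    proof (cases c)
      case Synchronous
      have "inv (val (take (nat \<lfloor>t\<rfloor>) v)) \<otimes> val (take (nat \<lfloor>t\<rfloor>) w) \<in> ball (nat \<lfloor>K\<rfloor> + 2)"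
        if "t > 0" for t :: real
        using lists that KM[OF vw(1)] Synchronous
        by (intro skel_dist_ge) (auto simp: word_ft_def sync_ft_def)
      then have "tracks G ?B (\<lambda>t. t) p q"
        using lists unfolding mn tracks_def trajectory_def by (auto simp: take_lists)
      then show ?thesis using Synchronous by (auto simp: time_change_def)
    next
      case Bounded
      then obtain h h' where h: "async_ft_by G X \<phi> K v w h h'"
          "\<forall>t\<le>real (length v). 1 / M \<le> h' t \<and> h' t \<le> M"
        using KM[OF vw(1)] by (auto simp: word_ft_def bd_async_ft_def)
      then show ?thesis
        using bounded_time_change[OF h] async_ft_by_tracks(2)[OF lists h(1)] Bounded unfolding mn by blast
    next
      case Unbounded
      then obtain h h' where h: "async_ft_by G X \<phi> K v w h h'"
        using KM[OF vw(1)] by (auto simp: word_ft_def async_ft_def)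
      have "time_change Unbounded (max 1 M) (length v) (length w) h"
        by (rule time_change_mono[OF async_ft_by_tracks(1)[OF lists h]]) simp
      then show ?thesis
        using async_ft_by_tracks(2)[OF lists h(1)] Unbounded unfolding mn by blast
    qed
  qed
  then show "fellow_travelling c G (map_prod traj traj ` W)"
    unfolding fellow_travelling_def
    by (intro exI[of _ ?B] exI[of _ "max 1 M"] conjI allI impI finite_ball)
next
  assume "fellow_travelling c G (map_prod traj traj ` W)"
  then obtain B M where BM: "finite B" "\<And>m p n q. ((m, p), (n, q)) \<in> map_prod traj traj ` W \<Longrightarrow>
      \<exists>h. time_change c M m n h \<and> tracks G B h p q"
    unfolding fellow_travelling_def by blast
  obtain k where k: "B \<inter> carrier G \<subseteq> ball k" using finite_in_ball[of "B \<inter> carrier G"] BM(1) by auto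
  have "word_ft c G X \<phi> (real k + 2) M v w" if vw: "(v, w) \<in> W" for v w
  proof -
    have lists: "v \<in> lists X" "w \<in> lists X" using vw W by auto
    have "((length v, snd (traj v)), (length w, snd (traj w))) \<in> map_prod traj traj ` W"
      using vw by (intro image_eqI[of _ _ "(v, w)"]) (simp_all add: trajectory_def)
    from BM(2)[OF this] obtain h where h: "time_change c M (length v) (length w) h"
        "tracks G B h (snd (traj v)) (snd (traj w))"
      by blast
    show ?thesis
    proof (cases "c = Synchronous")
      case True
      have "skel_dist G X \<phi> (path_point G \<phi> v t) (path_point G \<phi> w t) \<le> real k + 2"
        if "t \<ge> 0" for t
      proof (rule skel_dist_le)
        show "inv (val (take (nat \<lfloor>t\<rfloor>) v)) \<otimes> val (take (nat \<lfloor>t\<rfloor>) w) \<in> ball k"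
        proof (cases "t = 0")
          case False
          then have "inv (val (take (nat \<lfloor>t\<rfloor>) v)) \<otimes> val (take (nat \<lfloor>t\<rfloor>) w) \<in> B \<inter> carrier G"
            using h True that lists unfolding time_change_def tracks_def trajectory_def
            by (simp add: take_lists)
          then show ?thesis using k by blast
        qed (simp add: one_in_ball)
      qed (use lists that in auto)
      then show ?thesis using True by (simp add: word_ft_def sync_ft_def)
    next
      case False
      then obtain h' where h': "strict_mono h" "\<forall>t. (h has_real_derivative h' t) (at t)"
          "h ` {0..real (length v)} = {0..real (length w)}"
          "c = Bounded \<longrightarrow> (\<forall>t\<le>real (length v). 1 / M \<le> h' t \<and> h' t \<le> M)"
        using h(1) unfolding time_change_def by auto
      have "async_ft_by G X \<phi> (real k + 2) v w h h'"
        using tracks_async_ft_by[OF lists h'(1-3) k h(2)] time_change_pos[OF h(1)] by blast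
      then show ?thesis using False h'(4) unfolding word_ft_def bd_async_ft_def async_ft_def
        by (cases c) auto
    qed
  qed
  then show "\<exists>K M. \<forall>(v, w)\<in>W. word_ft c G X \<phi> K M v w" by blast
qed

text \<open>Two ways of running through the same word whose positions differ by a bounded amount.\<close>
lemma reindexing_dilation:
  assumes "w \<in> lists X" "c = Synchronous \<or> (m = 0 \<longleftrightarrow> m' = 0) \<and> \<bar>int m' - int m\<bar> \<le> 1"
    and "\<And>i j. \<bar>int j - int i\<bar> \<le> 3 \<or> m \<le> i \<and> m' \<le> j \<Longrightarrow> \<bar>int (f' j) - int (f i)\<bar> \<le> 4"
  shows "dilation c G 1 (ball 4) (m, \<lambda>i. val (take (f i) w)) (m', \<lambda>j. val (take (f' j) w))"
  using assms unfolding dilation_def by (auto simp: take_lists intro!: segment_in_ball)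

lemma take_min_length: "take (min i (length w)) w = take i w"
  by (cases "i \<le> length w") auto

lemma traj_min: "traj w = (length w, \<lambda>i. val (take (min i (length w)) w))"
  by (simp add: trajectory_def take_min_length)

lemma dilation_refl: "w \<in> lists X \<Longrightarrow> dilation c G 1 (ball 4) (traj w) (traj w)"
  unfolding traj_min by (rule reindexing_dilation) auto

lemma translate_traj:
  "w \<in> lists X \<Longrightarrow> x \<in> X \<Longrightarrow> translate G (\<phi> x) (traj w) =
    (length w, \<lambda>i. val (take (Suc (min i (length w))) (x # w)))"
  by (simp add: translate_def trajectory_def take_min_length)

lemma dilation_prefix:
  assumes "w \<in> lists X" "x \<in> X" "c = Synchronous \<or> w \<noteq> []"
  shows "dilation c G 1 (ball 4) (translate G (\<phi> x) (traj w)) (traj (x # w))"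
    and "dilation c G 1 (ball 4) (traj (x # w)) (translate G (\<phi> x) (traj w))"
  unfolding translate_traj[OF assms(1,2)] traj_min[of "x # w"]
  by (rule reindexing_dilation; use assms in auto)+

lemma dilation_append:
  assumes "w \<in> lists X" "z \<in> X" "c = Synchronous \<or> w \<noteq> []"
  shows "dilation c G 1 (ball 4) (traj w) (traj (w @ [z]))"
proof -
  have "traj w = (length w, \<lambda>i. val (take (min i (length w)) (w @ [z])))"
    by (simp add: trajectory_def take_min_length)
  then show ?thesis unfolding traj_min[of "w @ [z]"]
    by (simp only:, intro reindexing_dilation) (use assms in auto)
qed

end

context marked_group
begin

text \<open>To compare \<open>v\<close> with a representative of \<open>v g\<close>, spell \<open>g\<close> as a product of generators and choose
  representatives in \<open>L\<close> of the successive products. Consecutive ones fellow travel.\<close>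
lemma right_pairs_words:
  assumes L: "language_for G X \<phi> L" and g: "g \<in> carrier G"
    and base: "\<And>x. x \<in> X \<Longrightarrow> fellow_travelling c G (right_pairs G \<phi> L (\<phi> x))"
      "fellow_travelling c G (right_pairs G \<phi> L \<one>)"
  shows "fellow_travelling c G (right_pairs G \<phi> L g)"
proof -
  have lists: "\<And>v. v \<in> L \<Longrightarrow> v \<in> lists X" and rep: "\<And>h. h \<in> carrier G \<Longrightarrow> \<exists>w\<in>L. val w = h"
    using L unfolding language_for_def by blast+
  have "fellow_travelling c G (right_pairs G \<phi> L (val u))" if "u \<in> lists X" for u
    using that
  proof (induction u rule: list.induct)
    case Nil
    then show ?case using base(2) by simp
  next
    case (Cons x u)
    have xu: "x \<in> X" "u \<in> lists X" using Cons.prems by simp_all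
    have "right_pairs G \<phi> L (val (x # u)) \<subseteq>
        right_pairs G \<phi> L (\<phi> x) O right_pairs G \<phi> L (val u)"
    proof
      fix pq assume "pq \<in> right_pairs G \<phi> L (val (x # u))"
      then obtain v w where vw: "pq = (traj v, traj w)" "v \<in> L" "w \<in> L"
          "val w = val v \<otimes> val (x # u)"
        unfolding right_pairs_def by blast
      obtain v' where v': "v' \<in> L" "val v' = val v \<otimes> \<phi> x"
        using rep[of "val v \<otimes> \<phi> x"] lists[OF vw(2)] xu(1) by auto
      have "val w = val v' \<otimes> val u"
        using vw(4) v'(2) xu lists[OF vw(2)] by (simp add: m_assoc)
      then show "pq \<in> right_pairs G \<phi> L (\<phi> x) O right_pairs G \<phi> L (val u)"
        using vw v' unfolding right_pairs_def by blast
    qed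
    from fellow_travelling_subset[OF fellow_travelling_relcomp[OF
        base(1)[OF xu(1)] Cons.IH[OF xu(2)]] this]
    show ?case .
  qed
  moreover obtain u where "u \<in> lists X" "val u = g" using word_exists[OF g] by metis
  ultimately show ?thesis by metis
qed

text \<open>The same chain on the left. If the path \<open>v\<close> translated by \<open>u\<close> fellow travels with \<open>v' \<in> L\<close>, then so
  do their translates by \<open>x\<close>, because left translation is an isometry; and \<open>v'\<close> translated by \<open>x\<close> fellow
  travels with a representative in \<open>L\<close> of \<open>x v'\<close>.\<close>
lemma left_pairs_words:
  assumes L: "language_for G X \<phi> L" and g: "g \<in> carrier G"
    and base: "\<And>x. x \<in> X \<Longrightarrow> fellow_travelling c G (left_pairs G \<phi> L (\<phi> x))"
      "fellow_travelling c G (right_pairs G \<phi> L \<one>)"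
  shows "fellow_travelling c G (left_pairs G \<phi> L g)"
proof -
  have lists: "\<And>v. v \<in> L \<Longrightarrow> v \<in> lists X" and rep: "\<And>h. h \<in> carrier G \<Longrightarrow> \<exists>w\<in>L. val w = h"
    using L unfolding language_for_def by blast+
  have translate_one: "translate G \<one> (traj v) = traj v" if "v \<in> lists X" for v
    using that by (simp add: translate_def trajectory_def)
  have translate_mult: "translate G (a \<otimes> b) (traj v) = translate G a (translate G b (traj v))"
    if "v \<in> lists X" "a \<in> carrier G" "b \<in> carrier G" for v a b
    using that by (simp add: translate_def trajectory_def m_assoc)
  have "fellow_travelling c G (left_pairs G \<phi> L (val u))" if "u \<in> lists X" for u
    using that
  proof (induction u rule: list.induct)
    case Nil
    have "left_pairs G \<phi> L \<one> \<subseteq> right_pairs G \<phi> L \<one>"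
      unfolding left_pairs_def right_pairs_def using translate_one lists by fastforce
    then show ?case using base(2) fellow_travelling_subset by fastforce
  next
    case (Cons x u)
    have xu: "x \<in> X" "u \<in> lists X" using Cons.prems by simp_all
    let ?T = "translate G (\<phi> x)"
    have "left_pairs G \<phi> L (val (x # u)) \<subseteq>
        map_prod ?T ?T ` left_pairs G \<phi> L (val u) O left_pairs G \<phi> L (\<phi> x)"
    proof
      fix pq assume "pq \<in> left_pairs G \<phi> L (val (x # u))"
      then obtain v w where vw: "pq = (translate G (val (x # u)) (traj v), traj w)" "v \<in> L" "w \<in> L"
          "val w = val (x # u) \<otimes> val v"
        unfolding left_pairs_def by blast
      obtain v' where v': "v' \<in> L" "val v' = val u \<otimes> val v"
        using rep[of "val u \<otimes> val v"] lists[OF vw(2)] xu(2) by auto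
      have "val w = \<phi> x \<otimes> val v'"
        using vw(4) v'(2) xu lists[OF vw(2)] by (simp add: m_assoc)
      then have "(?T (traj v'), traj w) \<in> left_pairs G \<phi> L (\<phi> x)"
        using vw(3) v'(1) unfolding left_pairs_def by blast
      moreover have "(translate G (val u) (traj v), traj v') \<in> left_pairs G \<phi> L (val u)"
        using vw(2) v' unfolding left_pairs_def by blast
      then have "(?T (translate G (val u) (traj v)), ?T (traj v')) \<in>
          map_prod ?T ?T ` left_pairs G \<phi> L (val u)"
        by (intro image_eqI) auto
      moreover have "translate G (val (x # u)) (traj v) = ?T (translate G (val u) (traj v))"
        using translate_mult lists[OF vw(2)] xu by simp
      ultimately show "pq \<in> map_prod ?T ?T ` left_pairs G \<phi> L (val u) O left_pairs G \<phi> L (\<phi> x)"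
        unfolding vw(1) by (simp only:) (rule relcompI)
    qed
    from fellow_travelling_subset[OF fellow_travelling_relcomp[OF
        fellow_travelling_translate[OF Cons.IH[OF xu(2)] phi_closed[OF xu(1)]] base(1)[OF xu(1)]] this]
    show ?case .
  qed
  moreover obtain u where "u \<in> lists X" "val u = g" using word_exists[OF g] by metis
  ultimately show ?thesis by metis
qed

definition prefix_pairs :: "nat list set \<Rightarrow> nat \<Rightarrow> ('a trajectory \<times> 'a trajectory) set" where
  "prefix_pairs L x = {(traj (x # v), traj w) | v w. v \<in> L \<and> w \<in> L \<and> val w = val (x # v)}"

text \<open>The path labelled \<open>x v\<close> is the path \<open>v\<close> translated by \<open>x\<close>, preceded by one edge.\<close>
lemma prefix_pairs_iff:
  assumes "L \<subseteq> lists X" "x \<in> X" "c = Synchronous \<or> [] \<notin> L"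
  shows "fellow_travelling c G (prefix_pairs L x) \<longleftrightarrow> fellow_travelling c G (left_pairs G \<phi> L (\<phi> x))"
proof
  assume *: "fellow_travelling c G (prefix_pairs L x)"
  show "fellow_travelling c G (left_pairs G \<phi> L (\<phi> x))"
  proof (rule fellow_travelling_dilation[OF * order_refl finite_ball])
    fix P' Q' assume "(P', Q') \<in> left_pairs G \<phi> L (\<phi> x)"
    then obtain v w where "P' = translate G (\<phi> x) (traj v)" "Q' = traj w" "v \<in> L" "w \<in> L"
        "val w = \<phi> x \<otimes> val v"
      unfolding left_pairs_def by blast
    moreover then have "v \<in> lists X" "w \<in> lists X" "c = Synchronous \<or> v \<noteq> []" using assms by auto
    ultimately show "\<exists>P Q. (P, Q) \<in> prefix_pairs L x \<and>
        dilation c G 1 (ball 4) P P' \<and> dilation c G 1 (ball 4) Q Q'"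
      using dilation_prefix(2)[of v x c] dilation_refl[of w c] assms(2)
      by (intro exI[of _ "traj (x # v)"] exI[of _ "traj w"])
        (auto simp: prefix_pairs_def simp del: lists.Cons)
  qed
next
  assume *: "fellow_travelling c G (left_pairs G \<phi> L (\<phi> x))"
  show "fellow_travelling c G (prefix_pairs L x)"
  proof (rule fellow_travelling_dilation[OF * order_refl finite_ball])
    fix P' Q' assume "(P', Q') \<in> prefix_pairs L x"
    then obtain v w where "P' = traj (x # v)" "Q' = traj w" "v \<in> L" "w \<in> L"
        "val w = \<phi> x \<otimes> val v"
      unfolding prefix_pairs_def by auto
    moreover then have "v \<in> lists X" "w \<in> lists X" "c = Synchronous \<or> v \<noteq> []" using assms by auto
    ultimately show "\<exists>P Q. (P, Q) \<in> left_pairs G \<phi> L (\<phi> x) \<and>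
        dilation c G 1 (ball 4) P P' \<and> dilation c G 1 (ball 4) Q Q'"
      using dilation_prefix(1)[of v x c] dilation_refl[of w c] assms(2)
      by (intro exI[of _ "translate G (\<phi> x) (traj v)"] exI[of _ "traj w"])
        (auto simp: left_pairs_def)
  qed
qed

text \<open>If \<open>[] \<in> L\<close>, let \<open>w \<in> L\<close> represent a generator \<open>x\<close>. Then \<open>w\<close> fellow travels with \<open>[]\<close>, hence is
  empty, and also with \<open>[x]\<close>, hence is not.\<close>
lemma nonempty_words:
  assumes L: "language_for G X \<phi> L" and c: "c \<noteq> Synchronous"
    and right: "fellow_travelling c G (right_pairs G \<phi> L (\<phi> x))"
    and left: "fellow_travelling c G (prefix_pairs L x)" and x: "x \<in> X"
  shows "[] \<notin> L"
proof
  assume nil: "[] \<in> L"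
  obtain w where w: "w \<in> L" "val w = \<phi> x" using L x phi_closed[OF x] unfolding language_for_def by blast
  have "(traj [], traj w) \<in> right_pairs G \<phi> L (\<phi> x)"
    using nil w x unfolding right_pairs_def by fastforce
  from fellow_travelling_empty_iff[OF right this c] have "w = []" by simp
  moreover have "(traj [x], traj w) \<in> prefix_pairs L x"
    using nil w x unfolding prefix_pairs_def by fastforce
  from fellow_travelling_empty_iff[OF left this c] have "w \<noteq> []" by simp
  ultimately show False by simp
qed

lemma combing_word_ft:
  "combing \<tau> G X \<phi> L \<longleftrightarrow> (\<exists>K M.
     (if two_sided \<tau> then bicombing_wrt G X \<phi> L (word_ft (timing_of \<tau>) G X \<phi> K M)
      else combing_wrt G X \<phi> L (word_ft (timing_of \<tau>) G X \<phi> K M)))"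
  by (cases \<tau>) (simp_all add: word_ft_def[abs_def] two_sided_def)

lemma combing_fellow_travelling:
  "combing \<tau> G X \<phi> L \<longleftrightarrow> language_for G X \<phi> L \<and>
     (\<forall>g\<in>\<phi> ` X \<union> {\<one>}. fellow_travelling (timing_of \<tau>) G (right_pairs G \<phi> L g)) \<and>
     (two_sided \<tau> \<longrightarrow> (\<forall>x\<in>X. fellow_travelling (timing_of \<tau>) G (prefix_pairs L x)))"
proof (cases "language_for G X \<phi> L")
  case True
  then have L: "L \<subseteq> lists X" by (simp add: language_for_def)
  let ?c = "timing_of \<tau>"
  let ?S = "\<phi> ` X \<union> {\<one>}"
  define W where "W = (\<Union>g\<in>?S. {(v, w). v \<in> L \<and> w \<in> L \<and> val w = val v \<otimes> g})"
  define V where "V = (if two_sided \<tau> then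
      (\<Union>x\<in>X. {(x # v, w) | v w. v \<in> L \<and> w \<in> L \<and> val w = val (x # v)}) else {})"
  have sub: "W \<union> V \<subseteq> lists X \<times> lists X"
    using L unfolding W_def V_def by (auto split: if_splits) (use L in blast)+
  have "(\<forall>(v, w)\<in>W \<union> V. R v w) \<longleftrightarrow>
    (if two_sided \<tau> then bicombing_wrt G X \<phi> L R else combing_wrt G X \<phi> L R)" for R
    using True unfolding bicombing_wrt_def combing_wrt_def W_def V_def by auto
  then have "combing \<tau> G X \<phi> L \<longleftrightarrow> (\<exists>K M. \<forall>(v, w)\<in>W \<union> V. word_ft ?c G X \<phi> K M v w)"
    unfolding combing_word_ft by simp
  also have "\<dots> \<longleftrightarrow> fellow_travelling ?c G (map_prod traj traj ` (W \<union> V))"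
    using fellow_travelling_words[OF sub] .
  also have "map_prod traj traj ` (W \<union> V) = (\<Union>g\<in>?S. right_pairs G \<phi> L g) \<union>
      (if two_sided \<tau> then (\<Union>x\<in>X. prefix_pairs L x) else {})"
  proof -
    have img: "map_prod traj traj ` {(v, w). P v w} = {(traj v, traj w) | v w. P v w}" for P
      by force
    have "map_prod traj traj ` {(f v, w) | v w. P v w} = {(traj (f v), traj w) | v w. P v w}"
      for P and f :: "nat list \<Rightarrow> nat list" by force
    note img = img this
    have "map_prod traj traj ` W = (\<Union>g\<in>?S. right_pairs G \<phi> L g)"
      unfolding W_def right_pairs_def image_UN img ..
    moreover have "map_prod traj traj ` V = (if two_sided \<tau> then (\<Union>x\<in>X. prefix_pairs L x) else {})"
      unfolding V_def prefix_pairs_def by (cases "two_sided \<tau>") (simp_all only: image_UN img if_True if_False image_empty)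
    ultimately show ?thesis by (simp only: image_Un)
  qed
  also have "fellow_travelling ?c G ((\<Union>g\<in>?S. right_pairs G \<phi> L g) \<union>
      (if two_sided \<tau> then (\<Union>x\<in>X. prefix_pairs L x) else {})) \<longleftrightarrow>
    (\<forall>g\<in>?S. fellow_travelling ?c G (right_pairs G \<phi> L g)) \<and>
    (two_sided \<tau> \<longrightarrow> (\<forall>x\<in>X. fellow_travelling ?c G (prefix_pairs L x)))" (is "?l \<longleftrightarrow> ?r")
  proof
    assume ?l
    then show ?r by (auto intro: fellow_travelling_subset)
  next
    assume ?r
    then show ?l using finite_X
      by (auto intro!: fellow_travelling_Un fellow_travelling_UN fellow_travelling_empty)
  qed
  finally show ?thesis using True by simp
next
  case False
  then show ?thesis unfolding combing_word_ft bicombing_wrt_def combing_wrt_def by simp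
qed

text \<open>Being a combing of a given type depends on the alphabet only through the trajectories of the
  words.\<close>
theorem combing_iff_coarse:
  "combing \<tau> G X \<phi> L \<longleftrightarrow> L \<subseteq> lists X \<and> coarse_combing \<tau> G \<phi> L"
proof
  assume c: "combing \<tau> G X \<phi> L"
  then have L: "language_for G X \<phi> L"
    and r: "x \<in> X \<Longrightarrow> fellow_travelling (timing_of \<tau>) G (right_pairs G \<phi> L (\<phi> x))"
      "fellow_travelling (timing_of \<tau>) G (right_pairs G \<phi> L \<one>)"
    and l: "two_sided \<tau> \<Longrightarrow> x \<in> X \<Longrightarrow> fellow_travelling (timing_of \<tau>) G (prefix_pairs L x)" for x
    unfolding combing_fellow_travelling by blast+
  have sub: "L \<subseteq> lists X" using L by (simp add: language_for_def)
  obtain x where x: "x \<in> X" using X_nonempty by blast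
  have ne: "[] \<notin> L" if "two_sided \<tau>" "timing_of \<tau> \<noteq> Synchronous"
    using nonempty_words[OF L that(2) r(1)[OF x] l[OF that(1) x] x] .
  have "fellow_travelling (timing_of \<tau>) G (left_pairs G \<phi> L g)"
    if "two_sided \<tau>" "g \<in> carrier G" for g
  proof (rule left_pairs_words[OF L that(2) _ r(2)])
    fix y assume y: "y \<in> X"
    show "fellow_travelling (timing_of \<tau>) G (left_pairs G \<phi> L (\<phi> y))"
      using prefix_pairs_iff[OF sub y] ne[OF that(1)] l[OF that(1) y] by blast
  qed
  then show "L \<subseteq> lists X \<and> coarse_combing \<tau> G \<phi> L"
    using L sub ne right_pairs_words[OF L _ r] unfolding coarse_combing_def language_for_def by blast
next
  assume c: "L \<subseteq> lists X \<and> coarse_combing \<tau> G \<phi> L"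
  have "fellow_travelling (timing_of \<tau>) G (prefix_pairs L x)" if "two_sided \<tau>" "x \<in> X" for x
  proof -
    have "timing_of \<tau> = Synchronous \<or> [] \<notin> L"
      "fellow_travelling (timing_of \<tau>) G (left_pairs G \<phi> L (\<phi> x))"
      using c that unfolding coarse_combing_def by auto
    then show ?thesis using prefix_pairs_iff c that(2) by blast
  qed
  then show "combing \<tau> G X \<phi> L"
    using c unfolding combing_fellow_travelling coarse_combing_def language_for_def by auto
qed

end

section \<open>Appending a letter\<close>

lemma time_change_id: "time_change c 1 m m (\<lambda>t. t)"
proof -
  have "((\<lambda>t::real. t) has_real_derivative 1) (at t)" for t by simp
  then show ?thesis unfolding time_change_def
    by (auto intro!: strict_monoI exI[of _ "\<lambda>_. 1"])
qed

lemma generating_setI: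
  assumes "group G" "finite X" "X \<noteq> {}" "\<phi> ` X \<subseteq> carrier G"
    and "\<And>x. x \<in> X \<Longrightarrow> \<exists>y\<in>X. \<phi> y = inv\<^bsub>G\<^esub> (\<phi> x)"
    and words: "\<And>g. g \<in> carrier G \<Longrightarrow> \<exists>w\<in>lists X. word_val G \<phi> w = g"
  shows "generating_set G X \<phi>"
proof -
  have "word_val G \<phi> w \<in> generate G (\<phi> ` X)" if "w \<in> lists X" for w
    using that by (induction w rule: list.induct) (auto intro: generate.intros)
  then have "carrier G \<subseteq> generate G (\<phi> ` X)" using words by blast
  moreover have "generate G (\<phi> ` X) \<subseteq> carrier G" using group.generate_incl assms(1,4) by blast
  ultimately show ?thesis using assms unfolding generating_set_def by blast
qed

text \<open>Fresh symbols are added for the elements of \<open>E\<close> and for all inverses, so that the enlarged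
  alphabet is inverse closed; the words of the hypothesis make it generate the group.\<close>
lemma extend_marking:
  assumes "group G" "finite X" "\<phi> ` X \<subseteq> carrier G" "finite E" "E \<subseteq> carrier G" "E \<noteq> {}"
    and "\<And>g. g \<in> carrier G \<Longrightarrow> \<exists>w\<in>lists X. \<exists>e\<in>E. word_val G \<phi> w \<otimes>\<^bsub>G\<^esub> e = g"
  obtains Y \<psi> S where "generating_set G Y \<psi>" "X \<subseteq> Y" "\<forall>x\<in>X. \<psi> x = \<phi> x"
    "finite S" "S \<subseteq> Y" "\<psi> ` S = E"
proof -
  interpret group G by fact
  let ?D = "\<phi> ` X \<union> E"
  define A where "A = ?D \<union> m_inv G ` ?D"
  have A: "finite A" "A \<subseteq> carrier G" "E \<subseteq> A" using assms unfolding A_def by auto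
  have D: "?D \<subseteq> carrier G" using assms by auto
  have A_inv: "inv\<^bsub>G\<^esub> a \<in> A" if a: "a \<in> A" for a
  proof (cases "a \<in> ?D")
    case True
    then show ?thesis unfolding A_def by (rule UnI2[OF imageI])
  next
    case False
    then obtain d where d: "d \<in> ?D" "a = inv\<^bsub>G\<^esub> d" using a unfolding A_def by blast
    have "inv\<^bsub>G\<^esub> a = d" unfolding d(2) by (rule inv_inv[OF subsetD[OF D d(1)]])
    then show ?thesis using d(1) unfolding A_def by simp
  qed
  obtain f :: "'a \<Rightarrow> nat" where f: "inj_on f A" using finite_imp_inj_to_nat_seg[OF A(1)] by metis
  obtain k where k: "\<And>x. x \<in> X \<Longrightarrow> x < k" using assms(2) by (meson finite_nat_set_iff_bounded)
  \<comment> \<open>The symbols from \<open>k\<close> on are not in use.\<close>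
  define s where "s = (\<lambda>a. k + f a)"
  have s: "inj_on s A" "s a \<notin> X" for a
    using f k[of "s a"] unfolding s_def by (auto simp: inj_on_def)
  define Y where "Y = X \<union> s ` A"
  define \<psi> where "\<psi> = (\<lambda>y. if y \<in> X then \<phi> y else the_inv_into A s y)"
  have \<psi>_old: "\<psi> x = \<phi> x" if "x \<in> X" for x using that by (simp add: \<psi>_def)
  have \<psi>_new: "\<psi> (s a) = a" if "a \<in> A" for a
    using that s by (simp add: \<psi>_def the_inv_into_f_f)
  have \<psi>_A: "\<psi> y \<in> A" if "y \<in> Y" for y
    using that \<psi>_old \<psi>_new unfolding Y_def A_def by auto
  have gen: "generating_set G Y \<psi>"
  proof (rule generating_setI)
    show "finite Y" "Y \<noteq> {}" using assms(2,6) A unfolding Y_def by auto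
    show "\<psi> ` Y \<subseteq> carrier G" using \<psi>_A A(2) by blast
    show "\<exists>y\<in>Y. \<psi> y = inv\<^bsub>G\<^esub> (\<psi> x)" if "x \<in> Y" for x
      using \<psi>_new[OF A_inv[OF \<psi>_A[OF that]]] A_inv[OF \<psi>_A[OF that]] unfolding Y_def by blast
  next
    fix g assume "g \<in> carrier G"
    then obtain w e where w: "w \<in> lists X" "e \<in> E" "word_val G \<phi> w \<otimes>\<^bsub>G\<^esub> e = g" using assms(7) by metis
    have "w \<in> lists X \<Longrightarrow> word_val G \<psi> (w @ [s e]) = word_val G \<phi> w \<otimes>\<^bsub>G\<^esub> e" for w
    proof (induction w rule: list.induct)
      case Nil
      have "e \<in> A" "e \<in> carrier G" using w(2) A by auto
      then show ?case using \<psi>_new by simp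
    next
      case (Cons x w)
      then have "\<phi> x \<in> carrier G" "word_val G \<phi> w \<in> carrier G" "e \<in> carrier G"
        using word_val_closed[OF assms(3)] assms(3,5) w(2) by auto
      then show ?case using Cons \<psi>_old by (simp add: m_assoc)
    qed
    then show "\<exists>w\<in>lists Y. word_val G \<psi> w = g"
      using w A(3) by (intro bexI[of _ "w @ [s e]"]) (auto simp: Y_def)
  qed fact
  show thesis
  proof (rule that[OF gen])
    show "\<forall>x\<in>X. \<psi> x = \<phi> x" using \<psi>_old by blast
    show "X \<subseteq> Y" "s ` E \<subseteq> Y" "finite (s ` E)" using A(3) assms(4) unfolding Y_def by auto
    show "\<psi> ` s ` E = E" using \<psi>_new A(3) by (auto simp: image_iff subset_iff)
  qed
qed

lemma (in group) dilation_translate: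
  assumes "g \<in> carrier G" "dilation c G k E P P'"
  shows "dilation c G k E (translate G g P) (translate G g P')"
proof -
  obtain m p m' p' where P: "P = (m, p)" "P' = (m', p')" by (cases P; cases P')
  note d = assms(2)[unfolded P]
  note car = dilationD(1,2)[OF d]
  have "range (\<lambda>i. g \<otimes> p i) \<subseteq> carrier G" "range (\<lambda>i. g \<otimes> p' i) \<subseteq> carrier G"
    using car assms(1) by auto
  moreover have "inv (g \<otimes> p i) \<otimes> (g \<otimes> p' j) = inv (p i) \<otimes> p' j" for i j
    using car assms(1) by (simp add: inv_mult_translate)
  moreover note dilationD(3,4)[OF d]
  ultimately show ?thesis unfolding P dilation_def translate_def prod.case
    by (simp del: of_nat_mult) blast
qed

context marked_group
begin

lemma fellow_travelling_letters:
  "fellow_travelling c G {(traj [z], traj [z']) | z z'. z \<in> X \<and> z' \<in> X}"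
proof -
  have prefix: "val (take i [z]) \<in> ball 1" if "z \<in> X" for i z
    using that unfolding word_ball_def by (intro imageI) (auto simp: take_Cons')
  have "inv (val (take i [z])) \<otimes> val (take j [z']) \<in> ball (1 + 1)"
    if "z \<in> X" "z' \<in> X" for i j z z'
    using ball_mult[OF ball_inv[OF prefix[OF that(1)]] prefix[OF that(2)]] .
  then have "tracks G (ball 2) (\<lambda>t. t) (snd (traj [z])) (snd (traj [z']))"
    if "z \<in> X" "z' \<in> X" for z z'
    using that unfolding tracks_def trajectory_def by (auto simp: numeral_2_eq_2)
  then have "\<exists>h. time_change c 1 m n h \<and> tracks G (ball 2) h p q"
    if "((m, p), (n, q)) \<in> {(traj [z], traj [z']) | z z'. z \<in> X \<and> z' \<in> X}" for m n p q
    using that time_change_id[of c 1] by (auto simp: trajectory_def)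
  then show ?thesis
    unfolding fellow_travelling_def
    by (intro exI[of _ "ball 2"] exI[of _ 1] conjI allI impI finite_ball)
qed

text \<open>Appending one letter to each of two words is a dilation with factor \<open>1\<close>, except that an empty
  word becomes non-empty. In that case both words are empty, and the resulting one-letter words
  stay in a ball of radius \<open>2\<close> about each other.\<close>
lemma fellow_travelling_append:
  assumes R: "fellow_travelling c G R"
    and R': "\<And>P' Q'. (P', Q') \<in> R' \<Longrightarrow> \<exists>g v w z z'. g \<in> carrier G \<and> v \<in> lists X \<and> w \<in> lists X \<and>
      z \<in> X \<and> z' \<in> X \<and> P' = translate G g (traj (v @ [z])) \<and> Q' = traj (w @ [z']) \<and>
      (translate G g (traj v), traj w) \<in> R \<and> (c = Synchronous \<or> v \<noteq> [] \<or> g = \<one>)"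
  shows "fellow_travelling c G R'"
proof -
  define short where "short = {(traj [z], traj [z']) | z z'. z \<in> X \<and> z' \<in> X}"
  have long: "fellow_travelling c G (R' - short)"
  proof (rule fellow_travelling_dilation[OF R order_refl finite_ball])
    fix P' Q' assume P'Q': "(P', Q') \<in> R' - short"
    then obtain g v w z z' where *: "g \<in> carrier G" "v \<in> lists X" "w \<in> lists X" "z \<in> X" "z' \<in> X"
      "P' = translate G g (traj (v @ [z]))" "Q' = traj (w @ [z'])"
      "(translate G g (traj v), traj w) \<in> R" "c = Synchronous \<or> v \<noteq> [] \<or> g = \<one>"
      using R' by (metis DiffD1)
    have vw: "v = [] \<longleftrightarrow> w = []" if "c \<noteq> Synchronous"
      using fellow_travelling_empty_iff[OF R *(8) that] by simp
    have "c = Synchronous \<or> v \<noteq> []"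
    proof (rule ccontr)
      assume c: "\<not> (c = Synchronous \<or> v \<noteq> [])"
      then have "v = []" "w = []" "g = \<one>" using vw *(9) by auto
      moreover have "translate G \<one> (traj [z]) = traj [z]"
        using *(4) by (simp add: translate_def trajectory_def)
      ultimately have "(P', Q') \<in> short" using * unfolding short_def by auto
      then show False using P'Q' by simp
    qed
    moreover from this have "c = Synchronous \<or> w \<noteq> []" using vw by blast
    ultimately have "dilation c G 1 (ball 4) (translate G g (traj v)) P'"
      "dilation c G 1 (ball 4) (traj w) Q'"
      unfolding *(6,7) using dilation_translate[OF *(1) dilation_append[OF *(2,4)]]
        dilation_append[OF *(3,5)] by blast+
    then show "\<exists>P Q. (P, Q) \<in> R \<and> dilation c G 1 (ball 4) P P' \<and> dilation c G 1 (ball 4) Q Q'"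
      using *(8) by blast
  qed
  have "fellow_travelling c G short" unfolding short_def by (rule fellow_travelling_letters)
  from fellow_travelling_Un[OF long this] show ?thesis
    by (rule fellow_travelling_subset) blast
qed

text \<open>What concatenation with a finite set of letters requires: the words of \<open>L\<close> itself only need to
  fellow travel whenever suitable one-letter extensions of them differ by \<open>g\<close>.\<close>
lemma coarse_combing_append:
  assumes L: "L \<subseteq> lists X" and S: "S \<subseteq> X"
    and rep: "\<And>g. g \<in> carrier G \<Longrightarrow> \<exists>v\<in>L. \<exists>z\<in>S. val (v @ [z]) = g"
    and right: "\<And>g. g \<in> carrier G \<Longrightarrow> fellow_travelling (timing_of \<tau>) G
      {(traj v, traj w) | v w z z'. v \<in> L \<and> w \<in> L \<and> z \<in> S \<and> z' \<in> S \<and>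
         val (w @ [z']) = val (v @ [z]) \<otimes> g}"
    and left: "\<And>g. two_sided \<tau> \<Longrightarrow> g \<in> carrier G \<Longrightarrow> fellow_travelling (timing_of \<tau>) G
      {(translate G g (traj v), traj w) | v w z z'. v \<in> L \<and> w \<in> L \<and> z \<in> S \<and> z' \<in> S \<and>
         val (w @ [z']) = g \<otimes> val (v @ [z])}"
    and nonempty: "two_sided \<tau> \<Longrightarrow> timing_of \<tau> \<noteq> Synchronous \<Longrightarrow> [] \<notin> L"
  shows "coarse_combing \<tau> G \<phi> {u @ v | u v. u \<in> L \<and> v \<in> (\<lambda>z. [z]) ` S}"
proof -
  let ?L = "{u @ v | u v. u \<in> L \<and> v \<in> (\<lambda>z. [z]) ` S}"
  have translate_one: "translate G \<one> (traj v) = traj v" if "v \<in> lists X" for v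
    using that by (simp add: translate_def trajectory_def)
  have lists: "v \<in> lists X" if "v \<in> L" for v using that L by blast
  have "fellow_travelling (timing_of \<tau>) G (right_pairs G \<phi> ?L g)" if g: "g \<in> carrier G" for g
  proof (rule fellow_travelling_append[OF right[OF g]])
    fix P' Q' assume "(P', Q') \<in> right_pairs G \<phi> ?L g"
    then obtain v w z z' where *: "v \<in> L" "w \<in> L" "z \<in> S" "z' \<in> S" "P' = traj (v @ [z])"
      "Q' = traj (w @ [z'])" "val (w @ [z']) = val (v @ [z]) \<otimes> g"
      unfolding right_pairs_def by auto
    have "(translate G \<one> (traj v), traj w) \<in> {(traj v, traj w) | v w z z'. v \<in> L \<and> w \<in> L \<and>
        z \<in> S \<and> z' \<in> S \<and> val (w @ [z']) = val (v @ [z]) \<otimes> g}"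
      unfolding translate_one[OF lists[OF *(1)]] using *(1-4,7) by blast
    moreover have "P' = translate G \<one> (traj (v @ [z]))"
      using *(3,5) lists[OF *(1)] S by (simp add: translate_one subset_iff)
    ultimately show "\<exists>a v w z z'. a \<in> carrier G \<and> v \<in> lists X \<and> w \<in> lists X \<and> z \<in> X \<and> z' \<in> X \<and>
        P' = translate G a (traj (v @ [z])) \<and> Q' = traj (w @ [z']) \<and>
        (translate G a (traj v), traj w) \<in> {(traj v, traj w) | v w z z'. v \<in> L \<and> w \<in> L \<and>
          z \<in> S \<and> z' \<in> S \<and> val (w @ [z']) = val (v @ [z]) \<otimes> g} \<and>
        (timing_of \<tau> = Synchronous \<or> v \<noteq> [] \<or> a = \<one>)"
      using *(6) lists[OF *(1)] lists[OF *(2)] subsetD[OF S *(3)] subsetD[OF S *(4)]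
      by - (rule exI[of _ \<one>], rule exI[of _ v], rule exI[of _ w], rule exI[of _ z],
          rule exI[of _ z'], simp)
  qed
  moreover have "fellow_travelling (timing_of \<tau>) G (left_pairs G \<phi> ?L g)"
    if g: "g \<in> carrier G" and t: "two_sided \<tau>" for g
  proof (rule fellow_travelling_append[OF left[OF t g]])
    fix P' Q' assume "(P', Q') \<in> left_pairs G \<phi> ?L g"
    then obtain v w z z' where *: "v \<in> L" "w \<in> L" "z \<in> S" "z' \<in> S"
      "P' = translate G g (traj (v @ [z]))"
      "Q' = traj (w @ [z'])" "val (w @ [z']) = g \<otimes> val (v @ [z])"
      unfolding left_pairs_def by auto
    have "(translate G g (traj v), traj w) \<in> {(translate G g (traj v), traj w) | v w z z'. v \<in> L \<and>
        w \<in> L \<and> z \<in> S \<and> z' \<in> S \<and> val (w @ [z']) = g \<otimes> val (v @ [z])}"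
      using *(1-4,7) by blast
    moreover have "timing_of \<tau> = Synchronous \<or> v \<noteq> [] \<or> g = \<one>" using nonempty[OF t] *(1) by auto
    ultimately show "\<exists>a v w z z'. a \<in> carrier G \<and> v \<in> lists X \<and> w \<in> lists X \<and> z \<in> X \<and> z' \<in> X \<and>
        P' = translate G a (traj (v @ [z])) \<and> Q' = traj (w @ [z']) \<and>
        (translate G a (traj v), traj w) \<in> {(translate G g (traj v), traj w) | v w z z'. v \<in> L \<and>
          w \<in> L \<and> z \<in> S \<and> z' \<in> S \<and> val (w @ [z']) = g \<otimes> val (v @ [z])} \<and>
        (timing_of \<tau> = Synchronous \<or> v \<noteq> [] \<or> a = \<one>)"
      using *(5,6) g lists[OF *(1)] lists[OF *(2)] subsetD[OF S *(3)] subsetD[OF S *(4)]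
      by - (rule exI[of _ g], rule exI[of _ v], rule exI[of _ w], rule exI[of _ z],
          rule exI[of _ z'], intro conjI; assumption)
  qed
  moreover have "\<exists>w\<in>?L. val w = g" if "g \<in> carrier G" for g using rep[OF that] by blast
  ultimately show ?thesis unfolding coarse_combing_def by auto
qed

end

section \<open>Finite kernels\<close>

lemma (in group_hom) word_val_hom:
  assumes "\<phi> ` X \<subseteq> carrier G" "\<And>x. x \<in> X \<Longrightarrow> \<phi>' x = h (\<phi> x)" "w \<in> lists X"
  shows "word_val H \<phi>' w = h (word_val G \<phi> w)"
  using assms(3)
proof (induction w rule: list.induct)
  case (Cons x w)
  then have "\<phi> x \<in> carrier G" "word_val G \<phi> w \<in> carrier G"
    using assms(1) G.word_val_closed[OF assms(1)] by auto
  then show ?case using Cons assms(2) by simp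
qed simp

text \<open>Quotients by finite normal subgroups, up to isomorphism.\<close>
locale finite_kernel_hom = group_hom +
  assumes surj: "h ` carrier G = carrier H" and finite_kernel: "finite (kernel G H h)"
begin

lemma same_image:
  assumes "a \<in> carrier G" "b \<in> carrier G" "h a = h b"
  shows "inv a \<otimes> b \<in> kernel G H h"
  using assms by (simp add: kernel_def)

lemma finite_preimage:
  assumes "finite B"
  shows "finite {a \<in> carrier G. h a \<in> B}"
proof -
  have "finite {a \<in> carrier G. h a = b}" for b
  proof (cases "\<exists>a\<in>carrier G. h a = b")
    case True
    then obtain c where c: "c \<in> carrier G" "h c = b" by blast
    have "{a \<in> carrier G. h a = b} \<subseteq> (\<lambda>k. c \<otimes> k) ` kernel G H h"
    proof
      fix a assume "a \<in> {a \<in> carrier G. h a = b}"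
      then have "inv c \<otimes> a \<in> kernel G H h" "a = c \<otimes> (inv c \<otimes> a)"
        using c same_image[of c a] by (auto simp: G.inv_mult_cancel)
      then show "a \<in> (\<lambda>k. c \<otimes> k) ` kernel G H h" by blast
    qed
    then show ?thesis using finite_kernel finite_surj by blast
  next
    case False
    then have "{a \<in> carrier G. h a = b} = {}" by blast
    then show ?thesis by (simp only: finite.emptyI)
  qed
  then have "finite (\<Union>b\<in>B. {a \<in> carrier G. h a = b})" using assms by blast
  moreover have "{a \<in> carrier G. h a \<in> B} = (\<Union>b\<in>B. {a \<in> carrier G. h a = b})" by blast
  ultimately show ?thesis by simp
qed

lemma marking_image:
  assumes "generating_set G X \<phi>"
  shows "generating_set H X (\<lambda>x. h (\<phi> x))"
proof -
  interpret X: marked_group G X \<phi> by unfold_locales fact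
  show ?thesis
  proof (rule generating_setI)
    show "group H" "finite X" "X \<noteq> {}" "(\<lambda>x. h (\<phi> x)) ` X \<subseteq> carrier H"
      using X.finite_X X.X_nonempty by auto
    show "\<exists>y\<in>X. h (\<phi> y) = inv\<^bsub>H\<^esub> h (\<phi> x)" if "x \<in> X" for x
      using X.inverse_symbol[OF that] X.phi_closed[OF that] hom_inv by metis
    show "\<exists>w\<in>lists X. word_val H (\<lambda>x. h (\<phi> x)) w = g" if "g \<in> carrier H" for g
    proof -
      obtain a where a: "a \<in> carrier G" "g = h a" using surj \<open>g \<in> carrier H\<close> by blast
      obtain w where w: "w \<in> lists X" "word_val G \<phi> w = a" using X.word_exists[OF a(1)] by metis
      then show ?thesis using word_val_hom[OF X.img_X refl w(1)] a(2) by metis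
    qed
  qed
qed

definition push :: "'a trajectory \<Rightarrow> 'c trajectory" where
  "push = (\<lambda>(m, p). (m, \<lambda>i. h (p i)))"

lemma push_trajectory:
  assumes "\<phi> ` X \<subseteq> carrier G" "\<And>x. x \<in> X \<Longrightarrow> \<phi>' x = h (\<phi> x)" "w \<in> lists X"
  shows "push (trajectory G \<phi> w) = trajectory H \<phi>' w"
proof -
  have "take i w \<in> lists X" for i using assms(3) by (meson in_lists_conv_set in_set_takeD)
  then show ?thesis
    using word_val_hom[OF assms(1,2)] by (simp add: push_def trajectory_def)
qed

lemma push_translate:
  assumes "g \<in> carrier G" "\<And>i. snd P i \<in> carrier G"
  shows "push (translate G g P) = translate H (h g) (push P)"
  using assms by (cases P) (simp add: push_def translate_def)

lemma fellow_travelling_push: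
  assumes "fellow_travelling c G R"
  shows "fellow_travelling c H (map_prod push push ` R)"
proof (rule fellow_travelling_transfer[OF assms, where \<Phi> = "\<lambda>B. h ` B"])
  fix m p' n q' assume "((m, p'), n, q') \<in> map_prod push push ` R"
  then obtain P Q where PQ: "(P, Q) \<in> R" "push P = (m, p')" "push Q = (n, q')" by auto
  then obtain p q where pq: "P = (m, p)" "Q = (n, q)" "p' = (\<lambda>i. h (p i))" "q' = (\<lambda>i. h (q i))"
    unfolding push_def by (cases P; cases Q) simp
  note R = PQ(1)[unfolded pq(1,2)]
  note car = fellow_travelling_range[OF assms R]
  have "inv\<^bsub>H\<^esub> h (p i) \<otimes>\<^bsub>H\<^esub> h (q j) \<in> h ` B" if "inv (p i) \<otimes> q j \<in> B" for B i j
    using that car by (intro image_eqI[of _ _ "inv (p i) \<otimes> q j"]) simp_all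
  then show "\<exists>p q. ((m, p), n, q) \<in> R \<and> range p' \<subseteq> carrier H \<and> range q' \<subseteq> carrier H \<and>
      (\<forall>B i j. inv (p i) \<otimes> q j \<in> B \<longrightarrow> inv\<^bsub>H\<^esub> p' i \<otimes>\<^bsub>H\<^esub> q' j \<in> h ` B)"
    using R car unfolding pq(3,4) by - (rule exI[of _ p], rule exI[of _ q], auto)
qed simp

lemma fellow_travelling_lift:
  assumes "fellow_travelling c H (map_prod push push ` R)"
    and car: "\<And>m p n q i. ((m, p), (n, q)) \<in> R \<Longrightarrow> p i \<in> carrier G \<and> q i \<in> carrier G"
  shows "fellow_travelling c G R"
proof (rule fellow_travelling_transfer[OF assms(1), where \<Phi> = "\<lambda>B. {a \<in> carrier G. h a \<in> B}"])
  fix m p n q assume R: "((m, p), n, q) \<in> R"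
  then have "((m, \<lambda>i. h (p i)), (n, \<lambda>i. h (q i))) \<in> map_prod push push ` R"
    by (intro image_eqI[OF _ R]) (simp add: push_def)
  then show "\<exists>p' q'. ((m, p'), n, q') \<in> map_prod push push ` R \<and> range p \<subseteq> carrier G \<and>
      range q \<subseteq> carrier G \<and>
      (\<forall>B i j. inv\<^bsub>H\<^esub> p' i \<otimes>\<^bsub>H\<^esub> q' j \<in> B \<longrightarrow> inv (p i) \<otimes> q j \<in> {a \<in> carrier G. h a \<in> B})"
    using car[OF R] by - (rule exI[of _ "\<lambda>i. h (p i)"], rule exI[of _ "\<lambda>i. h (q i)"], auto)
qed (rule finite_preimage)

text \<open>The same language serves for the image. If the images of \<open>w\<close> and \<open>v g\<close> agree, then \<open>w\<close> and
  \<open>v g k\<close> agree for some \<open>k\<close> in the kernel, and there are only finitely many \<open>k\<close>.\<close>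
lemma combing_image:
  assumes gen: "generating_set G X \<phi>" and comb: "combing \<tau> G X \<phi> L"
  shows "combing \<tau> H X (\<lambda>x. h (\<phi> x)) L"
proof -
  interpret X: marked_group G X \<phi> by unfold_locales fact
  interpret Q: marked_group H X "\<lambda>x. h (\<phi> x)" by unfold_locales (rule marking_image[OF gen])
  let ?c = "timing_of \<tau>" and ?K = "kernel G H h" and ?push = "map_prod push push"
  have L: "L \<subseteq> lists X" and c: "coarse_combing \<tau> G \<phi> L"
    using comb unfolding X.combing_iff_coarse by auto
  have lists: "v \<in> lists X" if "v \<in> L" for v using that L by blast
  have val: "Q.val w = h (X.val w)" and traj: "Q.traj w = push (X.traj w)" if "w \<in> L" for w
    using word_val_hom[OF X.img_X refl] push_trajectory[OF X.img_X refl] lists[OF that] by auto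
  have rep: "\<exists>w\<in>L. X.val w = g" if "g \<in> carrier G" for g
    using c that unfolding coarse_combing_def by blast
  have K: "k \<in> ?K \<Longrightarrow> k \<in> carrier G" for k by (simp add: kernel_def)
  have "(\<exists>w\<in>L. Q.val w = h g) \<and> fellow_travelling ?c H (right_pairs H (\<lambda>x. h (\<phi> x)) L (h g)) \<and>
      (two_sided \<tau> \<longrightarrow> fellow_travelling ?c H (left_pairs H (\<lambda>x. h (\<phi> x)) L (h g)))"
    if g: "g \<in> carrier G" for g
  proof (intro conjI impI)
    show "\<exists>w\<in>L. Q.val w = h g" using rep[OF g] val by metis
  next
    let ?R = "\<Union>k\<in>?K. right_pairs G \<phi> L (g \<otimes> k)"
    have "fellow_travelling ?c G ?R"
      using c g K finite_kernel unfolding coarse_combing_def by (intro fellow_travelling_UN) auto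
    moreover have "right_pairs H (\<lambda>x. h (\<phi> x)) L (h g) \<subseteq> ?push ` ?R"
    proof
      fix pq assume "pq \<in> right_pairs H (\<lambda>x. h (\<phi> x)) L (h g)"
      then obtain v w where vw: "pq = (Q.traj v, Q.traj w)" "v \<in> L" "w \<in> L"
          "Q.val w = Q.val v \<otimes>\<^bsub>H\<^esub> h g"
        unfolding right_pairs_def by blast
      note car = X.val_closed[OF lists[OF vw(2)]] X.val_closed[OF lists[OF vw(3)]]
      have k: "inv (X.val v \<otimes> g) \<otimes> X.val w \<in> ?K"
        using vw(4) car g by (intro same_image) (simp_all add: val[OF vw(2)] val[OF vw(3)])
      have "X.val w = X.val v \<otimes> (g \<otimes> (inv (X.val v \<otimes> g) \<otimes> X.val w))"
        using car g by (simp add: G.m_assoc G.inv_mult_group G.inv_mult_cancel)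
      then have "(X.traj v, X.traj w) \<in> ?R"
        using vw(2,3) k unfolding right_pairs_def by blast
      then show "pq \<in> ?push ` ?R"
        unfolding vw(1) traj[OF vw(2)] traj[OF vw(3)] by (intro image_eqI) auto
    qed
    ultimately show "fellow_travelling ?c H (right_pairs H (\<lambda>x. h (\<phi> x)) L (h g))"
      by (rule fellow_travelling_subset[OF fellow_travelling_push])
  next
    assume two: "two_sided \<tau>"
    let ?R = "left_pairs G \<phi> L g O (\<Union>k\<in>?K. right_pairs G \<phi> L k)"
    have "fellow_travelling ?c G ?R"
    proof (intro G.fellow_travelling_relcomp fellow_travelling_UN finite_kernel)
      show "fellow_travelling ?c G (left_pairs G \<phi> L g)"
        using c g two unfolding coarse_combing_def by simp
      show "fellow_travelling ?c G (right_pairs G \<phi> L k)" if "k \<in> ?K" for k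
        using c K[OF that] unfolding coarse_combing_def by simp
    qed
    moreover have "left_pairs H (\<lambda>x. h (\<phi> x)) L (h g) \<subseteq> ?push ` ?R"
    proof
      fix pq assume "pq \<in> left_pairs H (\<lambda>x. h (\<phi> x)) L (h g)"
      then obtain v w where vw: "pq = (translate H (h g) (Q.traj v), Q.traj w)" "v \<in> L" "w \<in> L"
          "Q.val w = h g \<otimes>\<^bsub>H\<^esub> Q.val v"
        unfolding left_pairs_def by blast
      note car = X.val_closed[OF lists[OF vw(2)]] X.val_closed[OF lists[OF vw(3)]]
      obtain u where u: "u \<in> L" "X.val u = g \<otimes> X.val v" using rep[of "g \<otimes> X.val v"] car g by auto
      have k: "inv (X.val u) \<otimes> X.val w \<in> ?K"
        using vw(4) car g by (intro same_image) (simp_all add: u(2) val[OF vw(2)] val[OF vw(3)])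
      have "X.val w = X.val u \<otimes> (inv (X.val u) \<otimes> X.val w)"
        using car g by (simp add: u(2) G.inv_mult_cancel)
      then have "(X.traj u, X.traj w) \<in> (\<Union>k\<in>?K. right_pairs G \<phi> L k)"
        using u(1) vw(3) k unfolding right_pairs_def by blast
      moreover have "(translate G g (X.traj v), X.traj u) \<in> left_pairs G \<phi> L g"
        using u vw(2) unfolding left_pairs_def by blast
      ultimately have R: "(translate G g (X.traj v), X.traj w) \<in> ?R" by blast
      have "push (translate G g (X.traj v)) = translate H (h g) (Q.traj v)"
        unfolding traj[OF vw(2)] using g lists[OF vw(2)]
        by (intro push_translate) (simp_all add: trajectory_def)
      then show "pq \<in> ?push ` ?R"
        unfolding vw(1) traj[OF vw(3)] by (intro image_eqI[OF _ R]) simp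
    qed
    ultimately show "fellow_travelling ?c H (left_pairs H (\<lambda>x. h (\<phi> x)) L (h g))"
      by (rule fellow_travelling_subset[OF fellow_travelling_push])
  qed
  then have "coarse_combing \<tau> H (\<lambda>x. h (\<phi> x)) L"
    using c unfolding coarse_combing_def surj[symmetric] by simp
  then show ?thesis using L unfolding Q.combing_iff_coarse by simp
qed

text \<open>Lift the generators arbitrarily and append a letter for an element of the kernel to every
  word: the lifted words meet every coset of the kernel, and the last letter selects the element.
  Fellow travelling lifts because the preimage of a finite set of differences is finite.\<close>
lemma combing_lift:
  assumes gen: "generating_set H X \<phi>" and comb: "combing \<tau> H X \<phi> L"
  shows "\<exists>Y \<psi> S. generating_set G Y \<psi> \<and> finite S \<and> combing \<tau> G Y \<psi> {u @ v | u v. u \<in> L \<and> v \<in> S}"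
proof -
  interpret X: marked_group H X \<phi> by unfold_locales fact
  let ?c = "timing_of \<tau>" and ?K = "kernel G H h" and ?push = "map_prod push push"
  have L: "L \<subseteq> lists X" and c: "coarse_combing \<tau> H \<phi> L"
    using comb unfolding X.combing_iff_coarse by auto
  have "\<exists>g. g \<in> carrier G \<and> h g = \<phi> x" if "x \<in> X" for x
    using X.phi_closed[OF that] unfolding surj[symmetric] by (elim imageE) (intro exI conjI, auto)
  note lift = this
  define \<psi>0 where "\<psi>0 = (\<lambda>x. SOME g. g \<in> carrier G \<and> h g = \<phi> x)"
  have \<psi>0: "\<psi>0 x \<in> carrier G \<and> h (\<psi>0 x) = \<phi> x" if "x \<in> X" for x
    unfolding \<psi>0_def by (rule someI_ex[OF lift[OF that]])
  have img0: "\<psi>0 ` X \<subseteq> carrier G" using \<psi>0 by (simp add: image_subset_iff)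
  have rep0: "\<exists>w\<in>L. \<exists>e\<in>?K. word_val G \<psi>0 w \<otimes> e = g" if g: "g \<in> carrier G" for g
  proof -
    obtain w where w: "w \<in> L" "X.val w = h g"
      using c hom_closed[OF g] unfolding coarse_combing_def by blast
    then have wl: "w \<in> lists X" using L by blast
    have "word_val G \<psi>0 w \<in> carrier G" using G.word_val_closed[OF img0 wl] .
    moreover have "h (word_val G \<psi>0 w) = h g"
      using word_val_hom[OF img0 _ wl, of \<phi>] \<psi>0 w(2) by simp
    ultimately have "inv (word_val G \<psi>0 w) \<otimes> g \<in> ?K"
      "word_val G \<psi>0 w \<otimes> (inv (word_val G \<psi>0 w) \<otimes> g) = g"
      using g by (simp_all add: same_image G.inv_mult_cancel)
    then show ?thesis using w(1) by blast
  qed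
  have K: "?K \<subseteq> carrier G" "?K \<noteq> {}" using G.one_closed hom_one unfolding kernel_def by blast+
  have rep1: "\<exists>w\<in>lists X. \<exists>e\<in>?K. word_val G \<psi>0 w \<otimes> e = g" if "g \<in> carrier G" for g
    using rep0[OF that] L by blast
  obtain Y \<psi> S where Y: "generating_set G Y \<psi>" "X \<subseteq> Y" "\<forall>x\<in>X. \<psi> x = \<psi>0 x"
    "finite S" "S \<subseteq> Y" "\<psi> ` S = ?K"
    using extend_marking[OF G.group_axioms X.finite_X img0 finite_kernel K rep1] by metis
  interpret Y: marked_group G Y \<psi> by unfold_locales fact
  have lists: "v \<in> lists X" "v \<in> lists Y" if "v \<in> L" for v
    using that L lists_mono[OF Y(2)] by blast+
  have \<psi>X: "\<psi> ` X \<subseteq> carrier G" "\<And>x. x \<in> X \<Longrightarrow> \<phi> x = h (\<psi> x)" using Y(3) \<psi>0 by auto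
  have val: "X.val w = h (Y.val w)" and traj: "X.traj w = push (Y.traj w)" if "w \<in> L" for w
    using word_val_hom[OF \<psi>X lists(1)[OF that]] push_trajectory[OF \<psi>X lists(1)[OF that]] by auto
  have letter: "Y.val (v @ [z]) = Y.val v \<otimes> \<psi> z" "\<psi> z \<in> carrier G" "h (\<psi> z) = \<one>\<^bsub>H\<^esub>"
    "Y.val v \<in> carrier G"
    if "v \<in> L" "z \<in> S" for v z
  proof -
    have "\<psi> z \<in> ?K" using Y(6) that(2) by blast
    then show "\<psi> z \<in> carrier G" "h (\<psi> z) = \<one>\<^bsub>H\<^esub>" by (simp_all add: kernel_def)
    then show "Y.val (v @ [z]) = Y.val v \<otimes> \<psi> z" "Y.val v \<in> carrier G"
      using Y.val_append[OF lists(2)[OF that(1)], of "[z]"] that lists(2) Y(5) by auto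
  qed
  have "coarse_combing \<tau> G \<psi> {u @ v | u v. u \<in> L \<and> v \<in> (\<lambda>z. [z]) ` S}"
  proof (rule Y.coarse_combing_append)
    show "L \<subseteq> lists Y" using lists by blast
    show "S \<subseteq> Y" by fact
    show "two_sided \<tau> \<Longrightarrow> ?c \<noteq> Synchronous \<Longrightarrow> [] \<notin> L" using c unfolding coarse_combing_def by blast
    have vcong: "word_val G \<psi> w = word_val G \<psi>0 w" if "w \<in> lists X" for w
      using that by (induction w rule: list.induct) (simp_all add: Y(3))
    show "\<exists>v\<in>L. \<exists>z\<in>S. Y.val (v @ [z]) = g" if g: "g \<in> carrier G" for g
    proof -
      obtain w e where w: "w \<in> L" "e \<in> ?K" "word_val G \<psi>0 w \<otimes> e = g" using rep0[OF g] by blast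
      obtain z where z: "z \<in> S" "\<psi> z = e" using w(2) unfolding Y(6)[symmetric] by blast
      have "Y.val (w @ [z]) = g" using letter(1)[OF w(1) z(1)] vcong[OF lists(1)[OF w(1)]] w(3) z(2) by simp
      then show ?thesis using w(1) z(1) by blast
    qed
  next
    fix g assume g: "g \<in> carrier G"
    let ?R = "{(Y.traj v, Y.traj w) | v w z z'. v \<in> L \<and> w \<in> L \<and> z \<in> S \<and> z' \<in> S \<and>
         Y.val (w @ [z']) = Y.val (v @ [z]) \<otimes> g}"
    show "fellow_travelling ?c G ?R"
    proof (rule fellow_travelling_lift)
      have "?push ` ?R \<subseteq> right_pairs H \<phi> L (h g)"
      proof
        fix pq assume "pq \<in> ?push ` ?R"
        then obtain v w z z' where *: "v \<in> L" "w \<in> L" "z \<in> S" "z' \<in> S"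
          "pq = (X.traj v, X.traj w)" "Y.val (w @ [z']) = Y.val (v @ [z]) \<otimes> g"
          using traj by auto
        have "Y.val w \<otimes> \<psi> z' = Y.val v \<otimes> \<psi> z \<otimes> g" using *(6) letter(1)[OF *(1,3)] letter(1)[OF *(2,4)] by simp
        then have "h (Y.val w \<otimes> \<psi> z') = h (Y.val v \<otimes> \<psi> z \<otimes> g)" by simp
        then have "X.val w = X.val v \<otimes>\<^bsub>H\<^esub> h g"
          using letter[OF *(1,3)] letter[OF *(2,4)] g by (simp add: val *(1,2))
        then show "pq \<in> right_pairs H \<phi> L (h g)" using *(1,2,5) unfolding right_pairs_def by blast
      qed
      moreover have "fellow_travelling ?c H (right_pairs H \<phi> L (h g))"
        using c hom_closed[OF g] unfolding coarse_combing_def by blast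
      ultimately show "fellow_travelling ?c H (?push ` ?R)" by (rule fellow_travelling_subset[rotated])
    next
      fix m p n q i assume "((m, p), (n, q)) \<in> ?R"
      then show "p i \<in> carrier G \<and> q i \<in> carrier G" using lists(2) by (auto simp: trajectory_def)
    qed
  next
    fix g assume two: "two_sided \<tau>" and g: "g \<in> carrier G"
    let ?R = "{(translate G g (Y.traj v), Y.traj w) | v w z z'. v \<in> L \<and> w \<in> L \<and> z \<in> S \<and> z' \<in> S \<and>
         Y.val (w @ [z']) = g \<otimes> Y.val (v @ [z])}"
    show "fellow_travelling ?c G ?R"
    proof (rule fellow_travelling_lift)
      have "?push ` ?R \<subseteq> left_pairs H \<phi> L (h g)"
      proof
        fix pq assume "pq \<in> ?push ` ?R"
        then obtain v w z z' where *: "v \<in> L" "w \<in> L" "z \<in> S" "z' \<in> S"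
          "pq = (push (translate G g (Y.traj v)), X.traj w)" "Y.val (w @ [z']) = g \<otimes> Y.val (v @ [z])"
          using traj by auto
        have "push (translate G g (Y.traj v)) = translate H (h g) (X.traj v)"
          unfolding traj[OF *(1)] using g lists(2)[OF *(1)]
          by (intro push_translate) (simp_all add: trajectory_def)
        moreover have "Y.val w \<otimes> \<psi> z' = g \<otimes> (Y.val v \<otimes> \<psi> z)"
          using *(6) letter(1)[OF *(1,3)] letter(1)[OF *(2,4)] by simp
        then have "h (Y.val w \<otimes> \<psi> z') = h (g \<otimes> (Y.val v \<otimes> \<psi> z))" by simp
        then have "X.val w = h g \<otimes>\<^bsub>H\<^esub> X.val v"
          using letter[OF *(1,3)] letter[OF *(2,4)] g by (simp add: val *(1,2))
        ultimately show "pq \<in> left_pairs H \<phi> L (h g)" using *(1,2,5) unfolding left_pairs_def by auto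
      qed
      moreover have "fellow_travelling ?c H (left_pairs H \<phi> L (h g))"
        using c two hom_closed[OF g] unfolding coarse_combing_def by blast
      ultimately show "fellow_travelling ?c H (?push ` ?R)" by (rule fellow_travelling_subset[rotated])
    next
      fix m p n q i assume "((m, p), (n, q)) \<in> ?R"
      then show "p i \<in> carrier G \<and> q i \<in> carrier G" using lists(2) g by (auto simp: trajectory_def translate_def)
    qed
  qed
  moreover have "{u @ v | u v. u \<in> L \<and> v \<in> (\<lambda>z. [z]) ` S} \<subseteq> lists Y"
  proof
    fix y assume "y \<in> {u @ v | u v. u \<in> L \<and> v \<in> (\<lambda>z. [z]) ` S}"
    then obtain u z where "y = u @ [z]" "u \<in> L" "z \<in> S" by blast
    then show "y \<in> lists Y" using lists(2)[of u] subsetD[OF Y(5)] by simp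
  qed
  ultimately have "combing \<tau> G Y \<psi> {u @ v | u v. u \<in> L \<and> v \<in> (\<lambda>z. [z]) ` S}"
    unfolding Y.combing_iff_coarse by blast
  then show ?thesis using Y(1) finite_imageI[OF Y(4), of "\<lambda>z. [z]"] by blast
qed

end

section \<open>Overgroups of finite index\<close>

text \<open>The map \<open>r\<close> chooses a representative of each right coset \<open>H a\<close>. Representing \<open>H\<close> itself by the
  identity makes a word end in the initial state of the coset automaton exactly if its value lies
  in \<open>H\<close>.\<close>
lemma (in group) coset_representatives:
  assumes H: "subgroup H G" and fin: "finite (rcosets H)"
  shows "\<exists>r. finite (r ` carrier G) \<and>
    (\<forall>a\<in>carrier G. r a \<in> carrier G \<and> a \<otimes> inv (r a) \<in> H) \<and> (\<forall>a\<in>H. r a = \<one>) \<and>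
    (\<forall>a\<in>carrier G. \<forall>b\<in>carrier G. a \<otimes> inv b \<in> H \<longrightarrow> r a = r b)"
proof -
  \<comment> \<open>A choice that depends on the coset only, so that \<open>r\<close> is constant on cosets.\<close>
  define f where "f = (\<lambda>R. if R = H then \<one> else (SOME a. a \<in> carrier G \<and> R = H #> a))"
  have f: "f (H #> a) \<in> carrier G \<and> H #> a = H #> f (H #> a)" if a: "a \<in> carrier G" for a
  proof (cases "H #> a = H")
    case True
    then show ?thesis using coset_mult_one[of H] subgroup.subset[OF H] by (simp add: f_def)
  next
    case False
    have "\<exists>b. b \<in> carrier G \<and> H #> a = H #> b" using a by blast
    from someI_ex[OF this] show ?thesis using False by (simp add: f_def)
  qed
  show ?thesis
  proof (intro exI[of _ "\<lambda>a. f (H #> a)"] conjI ballI impI)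
    have "(\<lambda>a. f (H #> a)) ` carrier G \<subseteq> f ` (rcosets H)" unfolding RCOSETS_def by auto
    then show "finite ((\<lambda>a. f (H #> a)) ` carrier G)" using fin finite_surj by blast
  next
    fix a assume a: "a \<in> carrier G"
    show car: "f (H #> a) \<in> carrier G" using f[OF a] by blast
  next
    fix a assume a: "a \<in> carrier G"
    have car: "f (H #> a) \<in> carrier G" using f[OF a] by blast
    have "H #> (a \<otimes> inv (f (H #> a))) = H"
      using coset_mult_inv2[OF conjunct2[OF f[OF a]] a car subgroup.subset[OF H]] .
    then show "a \<otimes> inv (f (H #> a)) \<in> H" using coset_join1 a car H by blast
  next
    fix a assume "a \<in> H"
    then have "H #> a = H" using coset_join2 H subgroup.mem_carrier by metis
    then show "f (H #> a) = \<one>" by (simp add: f_def)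
  next
    fix a b assume ab: "a \<in> carrier G" "b \<in> carrier G" "a \<otimes> inv b \<in> H"
    then have "H #> (a \<otimes> inv b) = H" using coset_join2 H subgroup.mem_carrier by metis
    then have "H #> a = H #> b" using coset_mult_inv1 ab subgroup.subset[OF H] by blast
    then show "f (H #> a) = f (H #> b)" by simp
  qed
qed

lemma (in group) fellow_travelling_supergroup:
  assumes H: "subgroup H G" and R: "fellow_travelling c (G\<lparr>carrier := H\<rparr>) R"
  shows "fellow_travelling c G R"
proof (rule fellow_travelling_transfer[OF R, where \<Phi> = "\<lambda>B. B"])
  fix m p n q assume pq: "((m, p), n, q) \<in> R"
  have car: "p i \<in> H" "q i \<in> H" for i using fellow_travelling_range[OF R pq] by simp_all
  have "inv\<^bsub>G\<lparr>carrier := H\<rparr>\<^esub> p i = inv (p i)" for i using m_inv_consistent[OF H car(1)] .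
  then show "\<exists>p' q'. ((m, p'), n, q') \<in> R \<and> range p \<subseteq> carrier G \<and> range q \<subseteq> carrier G \<and>
     (\<forall>B i j. inv\<^bsub>G\<lparr>carrier := H\<rparr>\<^esub> p' i \<otimes>\<^bsub>G\<lparr>carrier := H\<rparr>\<^esub> q' j \<in> B \<longrightarrow> inv p i \<otimes> q j \<in> B)"
    using pq car subgroup.mem_carrier[OF H] by - (rule exI[of _ p], rule exI[of _ q], auto)
qed

text \<open>Append to the words for the subgroup \<open>C\<close> one letter for each element of a transversal. If \<open>w t'\<close>
  and \<open>v t g\<close> agree in \<open>J\<close>, then \<open>w\<close> and \<open>v (t g t'\<inverse>)\<close> agree, and \<open>t g t'\<inverse>\<close> is one of finitely many
  elements of \<open>C\<close>. For bicombings one would have to compare \<open>w\<close> with \<open>g v\<close> for \<open>g\<close> outside \<open>C\<close>,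
  where fellow travelling over \<open>C\<close> gives no information.\<close>
lemma combing_finite_index_overgroup:
  assumes J: "group J" and C: "subgroup C J" and fin: "finite (rcosets\<^bsub>J\<^esub> C)"
    and one_sided: "\<not> two_sided \<tau>"
    and gen: "generating_set (J\<lparr>carrier := C\<rparr>) X \<phi>" and comb: "combing \<tau> (J\<lparr>carrier := C\<rparr>) X \<phi> L"
  shows "\<exists>Y \<psi> S. generating_set J Y \<psi> \<and> finite S \<and> combing \<tau> J Y \<psi> {u @ v | u v. u \<in> L \<and> v \<in> S}"
proof -
  let ?G = "J\<lparr>carrier := C\<rparr>" and ?c = "timing_of \<tau>"
  interpret J: group J by fact
  interpret G: group ?G using J.subgroup_imp_group[OF C] .
  interpret X: marked_group ?G X \<phi> by unfold_locales fact
  have L: "L \<subseteq> lists X" and c: "coarse_combing \<tau> ?G \<phi> L"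
    using comb unfolding X.combing_iff_coarse by auto
  have sub: "C \<subseteq> carrier J" using subgroup.subset[OF C] .
  have same: "word_val ?G \<phi> w = word_val J \<phi> w" for w by (simp add: word_val_def)
  obtain r where fin_r: "finite (r ` carrier J)" and r0:
    "\<forall>a\<in>carrier J. r a \<in> carrier J \<and> a \<otimes>\<^bsub>J\<^esub> inv\<^bsub>J\<^esub> (r a) \<in> C"
    using J.coset_representatives[OF C fin] by blast
  have r: "r a \<in> carrier J" "a \<otimes>\<^bsub>J\<^esub> inv\<^bsub>J\<^esub> (r a) \<in> C" if "a \<in> carrier J" for a
    using r0 that by auto
  let ?T = "r ` carrier J"
  have T: "?T \<subseteq> carrier J" "?T \<noteq> {}" using r(1) J.one_closed by blast+
  have img: "\<phi> ` X \<subseteq> carrier J" using X.img_X sub by auto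
  have rep0: "\<exists>w\<in>L. \<exists>t\<in>?T. word_val J \<phi> w \<otimes>\<^bsub>J\<^esub> t = g" if g: "g \<in> carrier J" for g
  proof -
    have "\<forall>a\<in>C. \<exists>w\<in>L. word_val J \<phi> w = a" using c unfolding coarse_combing_def same by simp
    then obtain w where w: "w \<in> L" "word_val J \<phi> w = g \<otimes>\<^bsub>J\<^esub> inv\<^bsub>J\<^esub> (r g)"
      using r(2)[OF g] by blast
    then have "word_val J \<phi> w \<otimes>\<^bsub>J\<^esub> r g = g" using g r(1)[OF g] by (simp add: J.m_assoc)
    then show ?thesis using w(1) g by blast
  qed
  have rep1: "\<exists>w\<in>lists X. \<exists>t\<in>?T. word_val J \<phi> w \<otimes>\<^bsub>J\<^esub> t = g" if "g \<in> carrier J" for g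
    using rep0[OF that] L by blast
  obtain Y \<psi> S where Y: "generating_set J Y \<psi>" "X \<subseteq> Y" "\<forall>x\<in>X. \<psi> x = \<phi> x"
    "finite S" "S \<subseteq> Y" "\<psi> ` S = ?T"
    using extend_marking[OF J X.finite_X img fin_r T rep1] by metis
  interpret Y: marked_group J Y \<psi> by unfold_locales fact
  have lists: "v \<in> lists X" "v \<in> lists Y" if "v \<in> L" for v
    using that L lists_mono[OF Y(2)] by blast+
  have val_lists: "Y.val w = X.val w" if "w \<in> lists X" for w
    unfolding same using that by (induction w rule: list.induct) (simp_all add: Y(3))
  have val: "Y.val w = X.val w" and traj: "Y.traj w = X.traj w" if "w \<in> L" for w
    using val_lists lists(1)[OF that] by (simp_all add: trajectory_def X.take_lists)
  have letter: "Y.val (v @ [z]) = Y.val v \<otimes>\<^bsub>J\<^esub> \<psi> z" "\<psi> z \<in> carrier J" "Y.val v \<in> C" "Y.val v \<in> carrier J"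
    if "v \<in> L" "z \<in> S" for v z
  proof -
    show "\<psi> z \<in> carrier J" using Y.phi_closed subsetD[OF Y(5) that(2)] by blast
    then show "Y.val (v @ [z]) = Y.val v \<otimes>\<^bsub>J\<^esub> \<psi> z"
      using Y.val_append[OF lists(2)[OF that(1)], of "[z]"] subsetD[OF Y(5) that(2)] by simp
    show "Y.val v \<in> C" using X.val_closed[OF lists(1)[OF that(1)]] val[OF that(1)] by simp
    then show "Y.val v \<in> carrier J" using sub by blast
  qed
  have "coarse_combing \<tau> J \<psi> {u @ v | u v. u \<in> L \<and> v \<in> (\<lambda>z. [z]) ` S}"
  proof (rule Y.coarse_combing_append)
    show "L \<subseteq> lists Y" using lists by blast
    show "S \<subseteq> Y" by fact
    show "\<exists>v\<in>L. \<exists>z\<in>S. Y.val (v @ [z]) = g" if g: "g \<in> carrier J" for g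
    proof -
      obtain w t where w: "w \<in> L" "t \<in> ?T" "word_val J \<phi> w \<otimes>\<^bsub>J\<^esub> t = g" using rep0[OF g] by blast
      obtain z where z: "z \<in> S" "\<psi> z = t" using w(2) unfolding Y(6)[symmetric] by blast
      have "Y.val (w @ [z]) = g" using letter(1)[OF w(1) z(1)] val[OF w(1)] w(3) z(2) same by simp
      then show ?thesis using w(1) z(1) by blast
    qed
  next
    fix g assume g: "g \<in> carrier J"
    let ?R = "{(Y.traj v, Y.traj w) | v w z z'. v \<in> L \<and> w \<in> L \<and> z \<in> S \<and> z' \<in> S \<and>
         Y.val (w @ [z']) = Y.val (v @ [z]) \<otimes>\<^bsub>J\<^esub> g}"
    let ?g = "\<lambda>(z, z'). \<psi> z \<otimes>\<^bsub>J\<^esub> g \<otimes>\<^bsub>J\<^esub> inv\<^bsub>J\<^esub> \<psi> z'"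
    let ?D = "{zz \<in> S \<times> S. ?g zz \<in> C}"
    have "fellow_travelling ?c ?G (\<Union>zz\<in>?D. right_pairs ?G \<phi> L (?g zz))"
    proof (rule fellow_travelling_UN)
      show "finite ?D" using Y(4) by simp
      show "fellow_travelling ?c ?G (right_pairs ?G \<phi> L (?g zz))" if "zz \<in> ?D" for zz
        using c that unfolding coarse_combing_def by simp
    qed
    then have "fellow_travelling ?c J (\<Union>zz\<in>?D. right_pairs ?G \<phi> L (?g zz))"
      by (rule J.fellow_travelling_supergroup[OF C])
    moreover have "?R \<subseteq> (\<Union>zz\<in>?D. right_pairs ?G \<phi> L (?g zz))"
    proof
      fix pq assume "pq \<in> ?R"
      then obtain v w z z' where *: "v \<in> L" "w \<in> L" "z \<in> S" "z' \<in> S"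
        "pq = (X.traj v, X.traj w)" "Y.val (w @ [z']) = Y.val (v @ [z]) \<otimes>\<^bsub>J\<^esub> g"
        using traj by auto
      note v = letter[OF *(1,3)] and w = letter[OF *(2,4)]
      have "Y.val w = Y.val w \<otimes>\<^bsub>J\<^esub> \<psi> z' \<otimes>\<^bsub>J\<^esub> inv\<^bsub>J\<^esub> \<psi> z'" using v w by (simp add: J.m_assoc)
      also have "\<dots> = Y.val v \<otimes>\<^bsub>J\<^esub> \<psi> z \<otimes>\<^bsub>J\<^esub> g \<otimes>\<^bsub>J\<^esub> inv\<^bsub>J\<^esub> \<psi> z'" using *(6) v(1) w(1) by simp
      also have "\<dots> = Y.val v \<otimes>\<^bsub>J\<^esub> ?g (z, z')" using v w g by (simp add: J.m_assoc)
      finally have vw: "Y.val w = Y.val v \<otimes>\<^bsub>J\<^esub> ?g (z, z')" .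
      then have "inv\<^bsub>J\<^esub> (Y.val v) \<otimes>\<^bsub>J\<^esub> Y.val w = ?g (z, z')"
        using v w g by (simp add: J.inv_mult_cancel)
      moreover have "inv\<^bsub>J\<^esub> (Y.val v) \<otimes>\<^bsub>J\<^esub> Y.val w \<in> C"
        using v(3) w(3) C by (simp add: subgroup.m_closed subgroup.m_inv_closed)
      ultimately have "(z, z') \<in> ?D" using *(3,4) by simp
      moreover have "pq \<in> right_pairs ?G \<phi> L (?g (z, z'))"
        using *(1,2,5) vw unfolding right_pairs_def by (simp add: val) blast
      ultimately show "pq \<in> (\<Union>zz\<in>?D. right_pairs ?G \<phi> L (?g zz))" by blast
    qed
    ultimately show "fellow_travelling ?c J ?R" by (rule fellow_travelling_subset)
  qed (use one_sided in auto)
  moreover have "{u @ v | u v. u \<in> L \<and> v \<in> (\<lambda>z. [z]) ` S} \<subseteq> lists Y"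
  proof
    fix y assume "y \<in> {u @ v | u v. u \<in> L \<and> v \<in> (\<lambda>z. [z]) ` S}"
    then obtain u z where "y = u @ [z]" "u \<in> L" "z \<in> S" by blast
    then show "y \<in> lists Y" using lists(2)[of u] subsetD[OF Y(5)] by simp
  qed
  ultimately have "combing \<tau> J Y \<psi> {u @ v | u v. u \<in> L \<and> v \<in> (\<lambda>z. [z]) ` S}"
    unfolding Y.combing_iff_coarse by blast
  then show ?thesis using Y(1) finite_imageI[OF Y(4), of "\<lambda>z. [z]"] by blast
qed

section \<open>Deterministic sequential machines\<close>

primrec transduce :: "(nat \<Rightarrow> nat \<Rightarrow> nat list) \<Rightarrow> (nat \<Rightarrow> nat \<Rightarrow> nat) \<Rightarrow> nat \<Rightarrow> nat list \<Rightarrow> nat list" where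
  "transduce out nxt s [] = []"
| "transduce out nxt s (x # w) = out s x @ transduce out nxt (nxt s x) w"

lemma transduce_append:
  "transduce out nxt s (u @ v) = transduce out nxt s u @ transduce out nxt (foldl nxt s u) v"
  by (induction u arbitrary: s) auto

text \<open>The deterministic machine with transition function \<open>nxt\<close> and output function \<open>out\<close>.\<close>
definition transducer ::
    "nat set \<Rightarrow> nat set \<Rightarrow> nat set \<Rightarrow> (nat \<Rightarrow> nat \<Rightarrow> nat list) \<Rightarrow> (nat \<Rightarrow> nat \<Rightarrow> nat) \<Rightarrow> nat \<Rightarrow> gsm" where
  "transducer Q A X out nxt s = \<lparr>gsm_states = Q, gsm_start = s, gsm_accepting = A,
     gsm_trans = (\<lambda>(q, x). (q, x, out q x, nxt q x)) ` (Q \<times> X)\<rparr>"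

lemma transducer_run:
  assumes "w \<in> lists X" "q \<in> Q" "\<And>q x. q \<in> Q \<Longrightarrow> x \<in> X \<Longrightarrow> nxt q x \<in> Q"
  shows "gsm_run (transducer Q A X out nxt s) q w v q' \<longleftrightarrow>
     v = transduce out nxt q w \<and> q' = foldl nxt q w"
  using assms(1,2)
proof (induction w arbitrary: q v rule: list.induct)
  case Nil
  then show ?case by (auto intro: gsm_run_Nil elim: gsm_run.cases)
next
  case (Cons x w)
  let ?M = "transducer Q A X out nxt s"
  have IH: "gsm_run ?M (nxt q x) w v q' \<longleftrightarrow>
      v = transduce out nxt (nxt q x) w \<and> q' = foldl nxt (nxt q x) w" for v
    using Cons assms(3) by simp
  have tr: "(q, x, z, p) \<in> gsm_trans ?M \<longleftrightarrow> z = out q x \<and> p = nxt q x" for z p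
    using Cons.prems by (auto simp: transducer_def)
  have "gsm_run ?M q (x # w) v q' \<longleftrightarrow> (\<exists>z p v'. (q, x, z, p) \<in> gsm_trans ?M \<and> v = z @ v' \<and>
      gsm_run ?M p w v' q')"
  proof
    assume "gsm_run ?M q (x # w) v q'"
    then show "\<exists>z p v'. (q, x, z, p) \<in> gsm_trans ?M \<and> v = z @ v' \<and> gsm_run ?M p w v' q'"
      by cases metis
  qed (metis gsm_run_Cons)
  then show ?case using IH tr by auto
qed

lemma closed_under_transducer:
  assumes "closed_eps_free_gsm F" "L \<in> F" "L \<subseteq> lists X" "finite X" "finite Q" "s \<in> Q" "A \<subseteq> Q"
    and nxt: "\<And>q x. q \<in> Q \<Longrightarrow> x \<in> X \<Longrightarrow> nxt q x \<in> Q"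
    and out: "\<And>q x. q \<in> Q \<Longrightarrow> x \<in> X \<Longrightarrow> out q x \<noteq> []"
  shows "transduce out nxt s ` {w \<in> L. foldl nxt s w \<in> A} \<in> F"
proof -
  let ?M = "transducer Q A X out nxt s"
  have "is_gsm ?M" using assms unfolding is_gsm_def transducer_def by auto
  moreover have "eps_free_gsm ?M" using out unfolding eps_free_gsm_def transducer_def by auto
  ultimately have "gsm_mapping ?M L \<in> F" using assms(1,2) unfolding closed_eps_free_gsm_def by blast
  moreover have "gsm_run ?M s w v q \<longleftrightarrow> v = transduce out nxt s w \<and> q = foldl nxt s w"
    if "w \<in> L" for w v q
    by (rule transducer_run[OF subsetD[OF assms(3) that] assms(6) nxt])
  then have "gsm_mapping ?M L = transduce out nxt s ` {w \<in> L. foldl nxt s w \<in> A}"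
    unfolding gsm_mapping_def by (auto simp: transducer_def)
  ultimately show ?thesis by simp
qed

section \<open>Change of generators\<close>

lemma foldl_closed:
  assumes "\<And>q x. q \<in> Q \<Longrightarrow> x \<in> X \<Longrightarrow> nxt q x \<in> Q" "q \<in> Q" "w \<in> lists X"
  shows "foldl nxt q w \<in> Q"
  using assms(3,2) by (induction w arbitrary: q rule: list.induct) (simp_all add: assms(1))

context marked_group
begin

text \<open>Padding a word with \<open>x x\<inverse>\<close> changes its length by \<open>2\<close>, so one of any two consecutive lengths that
  are large enough can be attained. Parity may make a prescribed length unattainable.\<close>
lemma word_of_length:
  assumes "g \<in> carrier G"
  shows "\<exists>N. \<forall>l\<ge>N. \<exists>w\<in>lists X. val w = g \<and> (length w = l \<or> length w = Suc l)"
proof -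
  obtain u where u: "u \<in> lists X" "val u = g" using word_exists[OF assms] by metis
  obtain x where x: "x \<in> X" using X_nonempty by blast
  obtain y where y: "y \<in> X" "\<phi> y = inv (\<phi> x)" using inverse_symbol[OF x] by metis
  have pad: "\<exists>w\<in>lists X. val w = g \<and> length w = length u + 2 * k" for k
  proof (induction k)
    case 0
    then show ?case using u by auto
  next
    case (Suc k)
    then obtain w where w: "w \<in> lists X" "val w = g" "length w = length u + 2 * k" by metis
    have "val (x # y # w) = \<phi> x \<otimes> (inv (\<phi> x) \<otimes> val w)" using y(2) by simp
    also have "\<dots> = g" using inv_mult_cancel(1)[OF phi_closed[OF x] val_closed[OF w(1)]] w(2) by simp
    finally show ?case using w x y(1) by (intro bexI[of _ "x # y # w"]) simp_all
  qed
  have "\<exists>w\<in>lists X. val w = g \<and> (length w = l \<or> length w = Suc l)" if l: "l \<ge> length u" for l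
  proof -
    define k where "k = (Suc l - length u) div 2"
    have "length u + 2 * k = l \<or> length u + 2 * k = Suc l" using l unfolding k_def by presburger
    then show ?thesis using pad[of k] by metis
  qed
  then show ?thesis by blast
qed

text \<open>The state records by how much the output runs ahead of \<open>n\<close> letters per input letter. Because the
  surplus is passed on to the next letter, it never exceeds one letter, however long the word. So
  the rewritten word is the old one slowed down by the factor \<open>n\<close>, which preserves fellow
  travelling even in the synchronous case.\<close>
lemma dilation_rewriting:
  assumes Y: "marked_group G Y \<psi>" and n: "1 \<le> n"
    and out: "\<And>q x. q \<in> {0, 1} \<Longrightarrow> x \<in> X \<Longrightarrow> out q x \<in> lists Y \<and> word_val G \<psi> (out q x) = \<phi> x \<and>
        nxt q x \<in> {0, 1} \<and> length (out q x) + q = n + nxt q x"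
    and w: "w \<in> lists X"
  defines "w' \<equiv> transduce out nxt 0 w"
  shows "w' \<in> lists Y" "word_val G \<psi> w' = val w"
    and "dilation c G n (word_ball G Y \<psi> (n + 3)) (traj w) (trajectory G \<psi> w')"
proof -
  interpret Y: marked_group G Y \<psi> by fact
  have nxt: "nxt q x \<in> {0, 1}" if "q \<in> {0, 1}" "x \<in> X" for q x using out[OF that] by blast
  have main: "transduce out nxt q u \<in> lists Y \<and> Y.val (transduce out nxt q u) = val u \<and>
      length (transduce out nxt q u) + q = n * length u + foldl nxt q u"
    if "u \<in> lists X" "q \<in> {0, 1}" for u q
    using that
  proof (induction u arbitrary: q rule: list.induct)
    case (Cons x u)
    then have x: "x \<in> X" and u: "u \<in> lists X" by simp_all
    note o = out[OF Cons.prems(2) x]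
    have "nxt q x \<in> {0, 1}" using o by blast
    note IH = Cons.IH[OF u this]
    have "Y.val (transduce out nxt q (x # u)) = val (x # u)"
      using Y.val_append o IH by simp
    moreover have "length (transduce out nxt q (x # u)) + q = n * length (x # u) + foldl nxt q (x # u)"
      using o IH by simp
    moreover have "transduce out nxt q (x # u) \<in> lists Y" using o IH by (simp only: transduce.simps append_in_lists_conv)
    ultimately show ?case by blast
  qed simp
  show w': "w' \<in> lists Y" "Y.val w' = val w" using main[OF w, of 0] unfolding w'_def by simp_all
  \<comment> \<open>The position in the output at which the first \<open>i\<close> letters of \<open>w\<close> have been processed.\<close>
  define pos where "pos = (\<lambda>i. length (transduce out nxt 0 (take i w)))"
  have pos: "val (take i w) = Y.val (take (pos i) w')" "pos i \<le> length w'"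
    "pos i = n * min i (length w) \<or> pos i = Suc (n * min i (length w))" for i
  proof -
    have "w' = transduce out nxt 0 (take i w @ drop i w)" unfolding w'_def by simp
    then have eq: "w' = transduce out nxt 0 (take i w) @
        transduce out nxt (foldl nxt 0 (take i w)) (drop i w)"
      unfolding transduce_append .
    have m: "Y.val (transduce out nxt 0 (take i w)) = val (take i w)"
      "pos i = n * length (take i w) + foldl nxt 0 (take i w)"
      using main[OF take_lists[OF w], of 0 i] unfolding pos_def by simp_all
    have tk: "take (pos i) w' = transduce out nxt 0 (take i w)"
      unfolding eq pos_def by simp
    show "val (take i w) = Y.val (take (pos i) w')" unfolding tk m(1) ..
    show "pos i \<le> length w'" unfolding pos_def by (subst eq) simp
    have "foldl nxt 0 (take i w) \<in> {0, 1}" by (rule foldl_closed[OF nxt _ take_lists[OF w]]) simp_all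
    then show "pos i = n * min i (length w) \<or> pos i = Suc (n * min i (length w))"
      using m(2) by (auto simp: min.commute)
  qed
  have len: "length w' = n * length w \<or> length w' = Suc (n * length w)"
    using pos(3)[of "length w"] unfolding pos_def w'_def by simp
  have zero: "length w = 0 \<longleftrightarrow> length w' = 0" using len n unfolding w'_def by auto
  have "\<bar>int (min j (length w')) - int (pos i)\<bar> \<le> int (n + 3)"
    if ij: "\<bar>int j - int (n * i)\<bar> \<le> int n + 2 \<or> length w \<le> i \<and> length w' \<le> j" for i j
  proof (cases "i \<le> length w")
    case True
    then have p: "pos i = n * i \<or> pos i = Suc (n * i)" using pos(3)[of i] by (simp add: min_absorb1)
    show ?thesis
    proof (cases "length w' \<le> j")
      case True
      have "i = length w \<or> \<bar>int j - int (n * i)\<bar> \<le> int n + 2" using ij \<open>i \<le> length w\<close> by linarith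
      then show ?thesis
      proof
        assume "i = length w"
        then show ?thesis using p len True by auto
      next
        assume "\<bar>int j - int (n * i)\<bar> \<le> int n + 2"
        then show ?thesis using p pos(2)[of i] True by (auto simp: min_def)
      qed
    next
      case False
      then have "\<bar>int j - int (n * i)\<bar> \<le> int n + 2" using ij by linarith
      then show ?thesis using p False by (auto simp: min_def)
    qed
  next
    case False
    then have p: "pos i = n * length w \<or> pos i = Suc (n * length w)" using pos(3)[of i] by (simp add: min_absorb2)
    have "n * Suc (length w) \<le> n * i" using False by (intro mult_le_mono2) simp
    then have "n * length w + n \<le> n * i" by simp
    then show ?thesis using ij p len by (cases "length w' \<le> j") (auto simp: min_def simp del: of_nat_mult)
  qed
  then have seg: "inv (val (take i w)) \<otimes> Y.val (take j w') \<in> Y.ball (n + 3)"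
    if "\<bar>int j - int (n * i)\<bar> \<le> int n + 2 \<or> length w \<le> i \<and> length w' \<le> j" for i j
    using Y.segment_in_ball[OF w'(1), of "min j (length w')" "pos i" "n + 3"] that
    by (simp add: pos(1) Y.take_min_length)
  have bound: "\<bar>int (length w') - int (n * length w)\<bar> \<le> 1" using len by auto
  have car: "range (\<lambda>i. val (take i w)) \<subseteq> carrier G" "range (\<lambda>i. Y.val (take i w')) \<subseteq> carrier G"
    using w w'(1) by auto
  show "dilation c G n (Y.ball (n + 3)) (traj w) (Y.traj w')"
    unfolding dilation_def trajectory_def prod.case
    by (intro conjI car allI impI disjI2 zero bound) (erule seg)
qed

text \<open>Rewrite each generator as a word over the new alphabet of length \<open>n\<close>, up to one letter that is
  carried over.\<close>
lemma combing_change_generators: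
  assumes Y: "generating_set G Y \<psi>" and comb: "combing \<tau> G X \<phi> L"
    and F: "closed_eps_free_gsm F" "L \<in> F"
  shows "\<exists>L'. combing \<tau> G Y \<psi> L' \<and> L' \<in> F"
proof -
  interpret Y: marked_group G Y \<psi> by unfold_locales fact
  let ?c = "timing_of \<tau>"
  have L: "L \<subseteq> lists X" and c: "coarse_combing \<tau> G \<phi> L"
    using comb unfolding combing_iff_coarse by auto
  have "\<exists>N. \<forall>l\<ge>N. \<exists>w\<in>lists Y. Y.val w = \<phi> x \<and> (length w = l \<or> length w = Suc l)" if "x \<in> X" for x
    using Y.word_of_length[OF phi_closed[OF that]] .
  then obtain N where N: "\<And>x l. x \<in> X \<Longrightarrow> N x \<le> l \<Longrightarrow>
      \<exists>w\<in>lists Y. Y.val w = \<phi> x \<and> (length w = l \<or> length w = Suc l)"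
    by metis
  \<comment> \<open>The summand \<open>2\<close> keeps every output non-empty, even after a surplus of one letter.\<close>
  define n where "n = (\<Sum>x\<in>X. N x) + 2"
  have n: "N x \<le> n - 1" "2 \<le> n" if "x \<in> X" for x
    using member_le_sum[OF that, of N] finite_X unfolding n_def by auto
  have "\<exists>u e. u \<in> lists Y \<and> Y.val u = \<phi> x \<and> e \<in> {0, 1} \<and> length u + q = n + e"
    if q: "q \<in> {0, 1}" and x: "x \<in> X" for q x
  proof -
    have "N x \<le> n - q" using n[OF x] q by auto
    then obtain u where u: "u \<in> lists Y" "Y.val u = \<phi> x" "length u = n - q \<or> length u = Suc (n - q)"
      using N[OF x] by metis
    have "length u + q = n + 0 \<or> length u + q = n + 1" using u(3) q n(2)[OF x] by auto
    then show ?thesis using u(1,2) by blast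
  qed
  then obtain out nxt where out: "\<And>q x. q \<in> {0, 1} \<Longrightarrow> x \<in> X \<Longrightarrow> out q x \<in> lists Y \<and>
      Y.val (out q x) = \<phi> x \<and> nxt q x \<in> {0, 1} \<and> length (out q x) + q = n + nxt q x"
    by metis
  let ?f = "transduce out nxt 0" and ?E = "Y.ball (n + 3)"
  have n1: "1 \<le> n" unfolding n_def by simp
  have lists: "v \<in> lists X" if "v \<in> L" for v using that L by blast
  have f: "?f w \<in> lists Y" "Y.val (?f w) = val w" "dilation ?c G n ?E (traj w) (Y.traj (?f w))"
    if "w \<in> L" for w
    by (rule dilation_rewriting[OF Y.marked_group_axioms n1 out lists[OF that]]; assumption)+
  have right: "fellow_travelling ?c G (right_pairs G \<psi> (?f ` L) g)" if g: "g \<in> carrier G" for g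
  proof (rule fellow_travelling_dilation[OF _ n1 Y.finite_ball])
    show "fellow_travelling ?c G (right_pairs G \<phi> L g)" using c g unfolding coarse_combing_def by blast
    fix P' Q' assume "(P', Q') \<in> right_pairs G \<psi> (?f ` L) g"
    then obtain v w where *: "v \<in> L" "w \<in> L" "P' = Y.traj (?f v)" "Q' = Y.traj (?f w)"
      "Y.val (?f w) = Y.val (?f v) \<otimes> g"
      unfolding right_pairs_def by blast
    then have "(traj v, traj w) \<in> right_pairs G \<phi> L g"
      unfolding right_pairs_def using f(2) by auto
    then show "\<exists>P Q. (P, Q) \<in> right_pairs G \<phi> L g \<and> dilation ?c G n ?E P P' \<and> dilation ?c G n ?E Q Q'"
      using f(3)[OF *(1)] f(3)[OF *(2)] *(3,4) by blast
  qed
  have left: "fellow_travelling ?c G (left_pairs G \<psi> (?f ` L) g)"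
    if two: "two_sided \<tau>" and g: "g \<in> carrier G" for g
  proof (rule fellow_travelling_dilation[OF _ n1 Y.finite_ball])
    show "fellow_travelling ?c G (left_pairs G \<phi> L g)" using c g two unfolding coarse_combing_def by blast
    fix P' Q' assume "(P', Q') \<in> left_pairs G \<psi> (?f ` L) g"
    then obtain v w where *: "v \<in> L" "w \<in> L" "P' = translate G g (Y.traj (?f v))" "Q' = Y.traj (?f w)"
      "Y.val (?f w) = g \<otimes> Y.val (?f v)"
      unfolding left_pairs_def by blast
    then have "(translate G g (traj v), traj w) \<in> left_pairs G \<phi> L g"
      unfolding left_pairs_def using f(2) by auto
    then show "\<exists>P Q. (P, Q) \<in> left_pairs G \<phi> L g \<and> dilation ?c G n ?E P P' \<and> dilation ?c G n ?E Q Q'"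
      using dilation_translate[OF g f(3)[OF *(1)]] f(3)[OF *(2)] *(3,4) by blast
  qed
  have nonempty: "out q x \<noteq> []" if "q \<in> {0, 1}" "x \<in> X" for q x
    using out[OF that] n(2)[OF that(2)] that(1) by auto
  have rep: "\<exists>w\<in>?f ` L. Y.val w = g" if "g \<in> carrier G" for g
  proof -
    have "\<exists>w\<in>L. val w = g" using c that unfolding coarse_combing_def by blast
    then obtain w where w: "w \<in> L" "val w = g" by blast
    show ?thesis by (intro bexI[of _ "?f w"] imageI) (simp_all add: w f(2)[OF w(1)])
  qed
  have "[] \<notin> ?f ` L" if ne: "[] \<notin> L"
  proof
    assume "[] \<in> ?f ` L"
    then obtain w where w: "w \<in> L" "?f w = []" by auto
    then obtain x u where "w = x # u" using ne by (cases w) auto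
    then show False using w nonempty[of 0 x] lists[OF w(1)] by simp
  qed
  then have "coarse_combing \<tau> G \<psi> (?f ` L)"
    using c rep right left unfolding coarse_combing_def by blast
  moreover have "?f ` L \<subseteq> lists Y" using f(1) by blast
  moreover have "?f ` L \<in> F"
  proof -
    have nxt: "nxt q x \<in> {0, 1}" if "q \<in> {0, 1}" "x \<in> X" for q x using out[OF that] by blast
    have "foldl nxt 0 w \<in> {0, 1}" if "w \<in> L" for w
      by (rule foldl_closed[OF nxt _ lists[OF that]]) simp_all
    then have "{w \<in> L. foldl nxt 0 w \<in> {0, 1}} = L" by blast
    then show ?thesis
      using closed_under_transducer[OF F L finite_X, of "{0, 1}" 0 "{0, 1}" nxt out, OF _ _ _ nxt nonempty]
      by simp
  qed
  ultimately show ?thesis unfolding Y.combing_iff_coarse by blast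
qed

end

section \<open>Subgroups of finite index\<close>

context marked_group
begin

text \<open>Reidemeister--Schreier rewriting. The machine remembers the representative \<open>t\<close> of the coset reached
  so far, and replaces \<open>x\<close> by one symbol for the Schreier generator \<open>t x s\<inverse>\<close>, where \<open>s\<close> represents
  the next coset. After \<open>i\<close> letters the rewritten word is at \<open>w(i) s\<inverse>\<close>, where \<open>s\<close> is the representative
  of the coset of \<open>w(i)\<close>. So lengths and time changes stay the same, and differences change only
  by elements of the finite transversal. A Schreier generator may be trivial; it keeps its own
  symbol, so no letter is ever erased and the alignment is not disturbed.\<close>
lemma combing_finite_index_subgroup:
  assumes H: "subgroup H G" and fin: "finite (rcosets H)"
    and comb: "combing \<tau> G X \<phi> L" and F: "closed_eps_free_gsm F" "L \<in> F"
  shows "\<exists>Y \<psi> L'. generating_set (G\<lparr>carrier := H\<rparr>) Y \<psi> \<and> combing \<tau> (G\<lparr>carrier := H\<rparr>) Y \<psi> L' \<and>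
    L' \<in> F \<and> (bijective_language G X \<phi> L \<longrightarrow> bijective_language (G\<lparr>carrier := H\<rparr>) Y \<psi> L')"
proof -
  let ?H = "G\<lparr>carrier := H\<rparr>" and ?c = "timing_of \<tau>"
  interpret H: group ?H using subgroup_imp_group[OF H] .
  have L: "L \<subseteq> lists X" and c: "coarse_combing \<tau> G \<phi> L"
    using comb unfolding combing_iff_coarse by auto
  have lists: "v \<in> lists X" if "v \<in> L" for v using that L by blast
  have HG: "a \<in> carrier G" if "a \<in> H" for a using subgroup.mem_carrier[OF H that] .
  have H_inv: "inv\<^bsub>?H\<^esub> a = inv a" if "a \<in> H" for a using m_inv_consistent[OF H that] .
  obtain r where fin_r: "finite (r ` carrier G)" and r0:
    "\<forall>a\<in>carrier G. r a \<in> carrier G \<and> a \<otimes> inv (r a) \<in> H" "\<forall>a\<in>H. r a = \<one>"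
    "\<forall>a\<in>carrier G. \<forall>b\<in>carrier G. a \<otimes> inv b \<in> H \<longrightarrow> r a = r b"
    using coset_representatives[OF H fin] by blast
  have r: "finite (r ` carrier G)" "\<And>a. a \<in> carrier G \<Longrightarrow> r a \<in> carrier G"
    "\<And>a. a \<in> carrier G \<Longrightarrow> a \<otimes> inv (r a) \<in> H" "\<And>a. a \<in> H \<Longrightarrow> r a = \<one>"
    "\<And>a b. a \<in> carrier G \<Longrightarrow> b \<in> carrier G \<Longrightarrow> a \<otimes> inv b \<in> H \<Longrightarrow> r a = r b"
    using fin_r r0 by auto
  let ?T = "r ` carrier G"
  have T: "t \<in> carrier G" "r t = t" if t: "t \<in> ?T" for t
  proof -
    obtain a where a: "a \<in> carrier G" "t = r a" using t by blast
    show "t \<in> carrier G" using r(2)[OF a(1)] a(2) by simp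
    show "r t = t" using r(5)[OF a(1) r(2)[OF a(1)] r(3)[OF a(1)]] a(2) by simp
  qed
  have one_T: "\<one> \<in> ?T" using r(4)[OF subgroup.one_closed[OF H]] one_closed by force
  \<comment> \<open>The next state depends only on the current one, not on the element that led to it.\<close>
  have r_step: "r (r a \<otimes> b) = r (a \<otimes> b)" if ab: "a \<in> carrier G" "b \<in> carrier G" for a b
  proof -
    have "(a \<otimes> b) \<otimes> inv (r a \<otimes> b) = a \<otimes> inv (r a)"
      using ab r(2)[OF ab(1)] by (simp add: inv_mult_group m_assoc inv_mult_cancel)
    then show ?thesis using r(5)[of "a \<otimes> b" "r a \<otimes> b"] r(2,3)[OF ab(1)] ab by simp
  qed
  obtain e :: "'a \<Rightarrow> nat" where e: "inj_on e ?T" using finite_imp_inj_to_nat_seg[OF r(1)] by metis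
  define d where "d = the_inv_into ?T e"
  have d: "d (e t) = t" if "t \<in> ?T" for t using the_inv_into_f_f[OF e that] by (simp add: d_def)
  define nxt where "nxt = (\<lambda>q x. e (r (d q \<otimes> \<phi> x)))"
  define out where "out = (\<lambda>(q::nat) (x::nat). [prod_encode (q, x)])"
  define \<psi> where "\<psi> = (\<lambda>y. case prod_decode y of (q, x) \<Rightarrow> d q \<otimes> \<phi> x \<otimes> inv (r (d q \<otimes> \<phi> x)))"
  define Y where "Y = prod_encode ` (e ` ?T \<times> X)"
  let ?f = "transduce out nxt (e \<one>)"
  define L' where "L' = ?f ` {w \<in> L. foldl nxt (e \<one>) w \<in> {e \<one>}}"
  have \<psi>: "\<psi> (prod_encode (e t, x)) = t \<otimes> \<phi> x \<otimes> inv (r (t \<otimes> \<phi> x))" if "t \<in> ?T" for t x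
    using d[OF that] by (simp add: \<psi>_def)
  have nxt: "nxt q x \<in> e ` ?T" if q: "q \<in> e ` ?T" "x \<in> X" for q x
  proof -
    obtain t where t: "t \<in> ?T" "q = e t" using q(1) by blast
    have "t \<otimes> \<phi> x \<in> carrier G" using T(1)[OF t(1)] q(2) by simp
    then show ?thesis unfolding nxt_def t(2) d[OF t(1)] by (intro imageI)
  qed
  have wv: "word_val ?H \<psi> = word_val G \<psi>" by (simp add: word_val_def[abs_def])
  have \<psi>_Y: "\<psi> ` Y \<subseteq> H"
  proof
    fix g assume "g \<in> \<psi> ` Y"
    then obtain t x where g: "g = \<psi> (prod_encode (e t, x))" "t \<in> ?T" "x \<in> X" unfolding Y_def by blast
    then show "g \<in> H" unfolding g(1) \<psi>[OF g(2)] using T(1)[OF g(2)] by (intro r(3)) simp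
  qed
  have main: "transduce out nxt (e t) w \<in> lists Y \<and> length (transduce out nxt (e t) w) = length w \<and>
      word_val ?H \<psi> (transduce out nxt (e t) w) = t \<otimes> val w \<otimes> inv (r (t \<otimes> val w)) \<and>
      foldl nxt (e t) w = e (r (t \<otimes> val w))"
    if "w \<in> lists X" "t \<in> ?T" for w t
    using that
  proof (induction w arbitrary: t rule: list.induct)
    case Nil
    then show ?case using T[OF Nil(2)] by simp
  next
    case (Cons x w)
    then have x: "x \<in> X" and w: "w \<in> lists X" and t: "t \<in> ?T" by simp_all
    let ?s = "r (t \<otimes> \<phi> x)"
    have car: "t \<in> carrier G" "\<phi> x \<in> carrier G" "val w \<in> carrier G" "t \<otimes> \<phi> x \<in> carrier G"
      using T(1)[OF t] x w by simp_all
    have s: "?s \<in> ?T" "?s \<in> carrier G" using r(2) car by auto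
    have step: "nxt (e t) x = e ?s" "out (e t) x = [prod_encode (e t, x)]" "prod_encode (e t, x) \<in> Y"
      using d[OF t] t x by (auto simp: nxt_def out_def Y_def)
    note IH = Cons.IH[OF w s(1)]
    have rs: "r (?s \<otimes> val w) = r (t \<otimes> val (x # w))"
      using r_step[OF car(4,3)] car by (simp add: m_assoc)
    have "r (t \<otimes> val (x # w)) \<in> carrier G" using r(2) car by simp
    then have "word_val ?H \<psi> (transduce out nxt (e t) (x # w)) =
        t \<otimes> val (x # w) \<otimes> inv (r (t \<otimes> val (x # w)))"
      using step IH rs \<psi>[OF t, of x] car s by (simp add: m_assoc inv_mult_cancel)
    moreover have "foldl nxt (e t) (x # w) = e (r (t \<otimes> val (x # w)))"
      using step(1) IH rs by simp
    moreover have "transduce out nxt (e t) (x # w) \<in> lists Y"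
      "length (transduce out nxt (e t) (x # w)) = length (x # w)"
      using step IH by simp_all
    ultimately show ?case by blast
  qed
  have take_f: "take i (?f w) = ?f (take i w)" for i w
  proof -
    have "take i (transduce out nxt q w) = transduce out nxt q (take i w)" for q
      by (induction w arbitrary: q i) (auto simp: out_def take_Cons')
    then show ?thesis .
  qed
  have f: "?f w \<in> lists Y" "length (?f w) = length w"
    "word_val ?H \<psi> (take i (?f w)) = val (take i w) \<otimes> inv (r (val (take i w)))"
    "foldl nxt (e \<one>) w = e (r (val w))" if "w \<in> lists X" for w i
    using main[OF that one_T] main[OF take_lists[OF that, of i] one_T] that unfolding take_f by simp_all
  have acc: "foldl nxt (e \<one>) w \<in> {e \<one>} \<longleftrightarrow> val w \<in> H" if w: "w \<in> lists X" for w
  proof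
    assume "foldl nxt (e \<one>) w \<in> {e \<one>}"
    then have "e (r (val w)) = e \<one>" using f(4)[OF w] by simp
    then have "r (val w) = \<one>" by (rule inj_onD[OF e _ imageI[OF val_closed[OF w]] one_T])
    then show "val w \<in> H" using r(3)[of "val w"] w by simp
  next
    assume "val w \<in> H"
    then show "foldl nxt (e \<one>) w \<in> {e \<one>}" using f(4)[OF w] r(4) by simp
  qed
  have L'_eq: "L' = ?f ` {w \<in> L. val w \<in> H}"
    unfolding L'_def using acc lists by (intro arg_cong[of _ _ "(`) ?f"] Collect_cong) auto
  have fval: "word_val ?H \<psi> (?f w) = val w" if "w \<in> L" "val w \<in> H" for w
    using f(3)[OF lists[OF that(1)], of "length w"] f(2)[OF lists[OF that(1)]] r(4)[OF that(2)]
      lists[OF that(1)] by simp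
  have rep: "\<exists>w\<in>L'. word_val ?H \<psi> w = h" if "h \<in> H" for h
  proof -
    have "\<exists>w\<in>L. val w = h" using c HG[OF that] unfolding coarse_combing_def by blast
    then obtain w where w: "w \<in> L" "val w = h" by blast
    then have "?f w \<in> L'" using \<open>h \<in> H\<close> unfolding L'_eq by blast
    then show ?thesis using fval[OF w(1)] w(2) \<open>h \<in> H\<close> by blast
  qed
  have L'_lists: "L' \<subseteq> lists Y" unfolding L'_eq using f(1) lists by blast
  have gen: "generating_set ?H Y \<psi>"
  proof (rule generating_setI)
    show "group ?H" by (rule H.group_axioms)
    show "finite Y" "Y \<noteq> {}" using finite_X X_nonempty r(1) one_T unfolding Y_def by auto
    show "\<psi> ` Y \<subseteq> carrier ?H" using \<psi>_Y by simp
    show "\<exists>w\<in>lists Y. word_val ?H \<psi> w = h" if "h \<in> carrier ?H" for h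
      using rep[of h] that L'_lists by auto
    fix y assume "y \<in> Y"
    then obtain t x where t: "t \<in> ?T" and x: "x \<in> X" and y: "y = prod_encode (e t, x)"
      unfolding Y_def by blast
    obtain x' where x': "x' \<in> X" "\<phi> x' = inv (\<phi> x)" using inverse_symbol[OF x] by blast
    let ?s = "r (t \<otimes> \<phi> x)"
    have car: "t \<in> carrier G" "\<phi> x \<in> carrier G" "?s \<in> carrier G" "?s \<in> ?T"
      using T(1)[OF t] x r(2) by auto
    have "r (?s \<otimes> inv (\<phi> x)) = r ((t \<otimes> \<phi> x) \<otimes> inv (\<phi> x))" using car by (intro r_step) auto
    also have "\<dots> = t" using car T(2)[OF t] by (simp add: m_assoc)
    finally have "\<psi> (prod_encode (e ?s, x')) = ?s \<otimes> inv (\<phi> x) \<otimes> inv t"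
      using \<psi>[OF car(4), of x'] x'(2) by simp
    also have "\<dots> = inv (\<psi> y)" unfolding y \<psi>[OF t] using car by (simp add: inv_mult_group m_assoc)
    also have "\<dots> = inv\<^bsub>?H\<^esub> (\<psi> y)" using H_inv \<psi>_Y \<open>y \<in> Y\<close> by auto
    finally show "\<exists>y'\<in>Y. \<psi> y' = inv\<^bsub>?H\<^esub> (\<psi> y)"
      using car(4) x'(1) unfolding Y_def by blast
  qed
  interpret Y: marked_group ?H Y \<psi> by unfold_locales fact
  let ?\<Phi> = "\<lambda>B. (\<lambda>(s, b, t). s \<otimes> b \<otimes> inv t) ` (?T \<times> B \<times> ?T)"
  have \<Phi>_finite: "finite (?\<Phi> B)" if "finite B" for B using that r(1) by simp
  have close: "inv\<^bsub>?H\<^esub> (a \<otimes> inv (r a)) \<otimes> (b \<otimes> inv (r b)) \<in> ?\<Phi> B"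
    if ab: "inv a \<otimes> b \<in> B" "a \<in> carrier G" "b \<in> carrier G" for a b B
  proof (rule image_eqI[of _ _ "(r a, inv a \<otimes> b, r b)"])
    show "(r a, inv a \<otimes> b, r b) \<in> ?T \<times> B \<times> ?T" using ab by blast
    show "inv\<^bsub>?H\<^esub> (a \<otimes> inv (r a)) \<otimes> (b \<otimes> inv (r b)) = (case (r a, inv a \<otimes> b, r b) of (s, b, t) \<Rightarrow> s \<otimes> b \<otimes> inv t)"
      using H_inv[OF r(3)[OF ab(2)]] ab(2,3) r(2) by (simp add: inv_mult_group m_assoc)
  qed
  have pos: "Y.traj (?f w) = (length w, \<lambda>i. val (take i w) \<otimes> inv (r (val (take i w))))"
    if "w \<in> L" for w
    using f(2,3)[OF lists[OF that]] by (simp add: trajectory_def)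
  have posH: "val (take i w) \<otimes> inv (r (val (take i w))) \<in> H" if "w \<in> L" for i w
    using r(3) prefix_closed(1)[OF lists[OF that]] by blast
  have right: "fellow_travelling ?c ?H (right_pairs ?H \<psi> L' h)" if h: "h \<in> carrier ?H" for h
  proof (rule fellow_travelling_transfer[where \<Phi> = ?\<Phi>])
    show "fellow_travelling ?c G (right_pairs G \<phi> L h)"
      using c h HG unfolding coarse_combing_def by simp
    fix m p n q assume "((m, p), n, q) \<in> right_pairs ?H \<psi> L' h"
    then obtain v w where vw: "v \<in> L" "val v \<in> H" "w \<in> L" "val w \<in> H" "(m, p) = Y.traj (?f v)"
      "(n, q) = Y.traj (?f w)" "Y.val (?f w) = Y.val (?f v) \<otimes>\<^bsub>?H\<^esub> h"
      unfolding right_pairs_def L'_eq by blast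
    have "(traj v, traj w) \<in> right_pairs G \<phi> L h"
      using vw(7) fval[OF vw(1,2)] fval[OF vw(3,4)] vw(1,3) unfolding right_pairs_def by auto
    moreover have "inv\<^bsub>?H\<^esub> p i \<otimes>\<^bsub>?H\<^esub> q j \<in> ?\<Phi> B" if "inv (snd (traj v) i) \<otimes> snd (traj w) j \<in> B" for B i j
      using close[OF that] vw(5,6) pos[OF vw(1)] pos[OF vw(3)] lists[OF vw(1)] lists[OF vw(3)]
      by (simp add: trajectory_def)
    moreover have "range p \<subseteq> carrier ?H" "range q \<subseteq> carrier ?H" "m = length v" "n = length w"
      using vw(5,6) pos[OF vw(1)] pos[OF vw(3)] posH[OF vw(1)] posH[OF vw(3)] by auto
    ultimately show "\<exists>p' q'. ((m, p'), n, q') \<in> right_pairs G \<phi> L h \<and> range p \<subseteq> carrier ?H \<and>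
        range q \<subseteq> carrier ?H \<and> (\<forall>B i j. inv (p' i) \<otimes> q' j \<in> B \<longrightarrow> inv\<^bsub>?H\<^esub> p i \<otimes>\<^bsub>?H\<^esub> q j \<in> ?\<Phi> B)"
      by - (rule exI[of _ "snd (traj v)"], rule exI[of _ "snd (traj w)"], intro conjI allI impI,
          simp_all only: trajectory_def snd_conv)
  qed (rule \<Phi>_finite)
  have left: "fellow_travelling ?c ?H (left_pairs ?H \<psi> L' h)"
    if h: "h \<in> carrier ?H" and two: "two_sided \<tau>" for h
  proof (rule fellow_travelling_transfer[where \<Phi> = ?\<Phi>])
    have hG: "h \<in> carrier G" "h \<in> H" using h HG by simp_all
    show "fellow_travelling ?c G (left_pairs G \<phi> L h)"
      using c two hG unfolding coarse_combing_def by simp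
    fix m p n q assume "((m, p), n, q) \<in> left_pairs ?H \<psi> L' h"
    then obtain v w where vw: "v \<in> L" "val v \<in> H" "w \<in> L" "val w \<in> H"
      "(m, p) = translate ?H h (Y.traj (?f v))"
      "(n, q) = Y.traj (?f w)" "Y.val (?f w) = h \<otimes>\<^bsub>?H\<^esub> Y.val (?f v)"
      unfolding left_pairs_def L'_eq by blast
    have "(translate G h (traj v), traj w) \<in> left_pairs G \<phi> L h"
      using vw(7) fval[OF vw(1,2)] fval[OF vw(3,4)] vw(1,3) unfolding left_pairs_def by auto
    moreover have p: "m = length v" "p = (\<lambda>i. h \<otimes> (val (take i v) \<otimes> inv (r (val (take i v)))))"
      using vw(5) unfolding pos[OF vw(1)] by (simp_all add: translate_def)
    \<comment> \<open>Left multiplication by \<open>h \<in> H\<close> fixes every coset \<open>H a\<close>, so translating commutes with rewriting.\<close>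
    have r_h: "r (h \<otimes> a) = r a" if a: "a \<in> carrier G" for a
    proof (rule r(5))
      have "h \<otimes> a \<otimes> inv a = h" using a hG by (simp add: m_assoc)
      then show "h \<otimes> a \<otimes> inv a \<in> H" using hG by simp
    qed (use a hG in auto)
    have p': "p i = (h \<otimes> val (take i v)) \<otimes> inv (r (h \<otimes> val (take i v)))" for i
      using p(2) r_h[of "val (take i v)"] lists[OF vw(1)] hG r(2) by (simp add: m_assoc)
    moreover have "inv\<^bsub>?H\<^esub> p i \<otimes>\<^bsub>?H\<^esub> q j \<in> ?\<Phi> B"
      if "inv (snd (translate G h (traj v)) i) \<otimes> snd (traj w) j \<in> B" for B i j
      using close[of "h \<otimes> val (take i v)" "val (take j w)" B] that p'[of i] vw(6) pos[OF vw(3)]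
        lists[OF vw(1)] lists[OF vw(3)] hG
      by (simp add: trajectory_def translate_def)
    moreover have "range p \<subseteq> carrier ?H" "range q \<subseteq> carrier ?H" "n = length w"
      using vw(6) p(2) pos[OF vw(3)] posH[OF vw(1)] posH[OF vw(3)] hG(2) subgroup.m_closed[OF H] by auto
    ultimately show "\<exists>p' q'. ((m, p'), n, q') \<in> left_pairs G \<phi> L h \<and> range p \<subseteq> carrier ?H \<and>
        range q \<subseteq> carrier ?H \<and> (\<forall>B i j. inv (p' i) \<otimes> q' j \<in> B \<longrightarrow> inv\<^bsub>?H\<^esub> p i \<otimes>\<^bsub>?H\<^esub> q j \<in> ?\<Phi> B)"
      unfolding p(1)
      by - (rule exI[of _ "snd (translate G h (traj v))"], rule exI[of _ "snd (traj w)"], intro conjI allI impI,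
          simp_all only: trajectory_def translate_def snd_conv prod.case)
  qed (rule \<Phi>_finite)
  have "[] \<notin> L'" if ne: "[] \<notin> L"
  proof
    assume "[] \<in> L'"
    then obtain w where w: "w \<in> L" "?f w = []" unfolding L'_eq by auto
    then have "length w = 0" using f(2)[OF lists[OF w(1)]] by simp
    then show False using w(1) ne by simp
  qed
  then have "coarse_combing \<tau> ?H \<psi> L'"
    using c rep right left unfolding coarse_combing_def by simp
  then have "combing \<tau> ?H Y \<psi> L'" using L'_lists unfolding Y.combing_iff_coarse by blast
  moreover have "L' \<in> F" unfolding L'_def
    by (rule closed_under_transducer[OF F L finite_X, of "e ` ?T"])
      (use r(1) one_T nxt in \<open>auto simp: out_def\<close>)
  moreover have "bijective_language ?H Y \<psi> L'" if bij: "bijective_language G X \<phi> L"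
    unfolding bijective_language_def
  proof (intro conjI ballI L'_lists)
    fix h assume "h \<in> carrier ?H"
    then have h: "h \<in> H" by simp
    obtain w where w: "w \<in> L'" "Y.val w = h" using rep[OF h] by blast
    have "w' = w" if w': "w' \<in> L'" "Y.val w' = h" for w'
    proof -
      obtain u u' where u: "u \<in> L" "val u \<in> H" "w = ?f u" "u' \<in> L" "val u' \<in> H" "w' = ?f u'"
        using w(1) w'(1) unfolding L'_eq by blast
      then have "val u = h" "val u' = h" using fval w(2) w'(2) by simp_all
      then show ?thesis using bij HG[OF h] u unfolding bijective_language_def by blast
    qed
    then show "\<exists>!w. w \<in> L' \<and> Y.val w = h" using w by blast
  qed
  ultimately show ?thesis using gen by blast
qed

end

section \<open>The closure properties of combings\<close>

lemma finite_kernel_quotient: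
  assumes "N \<lhd> G" "finite N"
  shows "finite_kernel_hom G (G Mod N) (\<lambda>a. N #>\<^bsub>G\<^esub> a)"
proof -
  interpret N: normal N G by fact
  interpret Q: group "G Mod N" by (rule N.factorgroup_is_group)
  interpret pr: group_hom G "G Mod N" "\<lambda>a. N #>\<^bsub>G\<^esub> a"
    by unfold_locales (rule N.r_coset_hom_Mod)
  show ?thesis
  proof unfold_locales
    show "(\<lambda>a. N #>\<^bsub>G\<^esub> a) ` carrier G = carrier (G Mod N)"
      by (auto simp: FactGroup_def RCOSETS_def)
    have "kernel G (G Mod N) (\<lambda>a. N #>\<^bsub>G\<^esub> a) \<subseteq> N"
      using N.coset_join1[OF _ _ N.subgroup_axioms] by (auto simp: kernel_def FactGroup_def)
    then show "finite (kernel G (G Mod N) (\<lambda>a. N #>\<^bsub>G\<^esub> a))"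
      using assms(2) finite_subset by blast
  qed
qed

theorem proposition5p2:
  fixes F :: "nat list set set"
    and \<tau> :: combing_type
    and G :: "('a, 'm) monoid_scheme"
  assumes "language_family F"
    and "group G"
    and "finitely_generated G"
  shows
    "(\<forall>N. N \<lhd> G \<and> finite N \<longrightarrow>
        (has_F_combing F \<tau> G \<longrightarrow> has_F_combing F \<tau> (G Mod N)) \<and>
        (closed_finite_concat F \<and> has_F_combing F \<tau> (G Mod N) \<longrightarrow> has_F_combing F \<tau> G))
     \<and>
     (closed_finite_concat F \<and> \<tau> \<in> {Async, Bd_Async, Sync} \<and> has_F_combing F \<tau> G \<longrightarrow>
        (\<forall>J :: ('a, 'm) monoid_scheme.
           group J \<and> subgroup (carrier G) J \<and> G = J\<lparr>carrier := carrier G\<rparr> \<and>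
           finite (rcosets\<^bsub>J\<^esub> (carrier G)) \<longrightarrow>
           has_F_combing F \<tau> J))
     \<and>
     (closed_eps_free_gsm F \<and> closed_limited_deletion F \<longrightarrow>
        (\<forall>X \<phi> L. F_combing F \<tau> G X \<phi> L \<longrightarrow>
           (\<forall>Y \<psi>. generating_set G Y \<psi> \<longrightarrow> (\<exists>L'. F_combing F \<tau> G Y \<psi> L')) \<and>
           (\<forall>H. subgroup H G \<and> finite (rcosets\<^bsub>G\<^esub> H) \<longrightarrow>
              (\<exists>Y \<psi> L'. F_combing F \<tau> (G\<lparr>carrier := H\<rparr>) Y \<psi> L' \<and>
                 (bijective_language G X \<phi> L \<longrightarrow>
                  bijective_language (G\<lparr>carrier := H\<rparr>) Y \<psi> L')))))"
proof (intro conjI allI impI)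
  fix N assume N: "N \<lhd> G \<and> finite N"
  then interpret pr: finite_kernel_hom G "G Mod N" "\<lambda>a. N #>\<^bsub>G\<^esub> a"
    using finite_kernel_quotient by blast
  show "has_F_combing F \<tau> (G Mod N)" if "has_F_combing F \<tau> G"
    using that pr.marking_image pr.combing_image unfolding has_F_combing_def F_combing_def by meson
  assume *: "closed_finite_concat F \<and> has_F_combing F \<tau> (G Mod N)"
  then obtain X \<phi> L where L: "generating_set (G Mod N) X \<phi>" "combing \<tau> (G Mod N) X \<phi> L" "L \<in> F"
    unfolding has_F_combing_def F_combing_def by blast
  obtain Y \<psi> S where S: "generating_set G Y \<psi>" "finite S"
      "combing \<tau> G Y \<psi> {u @ v | u v. u \<in> L \<and> v \<in> S}"
    using pr.combing_lift[OF L(1,2)] by blast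
  have "{u @ v | u v. u \<in> L \<and> v \<in> S} \<in> F" using * L(3) S(2) unfolding closed_finite_concat_def by simp
  then show "has_F_combing F \<tau> G" using S unfolding has_F_combing_def F_combing_def by blast
next
  fix J :: "('a, 'm) monoid_scheme"
  assume F: "closed_finite_concat F \<and> \<tau> \<in> {Async, Bd_Async, Sync} \<and> has_F_combing F \<tau> G"
    and J: "group J \<and> subgroup (carrier G) J \<and> G = J\<lparr>carrier := carrier G\<rparr> \<and>
      finite (rcosets\<^bsub>J\<^esub> (carrier G))"
  then obtain X \<phi> L where L: "generating_set G X \<phi>" "combing \<tau> G X \<phi> L" "L \<in> F"
    unfolding has_F_combing_def F_combing_def by blast
  have G: "J\<lparr>carrier := carrier G\<rparr> = G" using J by simp
  have "\<not> two_sided \<tau>" using F by (auto simp: two_sided_def)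
  then obtain Y \<psi> S where S: "generating_set J Y \<psi>" "finite S"
      "combing \<tau> J Y \<psi> {u @ v | u v. u \<in> L \<and> v \<in> S}"
    using combing_finite_index_overgroup[of J "carrier G" \<tau> X \<phi> L, unfolded G] J L by blast
  have "{u @ v | u v. u \<in> L \<and> v \<in> S} \<in> F" using F L(3) S(2) unfolding closed_finite_concat_def by simp
  then show "has_F_combing F \<tau> J" using S unfolding has_F_combing_def F_combing_def by blast
next
  fix X \<phi> L assume F: "closed_eps_free_gsm F \<and> closed_limited_deletion F" and L: "F_combing F \<tau> G X \<phi> L"
  then interpret marked_group G X \<phi>
    using assms(2) unfolding F_combing_def marked_group_def marked_group_axioms_def by blast
  have comb: "combing \<tau> G X \<phi> L" "closed_eps_free_gsm F" "L \<in> F"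
    using L F unfolding F_combing_def by blast+
  show "\<exists>L'. F_combing F \<tau> G Y \<psi> L'" if "generating_set G Y \<psi>" for Y \<psi>
    using combing_change_generators[OF that comb] that unfolding F_combing_def by blast
  show "\<exists>Y \<psi> L'. F_combing F \<tau> (G\<lparr>carrier := H\<rparr>) Y \<psi> L' \<and>
      (bijective_language G X \<phi> L \<longrightarrow> bijective_language (G\<lparr>carrier := H\<rparr>) Y \<psi> L')"
    if "subgroup H G \<and> finite (rcosets\<^bsub>G\<^esub> H)" for H
    using combing_finite_index_subgroup[OF _ _ comb, of H] that unfolding F_combing_def by meson
qed

end
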